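(* Let $m>1$ be an integer. Then \begin{align*} \mathcal{N}^-(m^2;X)&\gg X^{\frac{1}{m}}/(\log X)^2,\\ \mathcal{N}^+(m;X)&\gg X^{\frac{1}{m}}/(\log X)^2. \end{align*}
   Context: For a finitely generated abelian group $A$, the $m$-rank $\mathrm{rk}_m A$ is the largest integer $r$ such that $A$ has a subgroup isomorphic to $(\mathbb{Z}/m\mathbb{Z})^r$. For a number field $k$, $\mathrm{Cl}(k)$ is its ideal class group and $d_k$ its absolute discriminant. For integers $m>1$, $r\ge 1$, $\mathcal{N}^-(m^r;X)$ and $\mathcal{N}^+(m^r;X)$ denote the number of imaginary quadratic and real quadratic number fields $k$, respectively, with $|d_k|\leq X$ and $\mathrm{rk}_m\mathrm{Cl}(k)\geq r$ (the notation depends on the pair $(m,r)$; thus $\mathcal{N}^-(m^2;X)$ refers to $r=2$ and $\mathcal{N}^+(m;X)$ to $r=1$). $f(X)\gg h(X)$ means that there are constants $c>0$ and $X_0$ (depending on $m$) with $f(X)\ge c\,h(X)$ for all $X\ge X_0$. *)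

theory Defs
  imports
    Complex_Main
    "HOL-Library.Extended_Nat"
    "HOL-Computational_Algebra.Polynomial"
    "HOL-Algebra.Algebra"
    "HOL-Algebra.Algebraic_Closure_Type"
    "Jordan_Normal_Form.Determinant"
begin

text \<open>
  Number fields are taken inside the complex numbers. A quadratic field is normal over the
  rationals, so each isomorphism class of quadratic fields contains exactly one subfield of the
  complex numbers; counting such subfields therefore counts quadratic fields.
\<close>

abbreviation CC :: "complex ring" where
  "CC \<equiv> ring_of_type_algebra"

definition number_field :: "nat \<Rightarrow> complex set \<Rightarrow> bool" where
  "number_field n K \<longleftrightarrow> subfield K CC \<and> ring.dimension CC n \<rat> K"

definition imaginary_quadratic_field :: "complex set \<Rightarrow> bool" where
  "imaginary_quadratic_field K \<longleftrightarrow> number_field 2 K \<and> \<not> K \<subseteq> \<real>"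

definition real_quadratic_field :: "complex set \<Rightarrow> bool" where
  "real_quadratic_field K \<longleftrightarrow> number_field 2 K \<and> K \<subseteq> \<real>"

definition ring_of_integers :: "complex set \<Rightarrow> complex ring" where
  "ring_of_integers K = CC\<lparr>carrier := {x \<in> K. algebraic_int x}\<rparr>"


section \<open>Discriminant\<close>

text \<open>Embeddings are made extensional so that distinct members differ on \<open>K\<close> itself.\<close>

definition embeddings :: "complex set \<Rightarrow> (complex \<Rightarrow> complex) set" where
  "embeddings K = Ring.ring_hom (CC\<lparr>carrier := K\<rparr>) CC \<inter> extensional K"

definition field_trace :: "complex set \<Rightarrow> complex \<Rightarrow> complex" where
  "field_trace K x = (\<Sum>\<sigma>\<in>embeddings K. \<sigma> x)"

definition integral_basis :: "complex set \<Rightarrow> complex list \<Rightarrow> bool" where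
  "integral_basis K bs \<longleftrightarrow>
     set bs \<subseteq> carrier (ring_of_integers K) \<and>
     (\<forall>x\<in>carrier (ring_of_integers K).
        \<exists>!cs :: int list. length cs = length bs \<and> x = (\<Sum>i<length bs. of_int (cs ! i) * bs ! i))"

definition discriminant :: "complex set \<Rightarrow> int" where
  "discriminant K = (THE d. \<exists>bs. integral_basis K bs \<and>
     of_int d = det (mat (length bs) (length bs) (\<lambda>(i, j). field_trace K (bs ! i * bs ! j))))"


section \<open>Ideal class group\<close>

definition fractional_ideals :: "complex set \<Rightarrow> complex set set" where
  "fractional_ideals K =
     {(\<lambda>x. x / d) ` J |J d. ideal J (ring_of_integers K) \<and> J \<noteq> {0} \<and>
                          d \<in> carrier (ring_of_integers K) \<and> d \<noteq> 0}"

text \<open>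
  The library's \<^const>\<open>ideal_prod\<close> uses its ring argument only for addition and multiplication, so
  \<open>ideal_prod CC I J\<close> is the set of finite nonempty sums of products of elements of \<open>I\<close> and \<open>J\<close>.
\<close>

definition fractional_ideal_group :: "complex set \<Rightarrow> complex set monoid" where
  "fractional_ideal_group K =
     \<lparr>carrier = fractional_ideals K, monoid.mult = ideal_prod CC, one = carrier (ring_of_integers K)\<rparr>"

definition principal_fractional_ideals :: "complex set \<Rightarrow> complex set set" where
  "principal_fractional_ideals K =
     {(\<lambda>x. a * x) ` carrier (ring_of_integers K) |a. a \<in> K \<and> a \<noteq> 0}"

definition class_group :: "complex set \<Rightarrow> complex set set monoid" where
  "class_group K = fractional_ideal_group K Mod principal_fractional_ideals K"


section \<open>Rank\<close>

definition has_power_subgroup :: "nat \<Rightarrow> nat \<Rightarrow> ('a, 'b) monoid_scheme \<Rightarrow> bool" where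
  "has_power_subgroup m r A \<longleftrightarrow>
     (\<exists>H. subgroup H A \<and> A\<lparr>carrier := H\<rparr> \<cong> product_group {..<r} (\<lambda>_. integer_mod_group m))"

text \<open>
  The supremum is taken in the extended naturals to make the rank total. For finitely generated
  \<open>A\<close> and \<open>m > 1\<close> it is attained, and is the largest \<open>r\<close> as in \<open>m_rank_eqI\<close>.
\<close>

definition m_rank :: "nat \<Rightarrow> ('a, 'b) monoid_scheme \<Rightarrow> enat" where
  "m_rank m A = Sup {enat r |r. has_power_subgroup m r A}"

lemma m_rank_eqI:
  assumes "has_power_subgroup m r A" and "\<And>s. has_power_subgroup m s A \<Longrightarrow> s \<le> r"
  shows "m_rank m A = enat r"
  unfolding m_rank_def by (rule antisym, rule Sup_least, use assms in auto, rule Sup_upper, use assms in auto)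


section \<open>Counting functions\<close>

definition N_minus :: "nat \<Rightarrow> nat \<Rightarrow> real \<Rightarrow> nat" where
  "N_minus m r x = card {K. imaginary_quadratic_field K \<and>
     real_of_int \<bar>discriminant K\<bar> \<le> x \<and> enat r \<le> m_rank m (class_group K)}"

definition N_plus :: "nat \<Rightarrow> nat \<Rightarrow> real \<Rightarrow> nat" where
  "N_plus m r x = card {K. real_quadratic_field K \<and>
     real_of_int \<bar>discriminant K\<bar> \<le> x \<and> enat r \<le> m_rank m (class_group K)}"

definition asymp_bounded_below :: "(real \<Rightarrow> real) \<Rightarrow> (real \<Rightarrow> real) \<Rightarrow> bool"
    (infix \<open>\<ggreater>\<close> 50) where
  "f \<ggreater> h \<longleftrightarrow> (\<exists>c>0. \<exists>x0. \<forall>x\<ge>x0. f x \<ge> c * h x)"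

end

theory Submission
  imports
    Defs
    "HOL-Number_Theory.Number_Theory"
    "HOL-Real_Asymp.Real_Asymp"
begin

text \<open>
  Put \<open>\<sigma> = (2m)\<^sup>2\<close>, \<open>S = \<sigma>\<^sup>m\<close> and \<open>Q = S\<^sup>2 - 1\<close>, let \<open>Q\<close> divide \<open>c\<^sup>m - b\<^sup>m\<close> with quotient \<open>z\<close>,
  and let \<open>D = z (z - b\<^sup>m)\<close>. The elements \<open>\<alpha> = 2 z - b\<^sup>m + 2 \<surd>D\<close> and
  \<open>\<gamma> = (S - 1) z + b\<^sup>m + (S - 1) \<surd>D\<close> have norms \<open>(b\<^sup>2)\<^sup>m\<close> and \<open>(b c)\<^sup>m\<close> and are coprime to their
  conjugates, so they generate \<open>m\<close>-th powers of ideals, whose classes have order dividing \<open>m\<close>.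
  For a prime \<open>\<rho>\<close> dividing \<open>m\<close> there are primes \<open>l\<close> dividing \<open>S - 1\<close>, respectively \<open>S + 1\<close>, with
  \<open>l \<equiv> 1\<close> modulo \<open>2 \<rho>\<close>. Modulo a prime above such an \<open>l\<close> the pair \<open>(\<alpha>, \<gamma>)\<close> is \<open>(g, 1)\<close>,
  respectively \<open>(g, -g)\<close>, with a primitive root \<open>g\<close>; hence \<open>\<gamma>\<^sup>i \<alpha>\<^sup>j\<close> is up to sign a \<open>\<rho>\<close>-th power only
  if \<open>\<rho>\<close> divides \<open>i\<close> and \<open>j\<close>. In the imaginary case the sign is the only unit, so the classes generate
  \<open>(\<int>/m)\<^sup>2\<close>; in the real case the units have rank one, which costs one factor.

  With \<open>b = x + y\<close> and \<open>c = \<sigma>\<^sup>2 x + y\<close> one has \<open>c - b = (\<sigma>\<^sup>2 - 1) x\<close> and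
  \<open>c - \<sigma>\<^sup>2 b = - (\<sigma>\<^sup>2 - 1) y\<close>. If \<open>x\<close> and \<open>y\<close> are bounded multiples of primes \<open>p\<close> and \<open>q\<close>, in residue
  classes that force the congruences above, then \<open>p\<close> and \<open>q\<close> divide \<open>D\<close> exactly once and hence ramify,
  and the sign of \<open>D\<close> is opposite to that of \<open>y\<close>. Since the discriminant is \<open>O(p\<^sup>2\<^sup>m)\<close>, it has a bounded number
  of prime factors of the size of \<open>q \<ge> \<surd>p\<close>, so each field comes from boundedly many pairs
  \<open>(p, q)\<close>, and Chebyshev's bound supplies the pairs.
\<close>

text \<open>With \<open>u = sqrt z + sqrt (z - b^m)\<close> and
  \<open>v = S sqrt z - sqrt (z - b^m)\<close> one has \<alpha> = u^2 and \<gamma> = u v.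
  Multiplying u and v by their images under the sign change of \<open>sqrt (z - b^m)\<close> gives
  \<open>b^m\<close> and \<open>S^2 z - (z - b^m) = Q z + b^m = c^m\<close>; this explains both
  norms. \<open>S\<close> is itself an m-th power, so that besides \<open>Q z\<close> also
  \<open>Q (z - b^m) = c^m - (\<sigma>^2 b)^m\<close> is a difference of m-th powers, and each
  factor of \<open>D\<close> can be given a chosen prime divisor through a linear form. \<sigma> is
  the square of 2 m because \<open>S - 1\<close> and \<open>S + 1\<close> then both have a factor
  \<open>V^\<rho> + 1\<close> with V an even multiple of \<rho>, the source of the primes l. The
  factor 2 in the congruence modulo 2 \<rho> makes -1 a \<rho>-th power modulo l, so that signs are
  invisible there. The exponents come from the following balance: for primes up to P there are about
  \<open>P^2 / (log P)^2\<close> pairs, while the discriminants are \<open>O(P^(2m))\<close>. For X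
  of that size this is \<open>X^(1/m) / (log X)^2\<close>, with one logarithm lost for each of the
  two primes.\<close>

hide_const (open) Divisibility.prime

section \<open>Quadratic fields\<close>

lemma CC_simps [simp]:
  "carrier CC = UNIV" "x \<otimes>\<^bsub>CC\<^esub> y = x * y" "\<one>\<^bsub>CC\<^esub> = 1" "\<zero>\<^bsub>CC\<^esub> = 0" "x \<oplus>\<^bsub>CC\<^esub> y = x + y"
  by (simp_all add: ring_of_type_algebra_def)

interpretation CCf: cring CC
  by (rule cring_from_type_algebra)

lemma CC_a_inv [simp]: "\<ominus>\<^bsub>CC\<^esub> x = - x"
  by (rule CCf.minus_equality) auto

lemma CC_m_inv: "x \<noteq> 0 \<Longrightarrow> inv\<^bsub>CC\<^esub> x = inverse x"
  by (rule CCf.comm_inv_char) auto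

definition qfield :: "complex \<Rightarrow> complex set" where
  "qfield s = {of_rat a + of_rat b * s |a b. True}"

text \<open>Among squarefree integers only 1 is a square, so \<open>d_neq_1\<close> is exactly what
  makes \<open>s\<close> irrational. Leaving \<open>s\<close> an arbitrary square root lets one
  locale serve both signs of \<open>d\<close>.\<close>

locale quadratic =
  fixes d :: int and s :: complex
  assumes s_square: "s\<^sup>2 = of_int d" and sqfree: "squarefree d" and d_neq_1: "d \<noteq> 1"
begin

lemma d_nz [simp]: "d \<noteq> 0"
  using sqfree by auto

lemma s_mult [simp]: "s * s = of_int d"
  using s_square by (simp add: power2_eq_square)

lemma s_nz [simp]: "s \<noteq> 0"
  using s_square by auto

lemma s_irrational: "s \<notin> \<rat>"
proof
  assume "s \<in> \<rat>"
  have "algebraic_int (of_int d :: complex)" by (rule int_imp_algebraic_int) auto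
  then have "algebraic_int s"
    using s_square algebraic_int_root[of "s^2" "monom 1 2" s]
    by (auto simp: poly_monom degree_monom_eq)
  then have "s \<in> \<int>" using \<open>s \<in> \<rat>\<close> rational_algebraic_int_is_int by blast
  then obtain k where "s = of_int k" by (auto elim: Ints_cases)
  then have "of_int (k^2) = (of_int d :: complex)" using s_square by simp
  then have "k^2 = d" by (metis of_int_eq_iff)
  then have "k dvd 1" using squarefreeD[OF sqfree] by simp
  then have "k^2 = 1" by (metis abs_1 dvd_abs_iff power2_abs one_power2 zdvd1_eq)
  then show False using \<open>k^2 = d\<close> d_neq_1 by simp
qed

lemma coord_eq_iff [simp]:
  "of_rat a + of_rat b * s = of_rat a' + of_rat b' * s \<longleftrightarrow> a = a' \<and> b = b'"
proof
  assume *: "of_rat a + of_rat b * s = of_rat a' + of_rat b' * s"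
  have "b = b'"
  proof (rule ccontr)
    assume "b \<noteq> b'"
    have "of_rat (b - b') * s = of_rat (a' - a)"
      using * by (simp add: of_rat_diff algebra_simps)
    then have "s = of_rat ((a' - a) / (b - b'))"
      using \<open>b \<noteq> b'\<close> by (simp add: of_rat_divide of_rat_diff field_simps)
    then show False using s_irrational by (metis Rats_of_rat)
  qed
  with * show "a = a' \<and> b = b'" by simp
qed auto

text \<open>Coordinates with respect to 1, \<open>s\<close> are unique, so the description is
  definite on \<open>K\<close>. Outside \<open>K\<close> the value is arbitrary, hence the
  membership premises in the rules below.\<close>

definition cj :: "complex \<Rightarrow> complex" where
  "cj x = (THE y. \<exists>a b. x = of_rat a + of_rat b * s \<and> y = of_rat a - of_rat b * s)"

lemma cj_coord [simp]: "cj (of_rat a + of_rat b * s) = of_rat a - of_rat b * s"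
  unfolding cj_def by (rule the_equality) auto

abbreviation K where "K \<equiv> qfield s"

lemma qfieldI: "of_rat a + of_rat b * s \<in> K"
  by (auto simp: qfield_def)

lemma qfieldE:
  assumes "x \<in> K" obtains a b where "x = of_rat a + of_rat b * s"
  using assms by (auto simp: qfield_def)

lemma rat_in_K [simp]: "of_rat a \<in> K"
  using qfieldI[of a 0] by simp

lemma int_in_K [simp]: "of_int a \<in> K"
  using rat_in_K[of "of_int a"] by simp

lemma one_in_K [simp]: "1 \<in> K" and zero_in_K [simp]: "0 \<in> K"
  using int_in_K[of 1] int_in_K[of 0] by auto

lemma s_in_K [simp]: "s \<in> K"
  using qfieldI[of 0 1] by simp

lemma mult_coord:
  "(of_rat a + of_rat b * s) * (of_rat a' + of_rat b' * s)
    = of_rat (a * a' + of_int d * b * b') + of_rat (a * b' + b * a') * s"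
proof -
  have "(of_rat a + of_rat b * s) * (of_rat a' + of_rat b' * s) =
     of_rat a * of_rat a' + of_rat b * of_rat b' * (s * s) + (of_rat a * of_rat b' + of_rat b * of_rat a') * s"
    by (simp add: algebra_simps)
  then show ?thesis by (simp add: of_rat_add of_rat_mult algebra_simps)
qed

lemma K_add [simp]: "x \<in> K \<Longrightarrow> y \<in> K \<Longrightarrow> x + y \<in> K"
proof (elim qfieldE)
  fix a b a' b' assume "x = of_rat a + of_rat b * s" "y = of_rat a' + of_rat b' * s"
  then have "x + y = of_rat (a + a') + of_rat (b + b') * s" by (simp add: of_rat_add algebra_simps)
  then show ?thesis using qfieldI by simp
qed

lemma K_mult [simp]: "x \<in> K \<Longrightarrow> y \<in> K \<Longrightarrow> x * y \<in> K"
  by (elim qfieldE) (simp only: mult_coord qfieldI)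

lemma K_minus [simp]: "x \<in> K \<Longrightarrow> - x \<in> K"
  using K_mult[OF int_in_K[of "-1"]] by simp

lemma cj_add [simp]: "x \<in> K \<Longrightarrow> y \<in> K \<Longrightarrow> cj (x + y) = cj x + cj y"
proof (elim qfieldE)
  fix a b a' b' assume *: "x = of_rat a + of_rat b * s" "y = of_rat a' + of_rat b' * s"
  then have "x + y = of_rat (a + a') + of_rat (b + b') * s" by (simp add: of_rat_add algebra_simps)
  then show ?thesis using * by (simp only: cj_coord) (simp add: of_rat_add algebra_simps)
qed

lemma cj_mult [simp]: "x \<in> K \<Longrightarrow> y \<in> K \<Longrightarrow> cj (x * y) = cj x * cj y"
proof (elim qfieldE)
  fix a b a' b' assume *: "x = of_rat a + of_rat b * s" "y = of_rat a' + of_rat b' * s"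
  have "(of_rat a - of_rat b * s) * (of_rat a' - of_rat b' * s)
    = of_rat (a * a' + of_int d * b * b') - of_rat (a * b' + b * a') * s"
  proof -
    have "(of_rat a - of_rat b * s) * (of_rat a' - of_rat b' * s) =
      of_rat a * of_rat a' + of_rat b * of_rat b' * (s * s) - (of_rat a * of_rat b' + of_rat b * of_rat a') * s"
      by (simp add: algebra_simps del: s_mult)
    then show ?thesis by (simp add: of_rat_add of_rat_mult algebra_simps)
  qed
  then show ?thesis unfolding * mult_coord cj_coord by simp
qed

lemma cj_in_K [simp]: "x \<in> K \<Longrightarrow> cj x \<in> K"
  by (elim qfieldE) (metis cj_coord qfieldI mult_minus_left of_rat_minus uminus_add_conv_diff add.commute)

lemma cj_cj [simp]: "x \<in> K \<Longrightarrow> cj (cj x) = x"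
proof (elim qfieldE)
  fix a b assume *: "x = of_rat a + of_rat b * s"
  then have "cj x = of_rat a + of_rat (-b) * s" by (simp add: of_rat_minus)
  then have "cj (cj x) = of_rat a - of_rat (-b) * s" by (simp only: cj_coord)
  then show ?thesis using * by (simp add: of_rat_minus)
qed

lemma cj_rat [simp]: "cj (of_rat a) = of_rat a"
  using cj_coord[of a 0] by simp

lemma cj_int [simp]: "cj (of_int a) = of_int a"
  using cj_rat[of "of_int a"] by simp

lemma cj_1 [simp]: "cj 1 = 1" and cj_0 [simp]: "cj 0 = 0"
  using cj_int[of 1] cj_int[of 0] by auto

lemma cj_s [simp]: "cj s = - s"
  using cj_coord[of 0 1] by simp

lemma cj_minus [simp]: "x \<in> K \<Longrightarrow> cj (- x) = - cj x"
  using cj_mult[of "of_int (-1)" x] cj_int[of "-1"] int_in_K[of "-1"] by (simp del: cj_mult cj_int int_in_K)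

lemma cj_eq_0 [simp]: "x \<in> K \<Longrightarrow> cj x = 0 \<longleftrightarrow> x = 0"
  using cj_cj cj_0 by metis

lemma K_power [simp]: "x \<in> K \<Longrightarrow> x ^ n \<in> K"
  by (induct n) auto

lemma cj_power [simp]: "x \<in> K \<Longrightarrow> cj (x ^ n) = cj x ^ n"
  by (induct n) auto

definition nm :: "complex \<Rightarrow> complex" where "nm x = x * cj x"
definition tr :: "complex \<Rightarrow> complex" where "tr x = x + cj x"

lemma nm_rat: assumes "x \<in> K" shows "nm x \<in> \<rat>"
proof -
  obtain a b where x: "x = of_rat a + of_rat b * s" using assms by (rule qfieldE)
  have "nm x = of_rat a * of_rat a - of_rat b * of_rat b * (s * s)"
    by (simp add: nm_def x algebra_simps)
  then show ?thesis by simp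
qed

lemma tr_rat: assumes "x \<in> K" shows "tr x \<in> \<rat>"
proof -
  obtain a b where x: "x = of_rat a + of_rat b * s" using assms by (rule qfieldE)
  then show ?thesis by (simp add: tr_def)
qed

lemma K_inverse [simp]: assumes "x \<in> K" shows "inverse x \<in> K"
proof (cases "x = 0")
  case False
  obtain r where r: "nm x = of_rat r" using nm_rat[OF assms] by (auto elim: Rats_cases)
  have "inverse x = of_rat (1 / r) * cj x"
    using False assms r[symmetric] by (simp add: nm_def of_rat_divide field_simps)
  then show ?thesis using assms by simp
qed auto

lemma K_divide [simp]: "x \<in> K \<Longrightarrow> y \<in> K \<Longrightarrow> x / y \<in> K"
  by (simp add: divide_inverse)

lemma cj_inverse [simp]: "x \<in> K \<Longrightarrow> cj (inverse x) = inverse (cj x)"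
  by (metis K_inverse cj_1 cj_mult cj_0 inverse_unique inverse_zero left_inverse mult.commute)

lemma subfield_K: "subfield K CC"
proof (rule field.subfieldI'[OF field_from_type_algebra])
  show "subring K CC"
    by (rule CCf.subringI) auto
  show "inv\<^bsub>CC\<^esub> k \<in> K" if "k \<in> K - {\<zero>\<^bsub>CC\<^esub>}" for k
    using that by (auto simp: CC_m_inv)
qed

lemma number_field_K: "number_field 2 K"
proof -
  have Q: "CCf.line_extension \<rat> a E = {x * a + y |x y. x \<in> \<rat> \<and> y \<in> E}" for a E
    by (auto simp: CCf.line_extension_def set_add_def set_mult_def r_coset_def)
  \<comment> \<open>\<open>dimension\<close> is inductive on line extensions: \<open>K\<close>
    arises from the zero space by adjoining first 1 and then \<open>s\<close>.\<close>
  have 1: "CCf.dimension (Suc 0) \<rat> (CCf.line_extension \<rat> 1 {0})"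
    by (rule CCf.Suc_dim) (use CCf.zero_dim in auto)
  have eq1: "CCf.line_extension \<rat> 1 {0} = \<rat>" unfolding Q by auto
  have 2: "CCf.dimension (Suc (Suc 0)) \<rat> (CCf.line_extension \<rat> s \<rat>)"
    by (rule CCf.Suc_dim) (use 1 eq1 s_irrational in auto)
  have eq2: "CCf.line_extension \<rat> s \<rat> = K" unfolding Q
    by (auto simp: qfield_def elim!: Rats_cases) (metis Rats_of_rat add.commute)+
  show ?thesis using 2 subfield_K unfolding eq2 number_field_def by (simp add: numeral_2_eq_2)
qed

lemma imaginary_K: "d < 0 \<Longrightarrow> imaginary_quadratic_field K"
proof -
  assume "d < 0"
  have "s \<notin> \<real>"
  proof
    assume "s \<in> \<real>" then obtain r where "s = of_real r" by (auto elim: Reals_cases)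
    then have "of_real (r^2) = (of_real (of_int d) :: complex)" using s_square by simp
    then have "r^2 = of_int d" by (metis of_real_eq_iff)
    then show False using \<open>d < 0\<close> by (metis of_int_less_0_iff not_less zero_le_power2)
  qed
  then show ?thesis using number_field_K s_in_K unfolding imaginary_quadratic_field_def by blast
qed

lemma s_real: "d > 0 \<Longrightarrow> s \<in> \<real>"
proof -
  assume "d > 0"
  have "(s - of_real (sqrt (of_int d))) * (s + of_real (sqrt (of_int d))) = 0"
    using \<open>d > 0\<close> by (simp add: algebra_simps flip: of_real_mult)
  then have "s = of_real (sqrt (of_int d)) \<or> s = - of_real (sqrt (of_int d))"
    by (auto simp: add_eq_0_iff2)
  then show ?thesis by (metis Reals_minus Reals_of_real)
qed

lemma real_K: "d > 0 \<Longrightarrow> real_quadratic_field K"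
proof -
  assume "d > 0"
  have "(of_rat r :: complex) \<in> \<real>" for r by (cases r) (auto simp: of_rat_rat)
  then show ?thesis using \<open>d > 0\<close> number_field_K s_real unfolding real_quadratic_field_def
    by (auto simp: qfield_def)
qed

end

section \<open>Normal form of an arbitrary quadratic field\<close>

lemma quadratic_decomp:
  fixes e :: int and t :: complex
  assumes "t^2 = of_int e" "t \<notin> \<rat>"
  obtains d f s where "quadratic d s" "e = d * f^2" "f \<noteq> 0" "t = of_int f * s"
proof -
  define d where "d = squarefree_part e"
  define f where "f = square_part e"
  have e: "e = d * f^2" using squarefree_decompose[of e] by (simp add: d_def f_def)
  have "f \<noteq> 0" using assms by (auto simp: e)
  define s where "s = t / of_int f"
  have ts: "t = of_int f * s" using \<open>f \<noteq> 0\<close> by (simp add: s_def)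
  have s2: "s^2 = of_int d" using assms(1) \<open>f \<noteq> 0\<close> by (simp add: s_def e power_divide)
  have "d \<noteq> 1"
  proof
    assume "d = 1"
    then have "(s - 1) * (s + 1) = 0" using s2 by (simp add: algebra_simps power2_eq_square)
    then have "s = 1 \<or> s = -1" by (auto simp: add_eq_0_iff2)
    then have "s \<in> \<rat>" by auto
    then show False using assms(2) ts by auto
  qed
  then have "quadratic d s" using s2 by unfold_locales (auto simp: d_def)
  then show ?thesis using that e \<open>f \<noteq> 0\<close> ts by blast
qed

text \<open>Completing the square yields a generator of the form \<open>(F * S / k + C) / 2\<close>.
  These are the field identities that pass between the basis 1, that generator and the basis 1,
  \<open>S\<close>.\<close>

lemma change_generator:
  fixes k A B C F S :: complex
  shows "A + B * ((F * S / k + C) / 2) = A + B * C / 2 + B * F / (2 * k) * S"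
    and "k \<noteq> 0 \<Longrightarrow> F \<noteq> 0 \<Longrightarrow>
      A + B * S = A - B * k * C / F + 2 * B * k / F * ((F * S / k + C) / 2)"
proof -
  show "A + B * ((F * S / k + C) / 2) = A + B * C / 2 + B * F / (2 * k) * S"
    by (simp add: add_divide_distrib distrib_left mult_ac)
next
  assume "k \<noteq> 0" "F \<noteq> 0"
  have "2 * B * k / F * ((F * S / k + C) / 2) = B * (k / k) * (F / F) * S + B * k * C / F"
    by (simp add: add_divide_distrib distrib_left mult_ac)
  then show "A + B * S = A - B * k * C / F + 2 * B * k / F * ((F * S / k + C) / 2)"
    using \<open>k \<noteq> 0\<close> \<open>F \<noteq> 0\<close> by simp
qed

text \<open>An irrational \<open>w\<close> in \<open>K\<close> spans \<open>K\<close> together with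
  1 and satisfies a quadratic equation; completing the square, clearing denominators and removing
  square factors leads to a squarefree \<open>d\<close>.\<close>

lemma number_field_2E:
  assumes "number_field 2 K"
  obtains d s where "quadratic d s" "K = qfield s"
proof -
  have sub: "subfield K CC" and dim: "CCf.dimension 2 \<rat> K" using assms by (auto simp: number_field_def)
  have Q: "CCf.line_extension \<rat> a E = {x * a + y |x y. x \<in> \<rat> \<and> y \<in> E}" for a E
    by (auto simp: CCf.line_extension_def set_add_def set_mult_def r_coset_def)
  have ring: "subring K CC"
    using sub by (simp add: subfield_def subdomain_def subcring_def)
  have closed: "\<And>x y. x \<in> K \<Longrightarrow> y \<in> K \<Longrightarrow> x * y \<in> K" "1 \<in> K"
    using subringE(3,6)[OF ring] by auto
  obtain v E' where E': "CCf.dimension 1 \<rat> E'" "v \<notin> E'" "K = CCf.line_extension \<rat> v E'"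
    using dim by (cases rule: CCf.dimension.cases) auto
  obtain u E'' where E'': "CCf.dimension 0 \<rat> E''" "u \<notin> E''" "E' = CCf.line_extension \<rat> u E''"
    using E'(1) by (cases rule: CCf.dimension.cases) auto
  have "E'' = {0}" using E''(1) by (cases rule: CCf.dimension.cases) auto
  then have E'_eq: "E' = {x * u |x. x \<in> \<rat>}" and "u \<noteq> 0" using E'' by (auto simp: Q)
  have K_eq: "K = {x * v + y * u |x y. x \<in> \<rat> \<and> y \<in> \<rat>}" unfolding E'(3) Q E'_eq by auto
  then have K_I: "\<And>x y. x \<in> \<rat> \<Longrightarrow> y \<in> \<rat> \<Longrightarrow> x * v + y * u \<in> K" by blast
  obtain x0 y0 where one: "1 = x0 * v + y0 * u" "x0 \<in> \<rat>" "y0 \<in> \<rat>"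
    using closed(2) unfolding K_eq by auto
  have "\<exists>w\<in>K. w \<notin> \<rat>"
  proof (rule ccontr)
    assume "\<not> ?thesis"
    then have sub: "K \<subseteq> \<rat>" by auto
    have "v = 1 * v + 0 * u" "u = 0 * v + 1 * u" by auto
    then have "v \<in> K" "u \<in> K" unfolding K_eq using Rats_0 Rats_1 by blast+
    then have "v / u \<in> \<rat>" using sub by (meson Rats_divide subsetD)
    then show False using E'(2) \<open>u \<noteq> 0\<close> unfolding E'_eq by (auto intro!: exI[of _ "v / u"])
  qed
  then obtain w where w: "w \<in> K" "w \<notin> \<rat>" by blast
  then obtain x1 y1 where w_eq: "w = x1 * v + y1 * u" "x1 \<in> \<rat>" "y1 \<in> \<rat>" unfolding K_eq by auto
  \<comment> \<open>The determinant of the coordinates of 1, \<open>w\<close> in the basis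
    \<open>v\<close>, \<open>u\<close>: the next two equations are Cramer's rule, and irrationality
    of \<open>w\<close> makes it nonzero.\<close>
  define \<delta> where "\<delta> = x0 * y1 - x1 * y0"
  have dv: "\<delta> * v = y1 - y0 * w" and du: "\<delta> * u = x0 * w - x1"
  proof -
    have "y1 * 1 - y0 * w = \<delta> * v" by (subst one(1), subst w_eq(1)) (simp add: \<delta>_def algebra_simps)
    then show "\<delta> * v = y1 - y0 * w" by simp
    have "x0 * w - x1 * 1 = \<delta> * u" by (subst one(1), subst w_eq(1)) (simp add: \<delta>_def algebra_simps)
    then show "\<delta> * u = x0 * w - x1" by simp
  qed
  have "\<delta> \<noteq> 0"
  proof
    assume "\<delta> = 0"
    then have *: "y0 * w = y1" "x0 * w = x1" using dv du by auto
    have "y0 = 0"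
    proof (rule ccontr)
      assume "y0 \<noteq> 0" then have "w = y1 / y0" using * by (simp add: field_simps)
      then show False using w one w_eq by auto
    qed
    moreover have "x0 = 0"
    proof (rule ccontr)
      assume "x0 \<noteq> 0" then have "w = x1 / x0" using * by (simp add: field_simps)
      then show False using w one w_eq by auto
    qed
    ultimately show False using one by simp
  qed
  have \<delta>: "\<delta> \<in> \<rat>" using one w_eq by (auto simp: \<delta>_def)
  have K_w: "\<exists>a b. z = of_rat a + of_rat b * w" if zK: "z \<in> K" for z
  proof -
    obtain x y where xy: "z = x * v + y * u" "x \<in> \<rat>" "y \<in> \<rat>" using zK unfolding K_eq by blast
    have "z = (x * (\<delta> * v) + y * (\<delta> * u)) / \<delta>" using \<open>\<delta> \<noteq> 0\<close> by (simp add: xy field_simps)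
    also have "\<dots> = (x * y1 - y * x1) / \<delta> + ((y * x0 - x * y0) / \<delta>) * w"
      unfolding dv du using \<open>\<delta> \<noteq> 0\<close> by (simp add: field_simps)
    finally show ?thesis using xy one w_eq \<delta> by (metis Rats_cases Rats_diff Rats_divide Rats_mult)
  qed
  have w_K: "of_rat a + of_rat b * w \<in> K" for a b
  proof -
    have "of_rat a + of_rat b * w = (of_rat a * x0 + of_rat b * x1) * v + (of_rat a * y0 + of_rat b * y1) * u"
    proof -
      have "of_rat a * 1 + of_rat b * w = (of_rat a * x0 + of_rat b * x1) * v + (of_rat a * y0 + of_rat b * y1) * u"
        by (subst one(1), subst w_eq(1)) (simp add: algebra_simps)
      then show ?thesis by simp
    qed
    moreover have "(of_rat a * x0 + of_rat b * x1) * v + (of_rat a * y0 + of_rat b * y1) * u \<in> K"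
      by (rule K_I) (use one(2,3) w_eq(2,3) in auto)
    ultimately show ?thesis by simp
  qed
  obtain a b where ww: "w * w = of_rat a + of_rat b * w" using K_w[OF closed(1)[OF w(1) w(1)]] by blast
  define D where "D = b^2 + 4 * a"
  have sq: "(2 * w - of_rat b)^2 = of_rat D"
  proof -
    have "(2 * w - of_rat b)^2 = 4 * (w * w) - 4 * of_rat b * w + of_rat b ^ 2"
      by (simp add: power2_eq_square algebra_simps)
    also have "\<dots> = of_rat D"
      unfolding ww D_def by (simp add: of_rat_add of_rat_mult power2_eq_square algebra_simps)
    finally show ?thesis .
  qed
  obtain n k where nk: "D = of_int n / of_int k" "k > 0" by (metis Fract_of_int_quotient quotient_of_div quotient_of_denom_pos surj_pair)
  \<comment> \<open>\<open>D\<close> may be a fraction \<open>n / k\<close>; multiplying its square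
    root by \<open>k\<close> gives the square \<open>k^2 D = n k\<close>, an integer.\<close>
  define t where "t = of_int k * (2 * w - of_rat b)"
  have t2: "t^2 = of_int (n * k)"
  proof -
    have "t^2 = of_int k ^ 2 * of_rat D" unfolding t_def power_mult_distrib sq ..
    then show ?thesis using nk by (simp add: of_rat_divide power2_eq_square)
  qed
  have w_t: "w = (t / of_int k + of_rat b) / 2" using nk by (simp add: t_def)
  have "t \<notin> \<rat>"
  proof
    assume "t \<in> \<rat>"
    then have "w \<in> \<rat>" unfolding w_t by simp
    then show False using w(2) by simp
  qed
  then obtain d f s where q: "quadratic d s" "f \<noteq> 0" "t = of_int f * s"
    using quadratic_decomp[OF t2] by metis
  have "K = qfield s"
  proof
    show "K \<subseteq> qfield s"
    proof
      fix z assume "z \<in> K"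
      then obtain a' b' where "z = of_rat a' + of_rat b' * w" using K_w by blast
      then have "z = of_rat (a' + b' * b / 2) + of_rat (b' * of_int f / (2 * of_int k)) * s"
        using change_generator(1)[of "of_rat a'" "of_rat b'" "of_int f" s "of_int k" "of_rat b"]
        by (simp add: w_t q(3) of_rat_add of_rat_mult of_rat_divide)
      then show "z \<in> qfield s" unfolding qfield_def by blast
    qed
    show "qfield s \<subseteq> K"
    proof
      fix z assume "z \<in> qfield s"
      then obtain a' b' where z: "z = of_rat a' + of_rat b' * s" by (auto simp: qfield_def)
      have "z = of_rat (a' - b' * of_int k * b / of_int f) + of_rat (2 * b' * of_int k / of_int f) * w"
        using change_generator(2)[of "of_int k" "of_int f" "of_rat a'" "of_rat b'" s "of_rat b"] nk(2) q(2)
        by (simp add: z w_t q(3) of_rat_add of_rat_diff of_rat_mult of_rat_divide)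
      then show "z \<in> K" using w_K by simp
    qed
  qed
  then show ?thesis using that q(1) by blast
qed

section \<open>Integral elements of a quadratic field\<close>

lemma coeff_pcompose_Ints:
  assumes "\<And>i. coeff p i \<in> \<int>" "\<And>i. coeff q i \<in> \<int>"
  shows "coeff (pcompose p q) i \<in> (\<int> :: 'a :: comm_ring_1 set)"
  using assms(1)
proof (induction p arbitrary: i)
  case (pCons a p)
  have "coeff p j \<in> \<int>" for j using pCons.prems[of "Suc j"] by simp
  then have IH: "coeff (pcompose p q) j \<in> \<int>" for j using pCons.IH by blast
  have "coeff (q * pcompose p q) i \<in> \<int>"
    unfolding coeff_mult by (intro Ints_sum Ints_mult assms(2) IH)
  moreover have "coeff [:a:] i \<in> \<int>" using pCons.prems[of 0] by (cases i) auto
  ultimately show ?case by (simp add: pcompose_pCons)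
qed auto

text \<open>Substituting X - 1 keeps the polynomial monic with integer coefficients. The shift by 1
  is what makes traces accessible through norms in \<open>algebraic_int_tr\<close>.\<close>

lemma algebraic_int_add_1:
  assumes "algebraic_int x" shows "algebraic_int (x + 1)"
proof -
  obtain p where p: "lead_coeff p = 1" "\<forall>i. coeff p i \<in> \<int>" "poly p x = 0"
    using assms by (auto elim: algebraic_int.cases)
  have "coeff [:-1, 1 :: 'a:] i \<in> \<int>" for i by (auto simp: coeff_pCons split: nat.splits)
  then have "\<forall>i. coeff (pcompose p [:-1, 1:]) i \<in> \<int>" using p coeff_pcompose_Ints by blast
  moreover have "lead_coeff (pcompose p [:-1, 1:]) = 1" using p by (subst lead_coeff_comp) auto
  moreover have "poly (pcompose p [:-1, 1:]) (x + 1) = 0" using p by (simp add: poly_pcompose)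
  ultimately show ?thesis by (intro algebraic_int.intros)
qed

text \<open>All powers of a reduced denominator would divide \<open>M\<close>, whereas
  \<open>2 ^ M > M\<close>.\<close>

lemma bounded_denominator_imp_Ints:
  assumes "r \<in> (\<rat> :: complex set)" "M > 0" "\<And>k. of_int M * r ^ k \<in> \<int>"
  shows "r \<in> \<int>"
proof -
  obtain a b :: int where ab: "b > 0" "coprime a b" "r = of_int a / of_int b"
    using assms(1) by (auto elim: Rats_cases')
  have dvd: "b ^ k dvd M" for k
  proof -
    obtain z where "of_int M * r ^ k = of_int z" using assms(3)[of k] by (auto elim: Ints_cases)
    then have "of_int (M * a ^ k) = (of_int (z * b ^ k) :: complex)"
      using ab(1) by (simp add: ab(3) field_simps)
    then have "M * a ^ k = z * b ^ k" by (metis of_int_eq_iff)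
    then have "b ^ k dvd M * a ^ k" by simp
    moreover have "coprime (b ^ k) (a ^ k)" using ab(2) by (simp add: coprime_commute)
    ultimately show ?thesis by (metis coprime_dvd_mult_left_iff)
  qed
  have "b = 1"
  proof (rule ccontr)
    assume "b \<noteq> 1"
    then have "b \<ge> 2" using ab by simp
    have "int (nat M) < 2 ^ nat M" by (metis of_nat_less_two_power)
    also have "\<dots> \<le> b ^ nat M" using \<open>b \<ge> 2\<close> by (intro power_mono) auto
    also have "\<dots> \<le> M" using dvd assms(2) zdvd_imp_le by blast
    finally show False using assms(2) by simp
  qed
  then show ?thesis using ab by simp
qed

context quadratic
begin

lemma nm_mult: "x \<in> K \<Longrightarrow> y \<in> K \<Longrightarrow> nm (x * y) = nm x * nm y"
  by (simp add: nm_def mult_ac)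

lemma nm_power: "x \<in> K \<Longrightarrow> nm (x ^ n) = nm x ^ n"
  by (simp add: nm_def power_mult_distrib)

text \<open>The monic equation expresses every power of \<open>x\<close> through the first
  \<open>degree p\<close> powers with integer coefficients, so a common denominator of these
  finitely many powers serves for all.\<close>

lemma bounded_denominator:
  assumes "x \<in> K" "algebraic_int x"
  obtains M :: int where "M > 0" "\<And>k. \<exists>a b. of_int M * x ^ k = of_int a + of_int b * s"
proof -
  obtain p where p: "lead_coeff p = 1" "\<forall>i. coeff p i \<in> \<int>" "poly p x = 0"
    using assms by (auto elim: algebraic_int.cases)
  define n where "n = degree p"
  have "\<exists>M>0. \<forall>k<N. \<exists>a b. of_int M * x ^ k = of_int a + of_int b * s" for N
  proof (induction N)
    case 0 show ?case by (intro exI[of _ 1]) auto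
  next
    case (Suc N)
    then obtain M where M: "M > 0" "\<forall>k<N. \<exists>a b. of_int M * x ^ k = of_int a + of_int b * s" by blast
    have "x ^ N \<in> K" using assms by simp
    then obtain a b where ab: "x ^ N = of_rat a + of_rat b * s" by (rule qfieldE)
    obtain a1 a2 where a: "a = of_int a1 / of_int a2" "a2 > 0"
      by (metis Fract_of_int_quotient quotient_of_div quotient_of_denom_pos surj_pair)
    obtain b1 b2 where b: "b = of_int b1 / of_int b2" "b2 > 0"
      by (metis Fract_of_int_quotient quotient_of_div quotient_of_denom_pos surj_pair)
    show ?case
    proof (rule exI[of _ "M * (a2 * b2)"], intro conjI allI impI)
      show "M * (a2 * b2) > 0" using M a b by simp
      fix k assume "k < Suc N"
      show "\<exists>u v. of_int (M * (a2 * b2)) * x ^ k = of_int u + of_int v * s"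
      proof (cases "k = N")
        case True
        have "of_int (M * (a2 * b2)) * x ^ k = of_int (M * a1 * b2) + of_int (M * b1 * a2) * s"
          using a(2) b(2) unfolding True ab a(1) b(1) by (simp add: of_rat_divide field_simps)
        then show ?thesis by blast
      next
        case False
        then obtain u v where uv: "of_int M * x ^ k = of_int u + of_int v * s"
          using M(2) \<open>k < Suc N\<close> less_antisym by blast
        have "of_int (M * (a2 * b2)) * x ^ k = of_int (a2 * b2) * (of_int M * x ^ k)" by simp
        also have "\<dots> = of_int (a2 * b2 * u) + of_int (a2 * b2 * v) * s"
          unfolding uv by (simp add: algebra_simps)
        finally have "of_int (M * (a2 * b2)) * x ^ k = of_int (a2 * b2 * u) + of_int (a2 * b2 * v) * s" .
        then show ?thesis by blast
      qed
    qed
  qed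
  then obtain M where M: "M > 0" "\<forall>k<n. \<exists>a b. of_int M * x ^ k = of_int a + of_int b * s" by blast
  have xn: "x ^ n = (\<Sum>i<n. - coeff p i * x ^ i)"
  proof -
    have "0 = (\<Sum>i\<le>n. coeff p i * x ^ i)" using p by (simp add: poly_altdef n_def)
    also have "\<dots> = (\<Sum>i<n. coeff p i * x ^ i) + x ^ n"
      using p by (simp add: n_def lessThan_Suc_atMost[symmetric])
    finally show ?thesis by (simp add: sum_negf add_eq_0_iff2)
  qed
  have sum_closed: "\<exists>a b. (\<Sum>i\<in>A. f i) = of_int a + of_int b * s"
    if "finite A" "\<And>i. i \<in> A \<Longrightarrow> \<exists>a b. f i = of_int a + of_int b * s" for A :: "nat set" and f
    using that
  proof (induction A rule: finite_induct)
    case empty show ?case by (intro exI[of _ 0]) auto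
  next
    case (insert i A)
    then obtain a b a' b' where "f i = of_int a + of_int b * s" "sum f A = of_int a' + of_int b' * s" by blast
    then have "sum f (insert i A) = of_int (a + a') + of_int (b + b') * s" using insert by (simp add: algebra_simps)
    then show ?case by blast
  qed
  have "\<exists>a b. of_int M * x ^ k = of_int a + of_int b * s" for k
  proof (induction k rule: less_induct)
    case (less k)
    show ?case
    proof (cases "k < n")
      case False
      have "of_int M * x ^ k = of_int M * (x ^ n * x ^ (k - n))" using False by (simp flip: power_add)
      also have "\<dots> = (\<Sum>i<n. - coeff p i * (of_int M * x ^ (i + (k - n))))"
        unfolding xn sum_distrib_right sum_distrib_left by (intro sum.cong refl) (simp add: power_add mult_ac)
      finally have eq: "of_int M * x ^ k = (\<Sum>i<n. - coeff p i * (of_int M * x ^ (i + (k - n))))" .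
      show ?thesis unfolding eq
      proof (rule sum_closed)
        fix i assume i: "i \<in> {..<n}"
        then have "i + (k - n) < k" using False by auto
        then obtain a b where ab: "of_int M * x ^ (i + (k - n)) = of_int a + of_int b * s"
          using less.IH[of "i + (k - n)"] \<open>i + (k - n) < k\<close> by blast
        obtain c where c: "coeff p i = of_int c" using p by (auto elim: Ints_cases)
        have "- coeff p i * (of_int M * x ^ (i + (k - n))) = of_int (- c * a) + of_int (- c * b) * s"
          unfolding ab c by (simp add: algebra_simps)
        then show "\<exists>a b. - coeff p i * (of_int M * x ^ (i + (k - n))) = of_int a + of_int b * s" by blast
      qed auto
    qed (use M in auto)
  qed
  then show ?thesis using that M by blast
qed

lemma algebraic_int_nm:
  assumes "x \<in> K" "algebraic_int x" shows "nm x \<in> \<int>"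
proof -
  obtain M where M: "M > 0" "\<And>k. \<exists>a b. of_int M * x ^ k = of_int a + of_int b * s"
    using bounded_denominator[OF assms] by blast
  \<comment> \<open>The left side is the norm of \<open>M x^k\<close>, an element with integer
    coordinates; the powers of the norm of \<open>x\<close> thus have the common denominator
    \<open>M^2\<close>.\<close>
  have "of_int (M^2) * nm x ^ k \<in> \<int>" for k
  proof -
    obtain a b where ab: "of_int M * x ^ k = of_int a + of_int b * s" using M by blast
    have "of_int (M^2) * nm x ^ k = nm (of_int M * x ^ k)"
      using assms by (simp add: nm_mult nm_power) (simp add: nm_def power2_eq_square)
    also have "\<dots> = of_int a * of_int a - of_int b * of_int b * (s * s)"
      unfolding ab by (simp add: nm_def algebra_simps)
    also have "\<dots> = of_int (a * a - b * b * d)" by simp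
    finally show ?thesis by (metis Ints_of_int)
  qed
  then show ?thesis using bounded_denominator_imp_Ints[OF nm_rat[OF assms(1)], of "M^2"] M by simp
qed

text \<open>The trace is the cross term in the norm of \<open>x + 1\<close>, which reduces the claim
  to norms.\<close>

lemma algebraic_int_tr:
  assumes "x \<in> K" "algebraic_int x" shows "tr x \<in> \<int>"
proof -
  have "nm (x + 1) = nm x + tr x + 1" using assms by (simp add: nm_def tr_def algebra_simps)
  then have "tr x = nm (x + 1) - nm x - 1" by simp
  then show ?thesis using algebraic_int_nm[OF assms] algebraic_int_nm[of "x + 1"] assms
    by (simp add: algebraic_int_add_1)
qed

lemma algebraic_int_iff:
  assumes "x \<in> K"
  shows "algebraic_int x \<longleftrightarrow> tr x \<in> \<int> \<and> nm x \<in> \<int>"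
proof
  assume "tr x \<in> \<int> \<and> nm x \<in> \<int>"
  moreover have "poly [:nm x, - tr x, 1:] x = 0" by (simp add: nm_def tr_def algebra_simps)
  ultimately show "algebraic_int x"
    by (intro algebraic_int.intros[of "[:nm x, - tr x, 1:]"]) (auto simp: coeff_pCons split: nat.splits)
qed (use algebraic_int_nm algebraic_int_tr assms in auto)

text \<open>Trace and negated norm of the standard generator \<open>w\<close> of the ring of
  integers, which is a root of \<open>X^2 - tw X - nw\<close>.\<close>

definition tw :: int where "tw = (if d mod 4 = 1 then 1 else 0)"
definition nw :: int where "nw = (if d mod 4 = 1 then (d - 1) div 4 else d)"
definition w :: complex where "w = (if d mod 4 = 1 then (1 + s) / 2 else s)"

lemma w_in_K [simp]: "w \<in> K"
  unfolding w_def using K_divide[OF _ int_in_K[of 2], of "1 + s"] by simp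

lemma cj_w: "cj w = of_int tw - w"
proof -
  have "cj ((1 + s) / of_int 2) = cj ((1 + s)) * cj (inverse (of_int 2))"
    unfolding divide_inverse by (intro cj_mult) (auto intro: K_inverse simp del: of_int_numeral)
  also have "\<dots> = (1 - s) / 2" by (subst cj_inverse) (auto simp del: of_int_numeral, simp)
  finally show ?thesis by (auto simp: w_def tw_def field_simps)
qed

lemma w_square: "w * w = of_int tw * w + of_int nw"
proof (cases "d mod 4 = 1")
  case True
  then obtain e where e: "d = 1 + 4 * e" by (metis add.commute mult_div_mod_eq)
  then have "s * s = 1 + 4 * of_int e" "(d - 1) div 4 = e" using s_mult by simp_all
  then show ?thesis using True by (simp add: w_def tw_def nw_def field_simps del: s_mult)
qed (simp add: w_def tw_def nw_def)

lemma s_eq_w: "\<exists>a b. s = of_int a + of_int b * w"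
proof (cases "d mod 4 = 1")
  case True
  have "s = of_int (-1) + of_int 2 * w" using True by (simp add: w_def)
  then show ?thesis by blast
next
  case False
  have "s = of_int 0 + of_int 1 * w" using False by (simp add: w_def)
  then show ?thesis by blast
qed

lemma w_irrational: "w \<notin> \<rat>"
  using s_irrational s_eq_w by (metis Rats_add Rats_mult Rats_of_int)

lemma w_coord_eq_iff [simp]:
  "of_int a + of_int b * w = of_int a' + of_int b' * w \<longleftrightarrow> a = a' \<and> b = b'"
proof
  assume *: "of_int a + of_int b * w = of_int a' + of_int b' * w"
  have "b = b'"
  proof (rule ccontr)
    assume "b \<noteq> b'"
    then have "w = of_int (a' - a) / of_int (b - b')" using * by (simp add: field_simps)
    then show False using w_irrational by (metis Rats_divide Rats_of_int)
  qed
  with * show "a = a' \<and> b = b'" by simp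
qed auto

definition IK :: "complex set" where "IK = {of_int a + of_int b * w |a b. True}"

lemma IK_I: "of_int a + of_int b * w \<in> IK" by (auto simp: IK_def)
lemma IK_E: assumes "x \<in> IK" obtains a b where "x = of_int a + of_int b * w"
  using assms by (auto simp: IK_def)

lemma IK_in_K: "x \<in> IK \<Longrightarrow> x \<in> K" by (elim IK_E) auto

lemma IK_int [simp]: "of_int a \<in> IK" using IK_I[of a 0] by simp
lemma IK_1 [simp]: "1 \<in> IK" and IK_0 [simp]: "0 \<in> IK" using IK_int[of 1] IK_int[of 0] by auto

lemma IK_add [simp]: "x \<in> IK \<Longrightarrow> y \<in> IK \<Longrightarrow> x + y \<in> IK"
proof (elim IK_E)
  fix a b a' b' assume "x = of_int a + of_int b * w" "y = of_int a' + of_int b' * w"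
  then have "x + y = of_int (a + a') + of_int (b + b') * w" by (simp add: algebra_simps)
  then show ?thesis using IK_I by metis
qed

lemma IK_mult [simp]: "x \<in> IK \<Longrightarrow> y \<in> IK \<Longrightarrow> x * y \<in> IK"
proof (elim IK_E)
  fix a b a' b' assume "x = of_int a + of_int b * w" "y = of_int a' + of_int b' * w"
  then have "x * y = of_int a * of_int a' + (of_int a * of_int b' + of_int b * of_int a') * w + of_int b * of_int b' * (w * w)"
    by (simp add: algebra_simps)
  also have "\<dots> = of_int (a * a' + b * b' * nw) + of_int (a * b' + b * a' + b * b' * tw) * w"
    unfolding w_square by (simp add: algebra_simps)
  finally show ?thesis using IK_I by metis
qed

lemma IK_minus [simp]: "x \<in> IK \<Longrightarrow> - x \<in> IK" using IK_mult[OF IK_int[of "-1"]] by simp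
lemma IK_diff [simp]: "x \<in> IK \<Longrightarrow> y \<in> IK \<Longrightarrow> x - y \<in> IK" using IK_add[OF _ IK_minus] by simp
lemma IK_power [simp]: "x \<in> IK \<Longrightarrow> x ^ n \<in> IK" by (induct n) auto
lemma IK_w [simp]: "w \<in> IK" using IK_I[of 0 1] by simp
lemma IK_s [simp]: "s \<in> IK" using s_eq_w IK_I by metis

lemma IK_cj [simp]: "x \<in> IK \<Longrightarrow> cj x \<in> IK"
  by (elim IK_E) (simp add: cj_w)

lemma Rats_K_IK: "x \<in> IK \<Longrightarrow> x \<in> \<rat> \<Longrightarrow> x \<in> \<int>"
proof (elim IK_E)
  fix a b assume x: "x \<in> \<rat>" "x = of_int a + of_int b * w"
  have "b = 0"
  proof (rule ccontr)
    assume "b \<noteq> 0"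
    then have "w = (x - of_int a) / of_int b" using x(2) by (simp add: field_simps)
    then show False using w_irrational x(1) by (metis Rats_divide Rats_diff Rats_of_int)
  qed
  then show ?thesis using x by simp
qed

text \<open>Integral trace and norm bring the element to the form \<open>(t + u s) / 2\<close> with
  integers \<open>t\<close>, \<open>u\<close> and \<open>t^2 - d u^2\<close> divisible by 4. Squares
  modulo 4 then decide the parities: both odd is possible only for
  \<open>d mod 4 = 1\<close>.\<close>

lemma IK_iff: "x \<in> IK \<longleftrightarrow> x \<in> K \<and> algebraic_int x"
proof
  assume x: "x \<in> IK"
  then have "tr x \<in> \<int>" "nm x \<in> \<int>"
    using tr_rat[OF IK_in_K[OF x]] nm_rat[OF IK_in_K[OF x]] by (auto intro!: Rats_K_IK simp: tr_def nm_def)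
  then show "x \<in> K \<and> algebraic_int x" using IK_in_K[OF x] algebraic_int_iff by blast
next
  assume "x \<in> K \<and> algebraic_int x"
  then have x: "x \<in> K" "tr x \<in> \<int>" "nm x \<in> \<int>" using algebraic_int_iff by auto
  obtain a b where ab: "x = of_rat a + of_rat b * s" using x(1) by (rule qfieldE)
  obtain t where t: "tr x = of_int t" using x by (auto elim: Ints_cases)
  obtain n where n: "nm x = of_int n" using x by (auto elim: Ints_cases)
  have "of_rat (2 * a) = (of_rat (of_int t) :: complex)" using t by (simp add: ab tr_def of_rat_mult)
  then have "2 * a = of_int t" by (metis of_rat_eq_iff)
  then have a: "a = of_int t / 2" by simp
  have "of_rat a * of_rat a - of_rat b * of_rat b * (s * s) = of_int n"
    using n by (simp add: ab nm_def algebra_simps)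
  then have "of_rat (a * a - b * b * of_int d) = (of_rat (of_int n) :: complex)"
    by (simp add: of_rat_diff of_rat_mult)
  then have nn: "a * a - b * b * of_int d = of_int n" by (simp only: of_rat_eq_iff)
  \<comment> \<open>Lowest terms for \<open>2 * b\<close>: the norm equation gives that
    \<open>v^2\<close> divides \<open>d\<close>, and squarefreeness forces
    \<open>v = 1\<close>.\<close>
  obtain u v where uv: "2 * b = of_int u / of_int v" "v > 0" "coprime u v"
    by (metis quotient_of_coprime quotient_of_denom_pos quotient_of_div surj_pair)
  have "of_int (d * u^2) = (of_int ((t^2 - 4 * n) * v^2) :: rat)"
  proof -
    have bv: "2 * b * of_int v = of_int u" using uv by (simp add: field_simps)
    have bd: "b * b * of_int d = a * a - of_int n" using nn by simp
    have "of_int (d * u^2) = of_int d * (2 * b * of_int v)^2" unfolding bv by simp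
    also have "\<dots> = 4 * of_int v ^ 2 * (b * b * of_int d)" by (simp add: power2_eq_square)
    also have "\<dots> = of_int ((t^2 - 4 * n) * v^2)"
      unfolding bd a by (simp add: power2_eq_square algebra_simps)
    finally show ?thesis .
  qed
  then have eq: "d * u^2 = (t^2 - 4 * n) * v^2" by (metis of_int_eq_iff)
  then have "v^2 dvd d * u^2" by simp
  moreover have "coprime (v^2) (u^2)" using uv(3) by (simp add: coprime_commute)
  ultimately have "v^2 dvd d" by (metis coprime_dvd_mult_left_iff)
  then have "v dvd 1" using squarefreeD[OF sqfree] by simp
  then have "v = 1" using uv(2) by auto
  then have b: "b = of_int u / 2" using uv by (simp add: field_simps)
  have eq: "d * u^2 = t^2 - 4 * n" using eq \<open>v = 1\<close> by simp
  have nd: "\<not> 4 dvd d" using squarefreeD[OF sqfree, of 2] by auto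
  have xs: "x = (of_int t + of_int u * s) / 2"
    unfolding ab a b by (simp add: of_rat_divide add_divide_distrib)
  show "x \<in> IK"
  proof (cases "d mod 4 = 1")
    case True
    then have "odd d" by presburger
    moreover have "even (t^2) = even (d * u^2)" unfolding eq by simp
    ultimately have "even t = even u" by simp
    then have "even (t - u)" by simp
    then obtain k where "t - u = 2 * k" by (elim evenE)
    then have k: "t = u + 2 * k" by simp
    have "x = of_int k + of_int u * w"
      unfolding xs k w_def using True by (simp add: field_simps)
    then show ?thesis using IK_I by metis
  next
    case False
    have "even u"
    proof (rule ccontr)
      assume "odd u"
      then obtain i where i: "u = 2 * i + 1" by (elim oddE)
      have "t^2 = d * u^2 + 4 * n" using eq by simp
      then have t2: "t^2 = d + 4 * (d * (i^2 + i) + n)" unfolding i by (simp add: power2_eq_square algebra_simps)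
      show False
      proof (cases "even t")
        case True
        then obtain j where "t = 2 * j" by (elim evenE)
        then have "d = 4 * (j^2 - (d * (i^2 + i) + n))" using t2 by (simp add: power2_eq_square algebra_simps)
        then show False using nd dvd_triv_left by metis
      next
        case odd: False
        then obtain j where "t = 2 * j + 1" by (elim oddE)
        then have "d = 1 + 4 * (j^2 + j - (d * (i^2 + i) + n))" using t2 by (simp add: power2_eq_square algebra_simps)
        then obtain e where "d = 1 + 4 * e" by blast
        then have "d mod 4 = 1" by simp
        then show False using False by simp
      qed
    qed
    then obtain u' where u': "u = 2 * u'" by (elim evenE)
    have "even (t^2) = even (d * u^2)" unfolding eq by simp
    then have "even t" using u' by simp
    then obtain t' where t': "t = 2 * t'" by (auto elim: evenE)
    have "x = of_int t' + of_int u' * w"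
      unfolding xs t' u' w_def using False by (simp add: field_simps)
    then show ?thesis using IK_I by metis
  qed
qed

lemma carrier_ring_of_integers: "carrier (ring_of_integers K) = IK"
  using IK_iff by (auto simp: ring_of_integers_def)

end

section \<open>Discriminants\<close>

lemma det_mat_2:
  "det (mat 2 2 f) = f (0, 0) * f (1, 1) - f (0, 1) * f (1, 0)" for f :: "nat \<times> nat \<Rightarrow> 'a :: comm_ring_1"
proof -
  have "det (mat 2 2 f) = (\<Sum>i<2. mat 2 2 f $$ (i, 0) * cofactor (mat 2 2 f) i 0)"
    by (rule laplace_expansion_column[of _ 2]) auto
  also have "\<dots> = f (0, 0) * det (mat_delete (mat 2 2 f) 0 0) - f (1, 0) * det (mat_delete (mat 2 2 f) 1 0)"
    by (simp add: cofactor_def numeral_2_eq_2)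
  also have "det (mat_delete (mat 2 2 f) 0 0) = f (1, 1)"
    by (subst det_single) (auto simp: mat_delete_def)
  also have "det (mat_delete (mat 2 2 f) 1 0) = f (0, 1)"
    by (subst det_single) (auto simp: mat_delete_def)
  finally show ?thesis by (simp add: mult.commute)
qed

context quadratic
begin

text \<open>A ring homomorphism fixes the rationals and sends \<open>s\<close> to a root of
  \<open>X^2 - d\<close>, which leaves two choices.\<close>

lemma embeddings_K: "embeddings K = {restrict id K, restrict cj K}"
proof (intro equalityI subsetI)
  fix h assume "h \<in> embeddings K"
  then have h: "h \<in> Ring.ring_hom (CC\<lparr>carrier := K\<rparr>) CC" and ext: "h \<in> extensional K"
    by (auto simp: embeddings_def)
  have h_mult: "h (x * y) = h x * h y" and h_add: "h (x + y) = h x + h y" if "x \<in> K" "y \<in> K" for x y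
    using Ring.ring_hom_mult[OF h, of x y] Ring.ring_hom_add[OF h, of x y] that by auto
  have h_1: "h 1 = 1" using Ring.ring_hom_one[OF h] by simp
  have h_0: "h 0 = 0" using h_add[of 0 0] by simp
  have h_nat: "h (of_nat n) = of_nat n" for n
  proof (induction n)
    case (Suc n)
    have "of_nat n \<in> K" using int_in_K[of "int n"] by simp
    then show ?case using Suc h_add[of 1 "of_nat n"] h_1 by simp
  qed (simp add: h_0)
  have h_neg: "h (- x) = - h x" if "x \<in> K" for x
    using h_add[of x "- x"] that h_0 by (simp add: add_eq_0_iff2)
  have h_int: "h (of_int z) = of_int z" for z
  proof (cases z rule: int_cases)
    case (nonneg n) then show ?thesis by (simp add: h_nat)
  next
    case (neg n)
    have "of_nat (Suc n) \<in> K" using int_in_K[of "int (Suc n)"] by simp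
    then show ?thesis using h_neg[of "of_nat (Suc n)"] neg h_nat[of "Suc n"] by (simp del: of_nat_Suc)
  qed
  have h_rat: "h (of_rat r) = of_rat r" for r
  proof -
    obtain a b where r: "r = of_int a / of_int b" "b > 0"
      by (metis Fract_of_int_quotient quotient_of_div quotient_of_denom_pos surj_pair)
    have "h (of_rat r * of_int b) = h (of_rat r) * h (of_int b)" by (intro h_mult) auto
    moreover have "of_rat r * of_int b = (of_int a :: complex)" using r by (simp add: of_rat_divide)
    ultimately have "h (of_rat r) * of_int b = of_int a" by (simp add: h_int)
    then have "h (of_rat r) = of_int a / of_int b" using r(2) by (simp add: eq_divide_eq)
    then show ?thesis by (simp add: r(1) of_rat_divide)
  qed
  have "h s * h s = of_int d" using h_mult[of s s] by (simp add: h_int)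
  then have "(h s - s) * (h s + s) = 0" by (simp add: algebra_simps)
  then have "h s = s \<or> h s = - s" by (auto simp: add_eq_0_iff2)
  moreover have coord: "h (of_rat a + of_rat b * s) = of_rat a + of_rat b * h s" for a b
    by (simp add: h_add h_mult h_rat)
  ultimately have "(\<forall>x\<in>K. h x = x) \<or> (\<forall>x\<in>K. h x = cj x)"
    by (auto elim!: qfieldE)
  then show "h \<in> {restrict id K, restrict cj K}"
    using ext by (auto intro!: extensionalityI[OF ext] simp: restrict_extensional)
next
  fix h assume "h \<in> {restrict id K, restrict cj K}"
  then show "h \<in> embeddings K"
    by (auto simp: embeddings_def intro!: ring_hom_memI)
qed

lemma field_trace_K: "x \<in> K \<Longrightarrow> field_trace K x = tr x"
proof -
  assume x: "x \<in> K"
  \<comment> \<open>\<open>field_trace\<close> sums over a set, so both terms are counted only if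
    the two embeddings are distinct.\<close>
  have "restrict id K \<noteq> restrict cj K"
  proof
    assume "restrict id K = restrict cj K"
    then have "restrict id K s = restrict cj K s" by (rule fun_cong)
    then show False by simp
  qed
  then show ?thesis using x by (simp add: field_trace_def embeddings_K tr_def)
qed

definition disc :: int where "disc = (if d mod 4 = 1 then d else 4 * d)"

lemma w_diff_square: "(w - cj w)\<^sup>2 = of_int disc"
proof -
  have "(w - cj w)\<^sup>2 = 4 * (w * w) - 4 * of_int tw * w + of_int tw ^ 2"
    unfolding cj_w by (simp add: power2_eq_square algebra_simps)
  also have "\<dots> = of_int (tw ^ 2 + 4 * nw)" unfolding w_square by (simp add: algebra_simps)
  also have "tw ^ 2 + 4 * nw = disc"
  proof (cases "d mod 4 = 1")
    case True
    then have "4 * ((d - 1) div 4) = d - 1" by presburger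
    then show ?thesis using True by (simp add: tw_def nw_def disc_def)
  qed (simp add: tw_def nw_def disc_def)
  finally show ?thesis .
qed

lemma integral_basis_w: "integral_basis K [1, w]"
  unfolding integral_basis_def carrier_ring_of_integers
proof (intro conjI ballI)
  fix x assume "x \<in> IK"
  then obtain a b where x: "x = of_int a + of_int b * w" by (rule IK_E)
  show "\<exists>!cs. length cs = length [1, w] \<and> x = (\<Sum>i<length [1, w]. of_int (cs ! i) * [1, w] ! i)"
  proof (rule ex1I[of _ "[a, b]"])
    fix cs :: "int list"
    assume cs: "length cs = length [1, w] \<and> x = (\<Sum>i<length [1, w]. of_int (cs ! i) * [1, w] ! i)"
    then obtain a' b' where "cs = [a', b']" by (auto simp: numeral_2_eq_2 length_Suc_conv)
    then show "cs = [a, b]" using cs x by simp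
  qed (simp add: x)
qed auto

text \<open>Every integral basis has length 2 and differs from 1, \<open>w\<close> by an integer
  matrix of determinant \<delta> = 1 or -1. The determinant of the trace form is the square of a
  determinant of conjugates, so only \<open>\<delta>^2\<close> enters.\<close>

lemma integral_basis_det:
  assumes "integral_basis K bs"
  shows "det (mat (length bs) (length bs) (\<lambda>(i, j). field_trace K (bs ! i * bs ! j))) = of_int disc"
proof -
  define n where "n = length bs"
  have sub: "set bs \<subseteq> IK" and
    ex1: "\<And>x. x \<in> IK \<Longrightarrow> \<exists>!cs :: int list. length cs = n \<and> x = (\<Sum>i<n. of_int (cs ! i) * bs ! i)"
    using assms unfolding integral_basis_def carrier_ring_of_integers n_def by auto
  have indep: "c i = 0" if eq: "(\<Sum>i<n. of_int (c i) * bs ! i) = 0" and i: "i < n" for c :: "nat \<Rightarrow> int" and i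
  proof -
    have "map c [0..<n] = replicate n 0"
    proof (rule ex1E[OF ex1[OF IK_0]])
      fix cs :: "int list"
      assume *: "\<forall>cs'. length cs' = n \<and> 0 = (\<Sum>i<n. of_int (cs' ! i) * bs ! i) \<longrightarrow> cs' = cs"
      have "(\<Sum>i<n. of_int (map c [0..<n] ! i) * bs ! i) = (\<Sum>i<n. of_int (c i) * bs ! i)"
        by (intro sum.cong) auto
      then have "map c [0..<n] = cs" using * eq by simp
      moreover have "replicate n 0 = cs" using * by simp
      ultimately show ?thesis by simp
    qed
    then have "map c [0..<n] ! i = replicate n 0 ! i" by simp
    then show ?thesis using i by simp
  qed
  have "\<exists>pq. bs ! i = of_int (fst pq) + of_int (snd pq) * w" if "i < n" for i
  proof -
    have "bs ! i \<in> IK" using sub nth_mem[of i bs] that unfolding n_def by auto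
    then obtain a b where "bs ! i = of_int a + of_int b * w" by (rule IK_E)
    then show ?thesis by (intro exI[of _ "(a, b)"]) simp
  qed
  then obtain pq where pq': "\<And>i. i < n \<Longrightarrow> bs ! i = of_int (fst (pq i)) + of_int (snd (pq i)) * w"
    by metis
  define p q where "p i = fst (pq i)" and "q i = snd (pq i)" for i
  have pq: "bs ! i = of_int (p i) + of_int (q i) * w" if "i < n" for i
    using pq'[OF that] by (simp add: p_def q_def)
  have "n = 2"
  proof -
    have "n \<noteq> 0" using ex1[OF IK_1] by auto
    moreover have "n \<noteq> 1"
    proof
      assume n: "n = 1"
      obtain cs where cs: "1 = of_int (cs ! 0) * bs ! 0" using ex1[OF IK_1] n by auto
      obtain es where es: "w = of_int (es ! 0) * bs ! 0" using ex1[OF IK_w] n by auto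
      have "of_int (es ! 0) * 1 = of_int (cs ! 0) * w"
        by (subst cs, subst es) simp
      then have "of_int (es ! 0) + of_int 0 * w = of_int 0 + of_int (cs ! 0) * w" by simp
      then have "cs ! 0 = 0" by (simp only: w_coord_eq_iff)
      then show False using cs by simp
    qed
    moreover have "\<not> n \<ge> 3"
    proof
      assume n: "n \<ge> 3"
      \<comment> \<open>Coefficient vectors supported on the first three basis elements; these alone
        will be shown to be dependent.\<close>
      define f where "f = (\<lambda>a b c (i :: nat). if i = 0 then a else if i = 1 then b else if i = 2 then c else (0 :: int))"
      have sum_f: "(\<Sum>i<n. of_int (f a b c i) * bs ! i)
          = of_int (a * p 0 + b * p 1 + c * p 2) + of_int (a * q 0 + b * q 1 + c * q 2) * w" for a b c
      proof -
        have "(\<Sum>i<n. of_int (f a b c i) * bs ! i) = (\<Sum>i<3. of_int (f a b c i) * bs ! i)"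
          by (rule sum.mono_neutral_right) (use n in \<open>auto simp: f_def\<close>)
        also have "\<dots> = of_int a * bs ! 0 + of_int b * bs ! 1 + of_int c * bs ! 2"
          by (simp add: f_def eval_nat_numeral)
        also have "\<dots> = of_int (a * p 0 + b * p 1 + c * p 2) + of_int (a * q 0 + b * q 1 + c * q 2) * w"
          using pq[of 0] pq[of 1] pq[of 2] n by (simp add: algebra_simps)
        finally show ?thesis .
      qed
      have rel: "a = 0 \<and> b = 0 \<and> c = 0"
        if "a * p 0 + b * p 1 + c * p 2 = 0" "a * q 0 + b * q 1 + c * q 2 = 0" for a b c
      proof -
        have "(\<Sum>i<n. of_int (f a b c i) * bs ! i) = 0" unfolding sum_f that by simp
        then have "f a b c 0 = 0" "f a b c 1 = 0" "f a b c 2 = 0"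
          using indep n by (meson less_le_trans numeral_eq_iff less_numeral_extra zero_less_numeral one_less_numeral_iff numeral_less_iff semiring_norm)+
        then show ?thesis by (simp add: f_def)
      qed
      \<comment> \<open>The cross product of the two coordinate rows is a relation, so all minors
        vanish. The relations built from \<open>q 1, - q 0\<close> and \<open>p 1, - p 0\<close>
        then make the first two elements zero, and finally \<open>1, 0, 0\<close> becomes a
        relation.\<close>
      have "p 1 * q 2 - p 2 * q 1 = 0 \<and> p 2 * q 0 - p 0 * q 2 = 0 \<and> p 0 * q 1 - p 1 * q 0 = 0"
        by (rule rel) (simp_all add: algebra_simps)
      then have "p 0 * q 1 = p 1 * q 0" by simp
      then have "q 1 = 0 \<and> - q 0 = 0 \<and> (0 :: int) = 0" "p 1 = 0 \<and> - p 0 = 0 \<and> (0 :: int) = 0"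
        by (intro rel; simp add: algebra_simps)+
      then have "(1 :: int) = 0 \<and> (0 :: int) = 0 \<and> (0 :: int) = 0"
        by (intro rel) auto
      then show False by simp
    qed
    ultimately show ?thesis by linarith
  qed
  obtain cs where cs: "1 = of_int (cs ! 0) * bs ! 0 + of_int (cs ! 1) * bs ! 1"
    using ex1[OF IK_1] \<open>n = 2\<close> by (auto simp: numeral_2_eq_2)
  obtain es where es: "w = of_int (es ! 0) * bs ! 0 + of_int (es ! 1) * bs ! 1"
    using ex1[OF IK_w] \<open>n = 2\<close> by (auto simp: numeral_2_eq_2)
  have b0: "bs ! 0 = of_int (p 0) + of_int (q 0) * w" and b1: "bs ! 1 = of_int (p 1) + of_int (q 1) * w"
    using pq \<open>n = 2\<close> by auto
  have "of_int 1 + of_int 0 * w = of_int (cs ! 0 * p 0 + cs ! 1 * p 1) + of_int (cs ! 0 * q 0 + cs ! 1 * q 1) * w"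
    using cs unfolding b0 b1 by (simp add: algebra_simps)
  then have c: "1 = cs ! 0 * p 0 + cs ! 1 * p 1" "0 = cs ! 0 * q 0 + cs ! 1 * q 1"
    by (simp_all only: w_coord_eq_iff)
  have "of_int 0 + of_int 1 * w = of_int (es ! 0 * p 0 + es ! 1 * p 1) + of_int (es ! 0 * q 0 + es ! 1 * q 1) * w"
    using es unfolding b0 b1 by (simp add: algebra_simps)
  then have e: "0 = es ! 0 * p 0 + es ! 1 * p 1" "1 = es ! 0 * q 0 + es ! 1 * q 1"
    by (simp_all only: w_coord_eq_iff)
  define \<delta> where "\<delta> = p 0 * q 1 - p 1 * q 0"
  \<comment> \<open>The coordinate matrices between the two bases are inverse to each other, so
    their determinants multiply to 1.\<close>
  have "(cs ! 0 * es ! 1 - cs ! 1 * es ! 0) * \<delta> =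
     (cs ! 0 * p 0 + cs ! 1 * p 1) * (es ! 0 * q 0 + es ! 1 * q 1) - (cs ! 0 * q 0 + cs ! 1 * q 1) * (es ! 0 * p 0 + es ! 1 * p 1)"
    by (simp add: \<delta>_def algebra_simps)
  also have "\<dots> = 1" using c e by simp
  finally have "\<delta> dvd 1" by (metis dvd_triv_right)
  then have \<delta>: "\<delta>\<^sup>2 = 1" by (metis abs_1 dvd_abs_iff power2_abs one_power2 zdvd1_eq)
  have in_K: "bs ! 0 \<in> K" "bs ! 1 \<in> K" unfolding b0 b1 by auto
  have "det (mat n n (\<lambda>(i, j). field_trace K (bs ! i * bs ! j)))
      = tr (bs ! 0 * bs ! 0) * tr (bs ! 1 * bs ! 1) - tr (bs ! 0 * bs ! 1) * tr (bs ! 1 * bs ! 0)"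
    unfolding \<open>n = 2\<close> det_mat_2 using in_K by (simp add: field_trace_K)
  also have "\<dots> = (bs ! 0 * cj (bs ! 1) - bs ! 1 * cj (bs ! 0))\<^sup>2"
    using in_K by (simp add: tr_def power2_eq_square algebra_simps)
  also have "bs ! 0 * cj (bs ! 1) - bs ! 1 * cj (bs ! 0) = of_int \<delta> * (cj w - w)"
    unfolding b0 b1 by (simp add: \<delta>_def algebra_simps)
  also have "\<dots>\<^sup>2 = of_int (\<delta>\<^sup>2) * (w - cj w)\<^sup>2" by (simp add: power_mult_distrib power2_commute)
  finally show ?thesis unfolding \<delta> w_diff_square n_def by simp
qed

lemma discriminant_K: "discriminant K = disc"
  unfolding discriminant_def
proof (rule the_equality)
  show "\<exists>bs. integral_basis K bs \<and>
    of_int disc = det (mat (length bs) (length bs) (\<lambda>(i, j). field_trace K (bs ! i * bs ! j)))"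
    using integral_basis_w integral_basis_det by metis
next
  fix e assume "\<exists>bs. integral_basis K bs \<and>
    of_int e = det (mat (length bs) (length bs) (\<lambda>(i, j). field_trace K (bs ! i * bs ! j)))"
  then have "(of_int e :: complex) = of_int disc" using integral_basis_det by metis
  then show "e = disc" by (simp only: of_int_eq_iff)
qed

end

text \<open>\<open>card\<close> of an infinite set is 0, so lower bounds for the counts depend on
  this. The discriminant bounds \<open>d\<close>, and both square roots of \<open>d\<close> generate
  the same field.\<close>

lemma finite_number_fields: "finite {K. number_field 2 K \<and> real_of_int \<bar>discriminant K\<bar> \<le> x}"
proof (rule finite_subset)
  show "finite ((\<lambda>d. qfield (csqrt (of_int d))) ` {- \<lceil>x\<rceil> .. \<lceil>x\<rceil>})" by simp
  show "{K. number_field 2 K \<and> real_of_int \<bar>discriminant K\<bar> \<le> x} \<subseteq> (\<lambda>d. qfield (csqrt (of_int d))) ` {- \<lceil>x\<rceil> .. \<lceil>x\<rceil>}"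
  proof
    fix K assume "K \<in> {K. number_field 2 K \<and> real_of_int \<bar>discriminant K\<bar> \<le> x}"
    then have K: "number_field 2 K" "real_of_int \<bar>discriminant K\<bar> \<le> x" by auto
    obtain d s where q: "quadratic d s" "K = qfield s" using number_field_2E[OF K(1)] by blast
    have disc: "discriminant K = (if d mod 4 = 1 then d else 4 * d)"
      using quadratic.discriminant_K[OF q(1)] by (simp add: quadratic.disc_def[OF q(1)] q(2))
    then have "\<bar>d\<bar> \<le> \<bar>discriminant K\<bar>" by auto
    then have "\<bar>d\<bar> \<le> \<lceil>x\<rceil>" using K(2) by linarith
    have "s\<^sup>2 = (csqrt (of_int d))\<^sup>2" using quadratic.s_square[OF q(1)] by simp
    then have "s = csqrt (of_int d) \<or> s = - csqrt (of_int d)" by (metis power2_eq_iff)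
    moreover have "qfield (- t) = qfield t" for t
      unfolding qfield_def
      by (auto simp flip: mult_minus_left of_rat_minus) (metis minus_minus mult_minus_left mult_minus_right of_rat_minus)+
    ultimately have "K = qfield (csqrt (of_int d))" using q(2) by metis
    then show "K \<in> (\<lambda>d. qfield (csqrt (of_int d))) ` {- \<lceil>x\<rceil> .. \<lceil>x\<rceil>}"
      using \<open>\<bar>d\<bar> \<le> \<lceil>x\<rceil>\<close> by (intro image_eqI[of _ _ d]) auto
  qed
qed

section \<open>Power subgroups and rank\<close>

lemma (in monoid) nat_pow_mod:
  assumes "x \<in> carrier G" "x [^] (m::nat) = \<one>"
  shows "x [^] (n mod m) = x [^] n"
proof -
  have "x [^] n = x [^] (m * (n div m) + n mod m)" by simp
  also have "\<dots> = (x [^] m) [^] (n div m) \<otimes> x [^] (n mod m)"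
    using assms(1) by (simp only: nat_pow_mult nat_pow_pow)
  also have "\<dots> = x [^] (n mod m)" using assms by simp
  finally show ?thesis by simp
qed

text \<open>The setting is a commutative monoid because that is what \<open>comm_monoid_A\<close>
  provides for the class group; the relations \<open>x i [^] m = \<one>\<close> supply the inverses
  inside the generated subgroup.\<close>

lemma (in comm_monoid) has_power_subgroupI:
  fixes x :: "nat \<Rightarrow> 'a"
  assumes m: "m > 0" and x: "\<And>i. i < r \<Longrightarrow> x i \<in> carrier G" and xm: "\<And>i. i < r \<Longrightarrow> x i [^] m = \<one>"
    and indep: "\<And>e. \<forall>i<r. e i < m \<Longrightarrow> (\<Otimes>i\<in>{..<r}. x i [^] (e i :: nat)) = \<one> \<Longrightarrow> \<forall>i<r. e i = 0"
  shows "has_power_subgroup m r G"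
proof -
  define P where "P = product_group {..<r} (\<lambda>_. integer_mod_group m)"
  interpret P: group P by (simp add: P_def)
  define \<phi> where "\<phi> e = (\<Otimes>i\<in>{..<r}. x i [^] nat (e i))" for e :: "nat \<Rightarrow> int"
  have carrP: "e \<in> carrier P \<longleftrightarrow> e \<in> ({..<r} \<rightarrow>\<^sub>E {0..<int m})" for e
    using m by (simp add: P_def carrier_integer_mod_group)
  have \<phi>_closed: "\<phi> e \<in> carrier G" for e unfolding \<phi>_def using x by (intro finprod_closed) auto
  have hom: "\<phi> (e \<otimes>\<^bsub>P\<^esub> e') = \<phi> e \<otimes> \<phi> e'" if "e \<in> carrier P" "e' \<in> carrier P" for e e'
  proof -
    have "\<phi> (e \<otimes>\<^bsub>P\<^esub> e') = (\<Otimes>i\<in>{..<r}. x i [^] nat (e i) \<otimes> x i [^] nat (e' i))"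
      unfolding \<phi>_def
    proof (rule finprod_cong')
      show "(\<lambda>i. x i [^] nat (e i) \<otimes> x i [^] nat (e' i)) \<in> {..<r} \<rightarrow> carrier G" using x by auto
      fix i assume "i \<in> {..<r}"
      then have i: "i < r" by simp
      then have nn: "e i \<ge> 0" "e' i \<ge> 0" using that by (auto simp: carrP PiE_iff)
      have "nat ((e \<otimes>\<^bsub>P\<^esub> e') i) = (nat (e i) + nat (e' i)) mod m"
        using i nn by (simp add: P_def nat_mod_distrib nat_add_distrib)
      then show "x i [^] nat ((e \<otimes>\<^bsub>P\<^esub> e') i) = x i [^] nat (e i) \<otimes> x i [^] nat (e' i)"
        using nat_pow_mod[OF x[OF i] xm[OF i]] x[OF i] by (simp add: nat_pow_mult)
    qed simp
    also have "\<dots> = \<phi> e \<otimes> \<phi> e'" unfolding \<phi>_def using x by (intro finprod_multf) auto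
    finally show ?thesis .
  qed
  have \<phi>_one: "\<phi> \<one>\<^bsub>P\<^esub> = \<one>"
    unfolding \<phi>_def by (rule finprod_one_eqI) (auto simp: P_def)
  have inv: "\<phi> e \<otimes> \<phi> (inv\<^bsub>P\<^esub> e) = \<one>" if "e \<in> carrier P" for e
    using hom[of e "inv\<^bsub>P\<^esub> e"] that \<phi>_one by simp
  have inv': "inv (\<phi> e) = \<phi> (inv\<^bsub>P\<^esub> e)" if "e \<in> carrier P" for e
    using inv_unique'[of "\<phi> e" "\<phi> (inv\<^bsub>P\<^esub> e)"] inv[OF that] \<phi>_closed m_comm by metis
  have ker: "e = \<one>\<^bsub>P\<^esub>" if e: "e \<in> carrier P" "\<phi> e = \<one>" for e
  proof -
    have bounds: "0 \<le> e i \<and> e i < int m" if "i < r" for i using e(1) that unfolding carrP PiE_iff by auto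
    then have "\<forall>i<r. nat (e i) < m" by (simp add: nat_less_iff)
    then have "\<forall>i<r. nat (e i) = 0" using indep[of "\<lambda>i. nat (e i)"] e(2) unfolding \<phi>_def by simp
    then have "\<forall>i<r. e i = 0" using bounds by (metis nat_0_le of_nat_0)
    then show ?thesis using e(1) unfolding carrP by (auto simp: P_def PiE_iff extensional_def fun_eq_iff)
  qed
  have "inj_on \<phi> (carrier P)"
  proof (rule inj_onI)
    fix e e' assume e: "e \<in> carrier P" "e' \<in> carrier P" "\<phi> e = \<phi> e'"
    have "\<phi> (e \<otimes>\<^bsub>P\<^esub> inv\<^bsub>P\<^esub> e') = \<phi> e' \<otimes> \<phi> (inv\<^bsub>P\<^esub> e')" using hom e by simp
    then have "\<phi> (e \<otimes>\<^bsub>P\<^esub> inv\<^bsub>P\<^esub> e') = \<one>" using inv e by simp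
    then have "e \<otimes>\<^bsub>P\<^esub> inv\<^bsub>P\<^esub> e' = \<one>\<^bsub>P\<^esub>" using ker e by simp
    then show "e = e'" using e by (metis P.inv_closed P.inv_equality P.inv_inv)
  qed
  define H where "H = \<phi> ` carrier P"
  have sub: "subgroup H G"
  proof
    show "H \<subseteq> carrier G" using \<phi>_closed by (auto simp: H_def)
    show "a \<otimes> b \<in> H" if "a \<in> H" "b \<in> H" for a b
      using that hom unfolding H_def by (auto simp flip: hom intro!: imageI)
    show "\<one> \<in> H" using \<phi>_one unfolding H_def by (metis P.one_closed imageI)
    show "inv a \<in> H" if "a \<in> H" for a
      using that inv' unfolding H_def by auto
  qed
  have "\<phi> \<in> iso P (G\<lparr>carrier := H\<rparr>)"
    using hom \<open>inj_on \<phi> (carrier P)\<close> by (auto simp: iso_def hom_def H_def bij_betw_def)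
  then have "P \<cong> G\<lparr>carrier := H\<rparr>" by (auto simp: is_iso_def)
  then have "G\<lparr>carrier := H\<rparr> \<cong> P" by (rule P.iso_sym)
  then show ?thesis using sub unfolding has_power_subgroup_def P_def by blast
qed

lemma m_rank_geI: "has_power_subgroup m r A \<Longrightarrow> enat r \<le> m_rank m A"
  unfolding m_rank_def by (rule Sup_upper) blast

context comm_monoid
begin

text \<open>Independence can be tested on elements of prime order: a suitable power of a nontrivial
  relation has exponents \<open>m div \<rho> * i\<close> and \<open>m div \<rho> * j\<close>, where
  \<rho> does not divide both \<open>i\<close> and \<open>j\<close>.\<close>

lemma has_power_subgroup_2I:
  assumes m: "m > 1" and x: "x \<in> carrier G" "x [^] m = \<one>" and y: "y \<in> carrier G" "y [^] m = \<one>"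
    and indep: "\<And>\<rho> i j :: nat. prime \<rho> \<Longrightarrow> \<rho> dvd m \<Longrightarrow>
      x [^] (m div \<rho> * i) \<otimes> y [^] (m div \<rho> * j) = \<one> \<Longrightarrow> \<rho> dvd i \<and> \<rho> dvd j"
  shows "has_power_subgroup m 2 G"
proof -
  define f where "f i = (if i = 0 then x else y)" for i :: nat
  show ?thesis
  proof (rule has_power_subgroupI[of m 2 f])
    show "m > 0" using m by simp
    show "f i \<in> carrier G" "f i [^] m = \<one>" for i using x y by (auto simp: f_def)
    fix e :: "nat \<Rightarrow> nat"
    assume lt: "\<forall>i<2. e i < m" and one: "(\<Otimes>i\<in>{..<2}. f i [^] e i) = \<one>"
    have set2: "{..<2} = {0, 1 :: nat}" by auto
    have one': "x [^] e 0 \<otimes> y [^] e 1 = \<one>"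
      using one x y unfolding set2 by (simp add: f_def)
    have "e 0 = 0 \<and> e 1 = 0"
    proof (rule ccontr)
      assume nz: "\<not> (e 0 = 0 \<and> e 1 = 0)"
      \<comment> \<open>Including \<open>m\<close> in the gcd is what gives the contradiction:
        \<rho> divides \<open>m div g\<close>, so if it also divided both \<open>i\<close> and
        \<open>j\<close>, then \<open>g * \<rho>\<close> would be a larger common divisor.\<close>
      define g where "g = gcd (gcd (e 0) (e 1)) m"
      have g0: "g > 0" using m by (simp add: g_def)
      have "g \<le> gcd (e 0) (e 1)" using nz by (simp add: g_def gcd_le1_nat)
      also have "\<dots> < m"
      proof (cases "e 0 = 0")
        case True then show ?thesis using lt by simp
      next
        case False then show ?thesis using lt gcd_le1_nat[of "e 0" "e 1"] by (metis less_2_cases_iff order_le_less_trans)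
      qed
      finally have "g < m" .
      have gm: "m = g * (m div g)" by (simp add: g_def)
      then have "m div g \<noteq> 1" using \<open>g < m\<close> by (metis mult.right_neutral nat_neq_iff)
      then obtain \<rho> where \<rho>: "prime \<rho>" "\<rho> dvd m div g" using prime_factor_nat by blast
      define i j t where "i = e 0 div g" and "j = e 1 div g" and "t = m div g div \<rho>"
      have "g dvd e 0" "g dvd e 1" unfolding g_def by (meson gcd_dvd1 gcd_dvd2 dvd_trans)+
      then have e0: "e 0 = g * i" and e1: "e 1 = g * j" by (simp_all add: i_def j_def)
      have "m div g = \<rho> * t" using \<rho>(2) by (simp add: t_def)
      then have mt: "m = g * \<rho> * t" using gm by (metis mult.assoc)
      have "\<rho> > 0" using \<rho>(1) prime_gt_0_nat by blast
      have md: "m div \<rho> = g * t" using mt \<open>\<rho> > 0\<close> by simp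
      have "\<one> = (x [^] e 0 \<otimes> y [^] e 1) [^] t" using one' by simp
      also have "\<dots> = x [^] (e 0 * t) \<otimes> y [^] (e 1 * t)"
        using x y by (simp add: nat_pow_distrib nat_pow_pow)
      also have "\<dots> = x [^] (m div \<rho> * i) \<otimes> y [^] (m div \<rho> * j)"
        unfolding md e0 e1 by (simp only: mult_ac)
      finally have "x [^] (m div \<rho> * i) \<otimes> y [^] (m div \<rho> * j) = \<one>" by (rule sym)
      moreover have "\<rho> dvd m" unfolding mt by simp
      ultimately have "\<rho> dvd i \<and> \<rho> dvd j" using indep[OF \<rho>(1)] by blast
      then have "g * \<rho> dvd e 0" "g * \<rho> dvd e 1" "g * \<rho> dvd m" unfolding e0 e1 by (auto simp: mt)
      then have "g * \<rho> dvd g" unfolding g_def by simp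
      then have "g * \<rho> \<le> g" using g0 by (simp add: dvd_imp_le)
      then show False using g0 prime_gt_1_nat[OF \<rho>(1)] by simp
    qed
    then show "\<forall>i<2. e i = 0" by (auto simp: less_2_cases_iff)
  qed
qed

lemma pow_eq_one_coprime:
  assumes y: "y \<in> carrier G" "y [^] (a :: nat) = \<one>" "y [^] (b :: nat) = \<one>"
  shows "y [^] gcd a b = \<one>"
proof (cases "a = 0")
  case True then show ?thesis using y by simp
next
  case False
  then obtain u v where uv: "a * u = b * v + gcd a b" using bezout_nat by blast
  have "\<one> = (y [^] a) [^] u" using y by simp
  also have "\<dots> = y [^] (b * v + gcd a b)" using y(1) by (simp only: nat_pow_pow uv)
  also have "\<dots> = (y [^] b) [^] v \<otimes> y [^] gcd a b" using y(1) by (simp only: nat_pow_pow nat_pow_mult)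
  also have "\<dots> = y [^] gcd a b" using y by simp
  finally show ?thesis by simp
qed

text \<open>Different primes may be witnessed by different elements. In \<open>z = x^a y^b\<close>
  the exponent \<open>b\<close> collects the primes witnessed by \<open>x\<close> and
  \<open>a\<close> the remaining ones, so at each prime exactly one factor of the power
  \<open>z [^] (m div \<rho>)\<close> is trivial.\<close>

lemma has_power_subgroup_1I:
  assumes m: "m > 1" and x: "x \<in> carrier G" "x [^] m = \<one>" and y: "y \<in> carrier G" "y [^] m = \<one>"
    and indep: "\<And>\<rho> :: nat. prime \<rho> \<Longrightarrow> \<rho> dvd m \<Longrightarrow> \<not> (x [^] (m div \<rho>) = \<one> \<and> y [^] (m div \<rho>) = \<one>)"
  shows "has_power_subgroup m 1 G"
proof -
  define P1 P2 where "P1 = {\<rho>. prime \<rho> \<and> \<rho> dvd m \<and> x [^] (m div \<rho>) \<noteq> \<one>}"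
    and "P2 = {\<rho>. prime \<rho> \<and> \<rho> dvd m \<and> x [^] (m div \<rho>) = \<one>}"
  have fin: "finite P1" "finite P2"
    using m by (auto simp: P1_def P2_def intro!: finite_subset[OF _ finite_divisors_nat[of m]])
  define a b where "a = \<Prod>P2" and "b = \<Prod>P1"
  define z where "z = x [^] a \<otimes> y [^] b"
  have z: "z \<in> carrier G" using x y by (simp add: z_def)
  have cop: "coprime \<rho> (\<Prod>P)" if "prime \<rho>" "\<rho> \<notin> P" "\<forall>p\<in>P. prime p" for \<rho> :: nat and P
    using that by (intro prod_coprime_right) (metis primes_coprime)
  have kill: "w [^] (n * (m div \<rho>)) = \<one>" if "w \<in> carrier G" "w [^] m = \<one>" "\<rho> dvd n" "\<rho> dvd m" for w and n \<rho> :: nat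
  proof -
    have "n * (m div \<rho>) = m * (n div \<rho>)" using that(3,4) by (auto elim!: dvdE)
    then show ?thesis using that by (simp flip: nat_pow_pow)
  qed
  have cancel: "w [^] (n * (m div \<rho>)) \<noteq> \<one>"
    if w: "w \<in> carrier G" "w [^] m = \<one>" "w [^] (m div \<rho>) \<noteq> \<one>" "coprime \<rho> n" "\<rho> dvd m" for w and n \<rho> :: nat
  proof
    assume "w [^] (n * (m div \<rho>)) = \<one>"
    then have "(w [^] (m div \<rho>)) [^] n = \<one>" using w by (simp add: nat_pow_pow mult.commute)
    moreover have "(w [^] (m div \<rho>)) [^] \<rho> = \<one>" using w by (simp add: nat_pow_pow)
    ultimately have "(w [^] (m div \<rho>)) [^] gcd \<rho> n = \<one>" using w by (intro pow_eq_one_coprime) auto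
    then show False using w by simp
  qed
  have z_ne: "z [^] (m div \<rho>) \<noteq> \<one>" if \<rho>: "prime \<rho>" "\<rho> dvd m" for \<rho>
  proof -
    have eq: "z [^] (m div \<rho>) = x [^] (a * (m div \<rho>)) \<otimes> y [^] (b * (m div \<rho>))"
      using x y by (simp add: z_def nat_pow_distrib nat_pow_pow)
    show ?thesis
    proof (cases "\<rho> \<in> P1")
      case True
      then have "\<rho> dvd b" unfolding b_def using fin by (intro dvd_prodI) auto
      then have "z [^] (m div \<rho>) = x [^] (a * (m div \<rho>))" using kill[of y \<rho> b] x y \<rho> by (simp add: eq)
      moreover have "coprime \<rho> a" unfolding a_def using True \<rho> by (intro cop) (auto simp: P1_def P2_def)
      ultimately show ?thesis using cancel[of x \<rho> a] x \<rho> True by (simp add: P1_def)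
    next
      case False
      then have \<rho>2: "\<rho> \<in> P2" using \<rho> by (auto simp: P1_def P2_def)
      then have "\<rho> dvd a" unfolding a_def using fin by (intro dvd_prodI) auto
      then have "z [^] (m div \<rho>) = y [^] (b * (m div \<rho>))" using kill[of x \<rho> a] x y \<rho> by (simp add: eq)
      moreover have "coprime \<rho> b" unfolding b_def using False \<rho> by (intro cop) (auto simp: P1_def P2_def)
      moreover have "y [^] (m div \<rho>) \<noteq> \<one>" using indep[OF \<rho>] \<rho>2 by (auto simp: P2_def)
      ultimately show ?thesis using cancel[of y \<rho> b] y \<rho> by simp
    qed
  qed
  show ?thesis
  proof (rule has_power_subgroupI[of m 1 "\<lambda>_. z"])
    show "m > 0" using m by simp
    show "z \<in> carrier G" by (rule z)
    have "z [^] m = x [^] (m * a) \<otimes> y [^] (m * b)" using x y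
      by (simp add: z_def nat_pow_distrib nat_pow_pow mult.commute)
    also have "\<dots> = (x [^] m) [^] a \<otimes> (y [^] m) [^] b" using x(1) y(1) by (simp only: nat_pow_pow)
    finally show zm: "z [^] m = \<one>" using x y by simp
    fix e :: "nat \<Rightarrow> nat"
    assume lt: "\<forall>i<1. e i < m" and one: "(\<Otimes>i\<in>{..<1}. z [^] e i) = \<one>"
    have set1: "{..<1} = {0 :: nat}" by auto
    have "z [^] e 0 = \<one>" using one z unfolding set1 by simp
    then have zg: "z [^] gcd (e 0) m = \<one>" using zm z by (intro pow_eq_one_coprime)
    have "e 0 = 0"
    proof (rule ccontr)
      assume "e 0 \<noteq> 0"
      define g where "g = gcd (e 0) m"
      have "g \<le> e 0" using \<open>e 0 \<noteq> 0\<close> by (simp add: g_def gcd_le1_nat)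
      moreover have "e 0 < m" using lt by simp
      ultimately have "g < m" by linarith
      have gm: "m = g * (m div g)" by (simp add: g_def)
      then have "m div g \<noteq> 1" using \<open>g < m\<close> by (metis mult.right_neutral nat_neq_iff)
      then obtain \<rho> where \<rho>: "prime \<rho>" "\<rho> dvd m div g" using prime_factor_nat by blast
      then obtain t where t: "m div g = \<rho> * t" by (elim dvdE)
      have "\<rho> > 0" using \<rho>(1) prime_gt_0_nat by blast
      have "m = \<rho> * (g * t)" using gm t by (metis mult.left_commute)
      then have "m div \<rho> = g * t" "\<rho> dvd m" using \<open>\<rho> > 0\<close> by simp_all
      then have "z [^] (m div \<rho>) = \<one>" using zg z by (simp add: g_def flip: nat_pow_pow)
      then show False using z_ne[OF \<rho>(1) \<open>\<rho> dvd m\<close>] by simp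
    qed
    then show "\<forall>i<1. e i = 0" by simp
  qed
qed

end

section \<open>Ideal classes\<close>

lemma ideal_prod_carrier: "ideal_prod (R\<lparr>carrier := A\<rparr>) I J = ideal_prod R I J"
proof (intro equalityI subsetI)
  fix x assume "x \<in> ideal_prod (R\<lparr>carrier := A\<rparr>) I J"
  then show "x \<in> ideal_prod R I J"
    by (induct rule: ideal_prod.induct) (auto intro: ideal_prod.intros)
next
  fix x assume "x \<in> ideal_prod R I J"
  then show "x \<in> ideal_prod (R\<lparr>carrier := A\<rparr>) I J"
  proof (induct rule: ideal_prod.induct)
    case (prod i j)
    then show ?case using ideal_prod.prod[of i I j J "R\<lparr>carrier := A\<rparr>"] by simp
  next
    case (sum s1 s2)
    then show ?case using ideal_prod.sum[of s1 "R\<lparr>carrier := A\<rparr>" I J s2] by simp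
  qed
qed

lemma ideal_prod_CC_scale:
  "ideal_prod CC ((*) a ` I) ((*) b ` J) = (*) (a * b) ` ideal_prod CC I J"
proof (intro equalityI subsetI)
  fix x assume "x \<in> ideal_prod CC ((*) a ` I) ((*) b ` J)"
  then show "x \<in> (*) (a * b) ` ideal_prod CC I J"
  proof (induct rule: ideal_prod.induct)
    case (prod i j)
    then obtain i' j' where "i = a * i'" "i' \<in> I" "j = b * j'" "j' \<in> J" by auto
    then show ?case using ideal_prod.prod[of i' I j' J CC]
      by (intro image_eqI[of _ _ "i' * j'"]) (auto simp: mult_ac)
  next
    case (sum s1 s2)
    then obtain t1 t2 where "s1 = a * b * t1" "t1 \<in> ideal_prod CC I J" "s2 = a * b * t2" "t2 \<in> ideal_prod CC I J" by auto
    then show ?case using ideal_prod.sum[of t1 CC I J t2]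
      by (intro image_eqI[of _ _ "t1 + t2"]) (auto simp: distrib_left)
  qed
next
  fix x assume "x \<in> (*) (a * b) ` ideal_prod CC I J"
  then obtain y where x: "x = a * b * y" and "y \<in> ideal_prod CC I J" by auto
  from this(2) have "a * b * y \<in> ideal_prod CC ((*) a ` I) ((*) b ` J)"
  proof (induct rule: ideal_prod.induct)
    case (prod i j)
    then have "(a * i) * (b * j) \<in> ideal_prod CC ((*) a ` I) ((*) b ` J)"
      using ideal_prod.prod[OF imageI[OF prod(1), of "(*) a"] imageI[OF prod(2), of "(*) b"], of CC] by simp
    moreover have "(a * i) * (b * j) = a * b * (i * j)" by (simp add: mult_ac)
    ultimately show ?case by simp
  next
    case (sum s1 s2)
    then show ?case using ideal_prod.sum[of "a * b * s1" CC _ _ "a * b * s2"] by (simp add: distrib_left)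
  qed
  then show "x \<in> ideal_prod CC ((*) a ` I) ((*) b ` J)" unfolding x .
qed

context quadratic
begin

abbreviation R where "R \<equiv> CC\<lparr>carrier := IK\<rparr>"

lemma ring_of_integers_K: "ring_of_integers K = R"
  using carrier_ring_of_integers by (simp add: ring_of_integers_def)

lemma subcring_IK: "subcring IK CC"
proof (rule CCf.subcringI)
  show "subring IK CC" by (rule CCf.subringI) auto
qed (auto simp: mult.commute)

lemma cring_R: "cring R"
  using CCf.subcring_iff[of IK] subcring_IK by auto

interpretation R: cring R by (rule cring_R)

lemma R_a_inv: "x \<in> IK \<Longrightarrow> \<ominus>\<^bsub>R\<^esub> x = - x"
  by (rule R.minus_equality) auto

lemma idealD:
  assumes "ideal J R"
  shows "J \<subseteq> IK" "0 \<in> J" "x \<in> J \<Longrightarrow> y \<in> J \<Longrightarrow> x + y \<in> J" "x \<in> J \<Longrightarrow> a \<in> IK \<Longrightarrow> a * x \<in> J"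
  using additive_subgroup.a_subset[OF ideal.axioms(1)[OF assms]]
    additive_subgroup.zero_closed[OF ideal.axioms(1)[OF assms]]
    additive_subgroup.a_closed[OF ideal.axioms(1)[OF assms], of x y]
    ideal.I_l_closed[OF assms, of x a] by auto

lemma idealI':
  assumes "J \<subseteq> IK" "0 \<in> J" "\<And>x y. x \<in> J \<Longrightarrow> y \<in> J \<Longrightarrow> x + y \<in> J"
    "\<And>x a. x \<in> J \<Longrightarrow> a \<in> IK \<Longrightarrow> a * x \<in> J"
  shows "ideal J R"
proof (rule idealI)
  show "ring R" by (rule R.ring_axioms)
  show "subgroup J (add_monoid R)"
  proof (rule group.subgroupI)
    show "group (add_monoid R)" by (rule R.a_group)
    fix a assume "a \<in> J"
    then have "a \<in> IK" using assms by auto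
    then have "inv\<^bsub>add_monoid R\<^esub> a = - a" using R_a_inv by (simp add: a_inv_def)
    then show "inv\<^bsub>add_monoid R\<^esub> a \<in> J" using assms(4)[OF \<open>a \<in> J\<close> IK_int[of "-1"]] by simp
  qed (use assms in auto)
qed (use assms in \<open>auto simp: mult.commute\<close>)

definition scale :: "complex \<Rightarrow> complex set \<Rightarrow> complex set" where "scale a J = (*) a ` J"
text \<open>The coset of \<open>J\<close> modulo the principal fractional ideals, written without
  reference to the quotient construction.\<close>

definition cls :: "complex set \<Rightarrow> complex set set" where "cls J = {scale a J |a. a \<in> K \<and> a \<noteq> 0}"
definition nzi :: "complex set \<Rightarrow> bool" where "nzi J \<longleftrightarrow> ideal J R \<and> J \<noteq> {0}"
abbreviation ip (infixl "\<diamondop>" 70) where "I \<diamondop> J \<equiv> ideal_prod CC I J"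

lemma ip_eq: "ideal_prod R I J = I \<diamondop> J" by (rule ideal_prod_carrier)

lemma scale_scale: "scale a (scale b J) = scale (a * b) J"
  by (auto simp: scale_def image_image mult.assoc)

lemma scale_1 [simp]: "scale 1 J = J" by (simp add: scale_def)

lemma scale_ip: "scale a I \<diamondop> scale b J = scale (a * b) (I \<diamondop> J)"
  unfolding scale_def by (rule ideal_prod_CC_scale)

lemma ideal_IK: "ideal IK R" using R.oneideal by simp

lemma nzi_IK: "nzi IK"
  unfolding nzi_def using ideal_IK IK_1 by force

lemma ip_ideal: "ideal I R \<Longrightarrow> ideal J R \<Longrightarrow> ideal (I \<diamondop> J) R"
  using R.ideal_prod_is_ideal unfolding ip_eq .
lemma ip_comm: "ideal I R \<Longrightarrow> ideal J R \<Longrightarrow> I \<diamondop> J = J \<diamondop> I"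
  using R.ideal_prod_commute unfolding ip_eq .
lemma ip_assoc: "ideal I R \<Longrightarrow> ideal J R \<Longrightarrow> ideal L R \<Longrightarrow> I \<diamondop> J \<diamondop> L = I \<diamondop> (J \<diamondop> L)"
  using R.ideal_prod_assoc unfolding ip_eq .
lemma ip_one: "ideal I R \<Longrightarrow> I \<diamondop> IK = I"
  using R.ideal_prod_one[of I] unfolding ip_eq by simp
lemma ip_one': "ideal I R \<Longrightarrow> IK \<diamondop> I = I"
  using ip_one ip_comm ideal_IK by metis

lemma ipI: "x \<in> I \<Longrightarrow> y \<in> J \<Longrightarrow> x * y \<in> I \<diamondop> J"
  using ideal_prod.prod[of x I y J CC] by simp

lemma nzi_ip: assumes "nzi I" "nzi J" shows "nzi (I \<diamondop> J)"
proof -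
  have I: "ideal I R" "I \<noteq> {0}" and J: "ideal J R" "J \<noteq> {0}" using assms by (auto simp: nzi_def)
  obtain x where "x \<in> I" "x \<noteq> 0" using I idealD(2)[OF I(1)] by blast
  moreover obtain y where "y \<in> J" "y \<noteq> 0" using J idealD(2)[OF J(1)] by blast
  ultimately have "x * y \<in> I \<diamondop> J" "x * y \<noteq> 0" using ipI by auto
  then show ?thesis unfolding nzi_def using ip_ideal I J by auto
qed

abbreviation A where "A \<equiv> class_group K"
abbreviation F where "F \<equiv> fractional_ideal_group K"

lemma F_mult: "I \<otimes>\<^bsub>F\<^esub> J = I \<diamondop> J" by (simp add: fractional_ideal_group_def)

lemma fractional_ideals_K:
  "fractional_ideals K = {scale (inverse a) J |J a. nzi J \<and> a \<in> IK \<and> a \<noteq> 0}"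
  by (auto simp: fractional_ideals_def ring_of_integers_K nzi_def scale_def divide_inverse mult.commute image_def)

lemma scale_in_fractional:
  assumes "nzi J" "a \<in> K" "a \<noteq> 0" shows "scale a J \<in> fractional_ideals K"
proof -
  obtain p q where a: "a = of_rat p + of_rat q * s" using assms(2) by (rule qfieldE)
  obtain p1 p2 where p: "p = of_int p1 / of_int p2" "p2 > 0"
    by (metis Fract_of_int_quotient quotient_of_div quotient_of_denom_pos surj_pair)
  obtain q1 q2 where q: "q = of_int q1 / of_int q2" "q2 > 0"
    by (metis Fract_of_int_quotient quotient_of_div quotient_of_denom_pos surj_pair)
  define n where "n = p2 * q2"
  have "a * of_int n = of_int (p1 * q2) + of_int (q1 * p2) * s"
    using p(2) q(2) by (simp add: a p(1) q(1) n_def of_rat_divide distrib_right)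
  then have b: "a * of_int n \<in> IK" by simp
  have n: "n \<noteq> 0" using p q by (simp add: n_def)
  define J' where "J' = scale (a * of_int n) J"
  have J: "ideal J R" "J \<noteq> {0}" using assms by (auto simp: nzi_def)
  have "ideal J' R" unfolding J'_def scale_def
  proof (rule idealI')
    show "(*) (a * of_int n) ` J \<subseteq> IK" using b idealD(1)[OF J(1)] by auto
    show "0 \<in> (*) (a * of_int n) ` J" using idealD(2)[OF J(1)] by (intro image_eqI[of _ _ 0]) auto
    show "x + y \<in> (*) (a * of_int n) ` J" if "x \<in> (*) (a * of_int n) ` J" "y \<in> (*) (a * of_int n) ` J" for x y
      using that idealD(3)[OF J(1)] by (auto simp flip: distrib_left)
    show "c * x \<in> (*) (a * of_int n) ` J" if "x \<in> (*) (a * of_int n) ` J" "c \<in> IK" for x c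
      using that idealD(4)[OF J(1)] by (auto simp: mult.left_commute[of c])
  qed
  moreover have "J' \<noteq> {0}"
  proof -
    obtain x where "x \<in> J" "x \<noteq> 0" using J idealD(2)[OF J(1)] by blast
    then have "a * of_int n * x \<in> J'" "a * of_int n * x \<noteq> 0" using assms(3) n by (auto simp: J'_def scale_def)
    then show ?thesis by auto
  qed
  moreover have "inverse (of_int n) * (a * of_int n) = a" using n by (simp add: mult.left_commute)
  then have "scale a J = scale (inverse (of_int n)) J'" unfolding J'_def scale_scale by (simp only:)
  ultimately show ?thesis unfolding fractional_ideals_K nzi_def using n
    by (intro CollectI exI[of _ J'] exI[of _ "of_int n"]) auto
qed

lemma cls_scale:
  assumes "b \<in> K" "b \<noteq> 0" shows "cls (scale b J) = cls J"
proof (intro equalityI subsetI)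
  fix Y assume "Y \<in> cls (scale b J)"
  then obtain a where "Y = scale (a * b) J" "a \<in> K" "a \<noteq> 0" by (auto simp: cls_def scale_scale)
  then show "Y \<in> cls J" using assms unfolding cls_def by (intro CollectI exI[of _ "a * b"]) auto
next
  fix Y assume "Y \<in> cls J"
  then obtain a where "Y = scale a J" "a \<in> K" "a \<noteq> 0" by (auto simp: cls_def)
  then show "Y \<in> cls (scale b J)" using assms unfolding cls_def scale_scale
    by (intro CollectI exI[of _ "a * inverse b"]) (auto simp: mult.assoc)
qed

lemma principal_eq: "principal_fractional_ideals K = cls IK"
  by (auto simp: principal_fractional_ideals_def cls_def scale_def ring_of_integers_K)

lemma coset_eq: assumes "ideal J R" shows "cls IK #>\<^bsub>F\<^esub> scale b J = {scale (a * b) J |a. a \<in> K \<and> a \<noteq> 0}"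
  unfolding r_coset_def F_mult cls_def using ip_one'[OF assms]
  by (auto simp: scale_ip)

text \<open>Every fractional ideal is a scaled integral one, and scaling does not change the class.
  From here on only integral ideals have to be handled.\<close>

lemma carrier_A: "carrier A = {cls J |J. nzi J}"
proof -
  have "carrier A = (\<lambda>Y. cls IK #>\<^bsub>F\<^esub> Y) ` fractional_ideals K"
    unfolding class_group_def carrier_FactGroup principal_eq by (simp add: fractional_ideal_group_def)
  also have "\<dots> = {cls J |J. nzi J}"
  proof (intro equalityI subsetI)
    fix Z assume "Z \<in> (\<lambda>Y. cls IK #>\<^bsub>F\<^esub> Y) ` fractional_ideals K"
    then obtain J a where J: "nzi J" "a \<in> IK" "a \<noteq> 0" "Z = cls IK #>\<^bsub>F\<^esub> scale (inverse a) J"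
      by (auto simp: fractional_ideals_K)
    then have "Z = {scale (c * inverse a) J |c. c \<in> K \<and> c \<noteq> 0}"
      using coset_eq by (simp add: nzi_def)
    also have "\<dots> = cls (scale (inverse a) J)" by (simp add: cls_def scale_scale)
    also have "\<dots> = cls J" using J IK_in_K by (intro cls_scale) auto
    finally show "Z \<in> {cls J |J. nzi J}" using J by blast
  next
    fix Z assume "Z \<in> {cls J |J. nzi J}"
    then obtain J where J: "nzi J" "Z = cls J" by blast
    have "J \<in> fractional_ideals K" using scale_in_fractional[OF J(1), of 1] by simp
    moreover have "Z = cls IK #>\<^bsub>F\<^esub> J" using coset_eq[of J 1] J by (simp add: nzi_def cls_def)
    ultimately show "Z \<in> (\<lambda>Y. cls IK #>\<^bsub>F\<^esub> Y) ` fractional_ideals K" by blast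
  qed
  finally show ?thesis .
qed

lemma one_A: "\<one>\<^bsub>A\<^esub> = cls IK"
  by (simp add: class_group_def principal_eq)

lemma cls_mult: "cls I \<otimes>\<^bsub>A\<^esub> cls J = cls (I \<diamondop> J)"
proof -
  have "cls I \<otimes>\<^bsub>A\<^esub> cls J = {U \<diamondop> V |U V. U \<in> cls I \<and> V \<in> cls J}"
    by (auto simp: class_group_def set_mult_def F_mult)
  also have "\<dots> = cls (I \<diamondop> J)"
  proof (intro equalityI subsetI)
    fix Z assume "Z \<in> {U \<diamondop> V |U V. U \<in> cls I \<and> V \<in> cls J}"
    then obtain a b where "Z = scale (a * b) (I \<diamondop> J)" "a \<in> K" "b \<in> K" "a \<noteq> 0" "b \<noteq> 0"
      by (auto simp: cls_def scale_ip)
    then show "Z \<in> cls (I \<diamondop> J)" unfolding cls_def by (intro CollectI exI[of _ "a * b"]) auto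
  next
    fix Z assume "Z \<in> cls (I \<diamondop> J)"
    then obtain a where "Z = scale a (I \<diamondop> J)" "a \<in> K" "a \<noteq> 0" by (auto simp: cls_def)
    then have "Z = scale a I \<diamondop> scale 1 J" by (simp only: scale_ip mult.right_neutral)
    moreover have "scale a I \<in> cls I" "scale 1 J \<in> cls J"
      using \<open>a \<in> K\<close> \<open>a \<noteq> 0\<close> unfolding cls_def by (auto simp del: scale_1)
    ultimately show "Z \<in> {U \<diamondop> V |U V. U \<in> cls I \<and> V \<in> cls J}" by blast
  qed
  finally show ?thesis .
qed

lemma comm_monoid_A: "comm_monoid A"
proof (rule comm_monoidI)
  show "x \<otimes>\<^bsub>A\<^esub> y \<in> carrier A" if "x \<in> carrier A" "y \<in> carrier A" for x y
    using that nzi_ip unfolding carrier_A by (auto simp: cls_mult)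
  show "\<one>\<^bsub>A\<^esub> \<in> carrier A" unfolding carrier_A one_A using nzi_IK by auto
  show "x \<otimes>\<^bsub>A\<^esub> y \<otimes>\<^bsub>A\<^esub> z = x \<otimes>\<^bsub>A\<^esub> (y \<otimes>\<^bsub>A\<^esub> z)"
    if "x \<in> carrier A" "y \<in> carrier A" "z \<in> carrier A" for x y z
    using that unfolding carrier_A by (auto simp: cls_mult ip_assoc nzi_def)
  show "\<one>\<^bsub>A\<^esub> \<otimes>\<^bsub>A\<^esub> x = x" if "x \<in> carrier A" for x
    using that unfolding carrier_A by (auto simp: cls_mult one_A ip_one' nzi_def)
  show "x \<otimes>\<^bsub>A\<^esub> y = y \<otimes>\<^bsub>A\<^esub> x" if "x \<in> carrier A" "y \<in> carrier A" for x y
    using that ip_comm unfolding carrier_A by (auto simp: cls_mult nzi_def)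
qed

lemma cls_eq_oneD:
  assumes "cls J = \<one>\<^bsub>A\<^esub>" shows "\<exists>\<theta>\<in>K. \<theta> \<noteq> 0 \<and> J = scale \<theta> IK"
proof -
  have "J \<in> cls J" unfolding cls_def by (intro CollectI exI[of _ 1]) auto
  then have "J \<in> cls IK" using assms one_A by simp
  then show ?thesis by (auto simp: cls_def)
qed

section \<open>Powers of ideals and m-th roots of principal ideals\<close>

primrec ipow :: "complex set \<Rightarrow> nat \<Rightarrow> complex set" where
  "ipow J 0 = IK" | "ipow J (Suc n) = ipow J n \<diamondop> J"

lemma ipow_ideal: "ideal J R \<Longrightarrow> ideal (ipow J n) R"
  by (induct n) (auto simp: ideal_IK ip_ideal)

lemma ipow_add: "ideal J R \<Longrightarrow> ipow J (a + b) = ipow J a \<diamondop> ipow J b"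
proof (induct b)
  case 0 then show ?case by (simp add: ip_one ipow_ideal)
next
  case (Suc b) then show ?case by (simp add: ip_assoc ipow_ideal)
qed

lemma ipow_mult: "ideal J R \<Longrightarrow> ipow J (a * b) = ipow (ipow J a) b"
proof (induct b)
  case (Suc b)
  then show ?case using ipow_add[OF Suc.prems, of "a * b" a] by (simp add: add.commute)
qed auto

lemma ipow_ip: "ideal I R \<Longrightarrow> ideal J R \<Longrightarrow> ipow (I \<diamondop> J) n = ipow I n \<diamondop> ipow J n"
proof (induct n)
  case 0 then show ?case by (simp add: ip_one ideal_IK)
next
  case (Suc n)
  have "ipow I n \<diamondop> ipow J n \<diamondop> (I \<diamondop> J) = ipow I n \<diamondop> (ipow J n \<diamondop> (I \<diamondop> J))"
    using Suc.prems by (simp add: ip_assoc ip_ideal ipow_ideal)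
  also have "ipow J n \<diamondop> (I \<diamondop> J) = I \<diamondop> (ipow J n \<diamondop> J)"
    using Suc.prems by (metis ip_assoc ip_comm ip_ideal ipow_ideal)
  also have "ipow I n \<diamondop> (I \<diamondop> (ipow J n \<diamondop> J)) = ipow I n \<diamondop> I \<diamondop> (ipow J n \<diamondop> J)"
    using Suc.prems by (simp add: ip_assoc ip_ideal ipow_ideal)
  finally show ?case using Suc by simp
qed

lemma ipow_principal: "ipow (scale a IK) n = scale (a ^ n) IK"
proof (induct n)
  case (Suc n)
  then show ?case by (simp add: scale_ip ip_one ideal_IK mult.commute)
qed auto

lemma cls_pow: "nzi J \<Longrightarrow> cls J [^]\<^bsub>A\<^esub> (n :: nat) = cls (ipow J n)"
  by (induct n) (auto simp: one_A cls_mult)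

lemma cls_principal: "a \<in> K \<Longrightarrow> a \<noteq> 0 \<Longrightarrow> cls (scale a IK) = \<one>\<^bsub>A\<^esub>"
  by (simp add: cls_scale one_A)

lemma scale_IK_eqD:
  assumes "scale a IK = scale b IK" "a \<noteq> 0"
  shows "\<exists>u v. u \<in> IK \<and> v \<in> IK \<and> u * v = 1 \<and> a = u * b"
proof -
  have "a \<in> scale a IK" by (auto simp: scale_def intro: image_eqI[of _ _ 1])
  then have "a \<in> scale b IK" using assms by simp
  then obtain u where u: "a = b * u" "u \<in> IK" by (auto simp: scale_def)
  have "b \<in> scale b IK" by (auto simp: scale_def intro: image_eqI[of _ _ 1])
  then have "b \<in> scale a IK" using assms by simp
  then obtain v where v: "b = a * v" "v \<in> IK" by (auto simp: scale_def)
  have "a = a * (u * v)" using u(1) v(1) by (metis mult.commute mult.assoc)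
  then have "u * v = 1" using assms(2) by simp
  then show ?thesis using u v by (auto simp: mult.commute)
qed

text \<open>If \<open>a\<close> has a comaximal cofactor \<open>b\<close> with
  \<open>a * b = z ^ m\<close>, this ideal is an m-th root of the principal ideal of
  \<open>a\<close>.\<close>

definition gen2 :: "complex \<Rightarrow> complex \<Rightarrow> complex set" where
  "gen2 z a = {z * x + a * y |x y. x \<in> IK \<and> y \<in> IK}"

lemma gen2_ideal: assumes "z \<in> IK" "a \<in> IK" shows "ideal (gen2 z a) R"
proof (rule idealI')
  show "gen2 z a \<subseteq> IK" using assms by (auto simp: gen2_def)
  show "0 \<in> gen2 z a" unfolding gen2_def by (intro CollectI exI[of _ 0]) auto
  show "x + y \<in> gen2 z a" if xy: "x \<in> gen2 z a" "y \<in> gen2 z a" for x y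
  proof -
    obtain x1 x2 y1 y2 where *: "x = z * x1 + a * x2" "y = z * y1 + a * y2" "x1 \<in> IK" "x2 \<in> IK" "y1 \<in> IK" "y2 \<in> IK"
      using xy by (auto simp: gen2_def)
    then have "x + y = z * (x1 + y1) + a * (x2 + y2)" by (simp add: algebra_simps)
    then show ?thesis unfolding gen2_def using * IK_add by blast
  qed
  show "c * x \<in> gen2 z a" if xy: "x \<in> gen2 z a" "c \<in> IK" for x c
  proof -
    obtain x1 x2 where *: "x = z * x1 + a * x2" "x1 \<in> IK" "x2 \<in> IK"
      using xy by (auto simp: gen2_def)
    then have "c * x = z * (c * x1) + a * (c * x2)" by (simp add: algebra_simps)
    then show ?thesis unfolding gen2_def using * xy(2) IK_mult by blast
  qed
qed

text \<open>This identity takes the place of unique factorisation of ideals.\<close>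

lemma ipow_gen2:
  assumes z: "z \<in> IK" and a: "a \<in> IK" and b: "b \<in> IK" and ab: "a * b = z ^ m" and m: "m > 0"
    and cop: "\<exists>u\<in>IK. \<exists>v\<in>IK. u * a + v * b = 1"
  shows "ipow (gen2 z a) m = scale a IK"
proof
  \<comment> \<open>Every product of \<open>k\<close> generators other than \<open>z ^ k\<close>
    itself contains the factor \<open>a\<close>.\<close>
  have sub: "ipow (gen2 z a) k \<subseteq> gen2 (z ^ k) a" for k
  proof (induct k)
    case 0
    have "x \<in> gen2 1 a" if "x \<in> IK" for x
      unfolding gen2_def using that by (intro CollectI exI[of _ x] exI[of _ 0]) auto
    then show ?case by auto
  next
    case (Suc k)
    show ?case
    proof
      fix x assume "x \<in> ipow (gen2 z a) (Suc k)"
      then have "x \<in> ipow (gen2 z a) k \<diamondop> gen2 z a" by simp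
      then show "x \<in> gen2 (z ^ Suc k) a"
      proof (induct rule: ideal_prod.induct)
        case (prod i j)
        then obtain x1 y1 x2 y2 where *: "i = z ^ k * x1 + a * y1" "j = z * x2 + a * y2"
            "x1 \<in> IK" "x2 \<in> IK" "y1 \<in> IK" "y2 \<in> IK"
          using Suc by (auto simp: gen2_def)
        have "i * j = z ^ Suc k * (x1 * x2) + a * (z ^ k * x1 * y2 + y1 * (z * x2 + a * y2))"
          unfolding * by (simp add: algebra_simps)
        moreover have "z ^ k * x1 * y2 + y1 * (z * x2 + a * y2) \<in> IK" "x1 * x2 \<in> IK" using * z a by auto
        ultimately show ?case unfolding gen2_def CC_simps by blast
      next
        case (sum s1 s2)
        then show ?case using idealD(3)[OF gen2_ideal[of "z ^ Suc k" a]] z a by (simp del: power_Suc)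
      qed
    qed
  qed
  show "ipow (gen2 z a) m \<subseteq> scale a IK"
  proof
    fix x assume "x \<in> ipow (gen2 z a) m"
    then have "x \<in> gen2 (z ^ m) a" using sub by blast
    then obtain x1 y1 where "x = z ^ m * x1 + a * y1" "x1 \<in> IK" "y1 \<in> IK" by (auto simp: gen2_def)
    then have "x = a * (b * x1 + y1)" "b * x1 + y1 \<in> IK" using b by (auto simp: ab[symmetric] algebra_simps)
    then show "x \<in> scale a IK" by (auto simp: scale_def)
  qed
  have gen: "z \<in> gen2 z a" "a \<in> gen2 z a" unfolding gen2_def
    by (intro CollectI exI[of _ 1] exI[of _ 0], simp) (intro CollectI exI[of _ 0] exI[of _ 1], simp)
  have pow: "x ^ k \<in> ipow J k" if "x \<in> J" for x J k
    by (induct k) (use that ipI in \<open>auto simp: mult.commute[of x]\<close>)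
  obtain u v where uv: "u \<in> IK" "v \<in> IK" "u * a + v * b = 1" using cop by blast
  \<comment> \<open>For \<open>k = m - 1\<close>, multiplication by \<open>a\<close> turns this into
    \<open>a = u' * a ^ m + v' * z ^ m\<close>, and both m-th powers lie in the power of the
    ideal.\<close>
  have "\<exists>u'\<in>IK. \<exists>v'\<in>IK. u' * a ^ k + v' * b = 1" for k
  proof (induct k)
    case 0 show ?case by (intro bexI[of _ 1] bexI[of _ 0]) auto
  next
    case (Suc k)
    then obtain u' v' where *: "u' \<in> IK" "v' \<in> IK" "u' * a ^ k + v' * b = 1" by blast
    have "1 = (u' * a ^ k + v' * b) * (u * a + v * b)" using * uv by simp
    also have "\<dots> = (u' * u) * a ^ Suc k + (u' * a ^ k * v + v' * (u * a + v * b)) * b"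
      by (simp add: algebra_simps)
    finally show ?case using * uv a b by (intro bexI[of _ "u' * u"] bexI[of _ "u' * a ^ k * v + v' * (u * a + v * b)"]) auto
  qed
  then obtain u' v' where *: "u' \<in> IK" "v' \<in> IK" "u' * a ^ (m - 1) + v' * b = 1" by blast
  have "a = a * (u' * a ^ (m - 1) + v' * b)" using * by simp
  also have "\<dots> = u' * a ^ m + v' * z ^ m" using m
  proof -
    have "a * a ^ (m - 1) = a ^ m" using m by (metis power_eq_if not_gr_zero)
    moreover have "a * (u' * a ^ (m - 1) + v' * b) = u' * (a * a ^ (m - 1)) + v' * (a * b)"
      by (simp add: algebra_simps)
    ultimately show ?thesis by (simp only: ab)
  qed
  finally have a_eq: "a = u' * a ^ m + v' * z ^ m" .
  have id: "ideal (ipow (gen2 z a) m) R" by (intro ipow_ideal gen2_ideal z a)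
  have "a \<in> ipow (gen2 z a) m"
    by (subst a_eq) (intro idealD(3)[OF id] idealD(4)[OF id] pow gen *)
  then have "y * a \<in> ipow (gen2 z a) m" if "y \<in> IK" for y using idealD(4)[OF id] that by blast
  then show "scale a IK \<subseteq> ipow (gen2 z a) m" by (auto simp: scale_def mult.commute[of a])
qed

text \<open>The relation makes a product of ideal powers principal, with generator \<theta>. As
  \<open>k * \<rho> = m\<close>, the \<rho>-th power of that ideal is also generated by
  \<open>\<alpha> ^ i * \<beta> ^ j\<close>, and two generators differ by a unit.\<close>

lemma cls_relation:
  assumes I: "nzi I" "ipow I m = scale \<alpha> IK" "\<alpha> \<in> K" "\<alpha> \<noteq> 0"
    and J: "nzi J" "ipow J m = scale \<beta> IK" "\<beta> \<in> K" "\<beta> \<noteq> 0"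
    and m: "m = k * \<rho>"
    and one: "cls I [^]\<^bsub>A\<^esub> (k * i) \<otimes>\<^bsub>A\<^esub> cls J [^]\<^bsub>A\<^esub> (k * j) = \<one>\<^bsub>A\<^esub>"
  shows "\<exists>u v \<theta>. u \<in> IK \<and> v \<in> IK \<and> u * v = 1 \<and> \<theta> \<in> IK \<and> \<alpha> ^ i * \<beta> ^ j = u * \<theta> ^ \<rho>"
proof -
  have id: "ideal I R" "ideal J R" using I J by (auto simp: nzi_def)
  have "cls (ipow I (k * i) \<diamondop> ipow J (k * j)) = \<one>\<^bsub>A\<^esub>"
    using one I J by (simp add: cls_pow cls_mult)
  then obtain \<theta> where \<theta>: "\<theta> \<in> K" "\<theta> \<noteq> 0" "ipow I (k * i) \<diamondop> ipow J (k * j) = scale \<theta> IK"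
    using cls_eq_oneD by blast
  have "scale \<theta> IK \<subseteq> IK"
    using idealD(1)[OF ip_ideal[OF ipow_ideal[OF id(1)] ipow_ideal[OF id(2)]]] \<theta>(3) by metis
  then have "\<theta> \<in> IK" by (force simp: scale_def)
  have "scale (\<theta> ^ \<rho>) IK = ipow (ipow I (k * i) \<diamondop> ipow J (k * j)) \<rho>"
    unfolding \<theta>(3) ipow_principal ..
  also have "\<dots> = ipow (ipow I (k * i)) \<rho> \<diamondop> ipow (ipow J (k * j)) \<rho>"
    by (intro ipow_ip ipow_ideal id)
  also have "\<dots> = ipow I (m * i) \<diamondop> ipow J (m * j)"
    unfolding m by (simp add: id mult_ac flip: ipow_mult)
  also have "\<dots> = scale (\<alpha> ^ i) IK \<diamondop> scale (\<beta> ^ j) IK"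
    by (simp add: ipow_mult id I J ipow_principal)
  also have "\<dots> = scale (\<alpha> ^ i * \<beta> ^ j) IK" by (simp add: scale_ip ip_one ideal_IK)
  finally have "scale (\<alpha> ^ i * \<beta> ^ j) IK = scale (\<theta> ^ \<rho>) IK" ..
  from scale_IK_eqD[OF this] show ?thesis using I J \<open>\<theta> \<in> IK\<close> by auto
qed

end

section \<open>Units\<close>

text \<open>The multiplicative form of the fact that discrete subgroups of the line are cyclic: the
  least element above 1 generates, by division with remainder on logarithms. Without such an element
  the positive part is trivial and \<epsilon> = 1 serves.\<close>

lemma discrete_subgroup_cyclic:
  fixes G :: "real set"
  assumes one: "1 \<in> G" and mult: "\<And>x y. x \<in> G \<Longrightarrow> y \<in> G \<Longrightarrow> x * y \<in> G"
    and inv: "\<And>x. x \<in> G \<Longrightarrow> inverse x \<in> G"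
    and fin: "\<And>B. finite {x \<in> G. 1 < x \<and> x \<le> B}"
  obtains \<epsilon> where "\<epsilon> \<in> G" "\<epsilon> > 0" "\<And>x. x \<in> G \<Longrightarrow> x > 0 \<Longrightarrow> \<exists>k. x = \<epsilon> powi k"
proof (cases "\<exists>y\<in>G. y > 1")
  case False
  have "x = 1" if "x \<in> G" "x > 0" for x
  proof (rule ccontr)
    assume "x \<noteq> 1"
    moreover have "x \<le> 1" using False that by force
    ultimately have "inverse x > 1" using that by (simp add: one_less_inverse)
    then show False using False inv[OF that(1)] by blast
  qed
  then show ?thesis using that[of 1] one by auto
next
  case True
  then obtain y where y: "y \<in> G" "y > 1" by blast
  define T where "T = {x \<in> G. 1 < x \<and> x \<le> y}"
  have T: "finite T" "T \<noteq> {}" using fin y by (auto simp: T_def)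
  define \<epsilon> where "\<epsilon> = Min T"
  have "\<epsilon> \<in> T" unfolding \<epsilon>_def using T by (rule Min_in)
  then have \<epsilon>: "\<epsilon> \<in> G" "\<epsilon> > 1" by (auto simp: T_def)
  have least: "x \<ge> \<epsilon>" if "x \<in> G" "x > 1" for x
  proof (cases "x \<le> y")
    case True then show ?thesis using that T unfolding \<epsilon>_def T_def by (intro Min_le) auto
  next
    case False then show ?thesis using \<open>\<epsilon> \<in> T\<close> by (auto simp: T_def)
  qed
  have pow: "\<epsilon> ^ n \<in> G" for n using one mult \<epsilon>(1) by (induct n) auto
  have powi: "\<epsilon> powi k \<in> G" for k
    using pow inv[OF pow] by (simp add: power_int_def power_inverse)
  have "\<exists>k. x = \<epsilon> powi k" if x: "x \<in> G" "x > 0" for x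
  proof -
    define k where "k = \<lfloor>log \<epsilon> x\<rfloor>"
    have pr: "\<epsilon> powi j = \<epsilon> powr of_int j" for j
      using \<epsilon> by (simp add: powr_real_of_int')
    have 1: "\<epsilon> powi k \<le> x"
    proof -
      have "\<epsilon> powr of_int k \<le> \<epsilon> powr (log \<epsilon> x)" using \<epsilon> by (intro powr_mono) (auto simp: k_def)
      then show ?thesis using \<epsilon> x by (simp add: pr)
    qed
    have 2: "x < \<epsilon> powi (k + 1)"
    proof -
      have "\<epsilon> powr (log \<epsilon> x) < \<epsilon> powr of_int (k + 1)"
      proof (rule powr_less_mono)
        show "log \<epsilon> x < of_int (k + 1)" unfolding k_def by linarith
      qed (rule \<epsilon>(2))
      then show ?thesis using \<epsilon> x unfolding pr by simp
    qed
    define z where "z = x * inverse (\<epsilon> powi k)"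
    have pos: "\<epsilon> powi k > 0" using \<epsilon> by (simp add: zero_less_power_int)
    have "z \<in> G" unfolding z_def by (intro mult x inv powi)
    moreover have "z \<ge> 1" using 1 pos by (simp add: z_def divide_inverse[symmetric])
    moreover have "z < \<epsilon>"
    proof -
      have "x < \<epsilon> * \<epsilon> powi k" using 2 \<epsilon> by (simp add: power_int_add mult.commute)
      then show ?thesis using pos by (simp add: z_def divide_inverse[symmetric] pos_divide_less_eq)
    qed
    ultimately have "z = 1" using least[of z] by force
    then have "x = \<epsilon> powi k" using pos by (simp add: z_def divide_inverse[symmetric])
    then show ?thesis by blast
  qed
  then show ?thesis using that[of \<epsilon>] \<epsilon> by auto
qed

text \<open>Up to sign both elements are powers of one \<epsilon>, with exponents \<open>k1\<close>
  and \<open>k2\<close>. A linear form \<open>i * k1 + j * k2\<close> vanishing modulo \<rho> exists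
  with \<open>i = 1, j = 0\<close> if \<rho> divides \<open>k1\<close>, and with
  \<open>j = 1\<close> otherwise.\<close>

lemma discrete_subgroup_dependent:
  fixes G :: "real set"
  assumes one: "1 \<in> G" and mult: "\<And>x y. x \<in> G \<Longrightarrow> y \<in> G \<Longrightarrow> x * y \<in> G"
    and inv: "\<And>x. x \<in> G \<Longrightarrow> inverse x \<in> G" and neg: "\<And>x. x \<in> G \<Longrightarrow> - x \<in> G"
    and nz: "0 \<notin> G" and fin: "\<And>B. finite {x \<in> G. 1 < x \<and> x \<le> B}"
    and x: "x1 \<in> G" "x2 \<in> G" and \<rho>: "prime (\<rho> :: nat)"
  obtains i j v where "\<not> (\<rho> dvd i \<and> \<rho> dvd j)" "v \<in> G" "x1 ^ i * x2 ^ j = v ^ \<rho> \<or> x1 ^ i * x2 ^ j = - (v ^ \<rho>)"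
proof -
  obtain \<epsilon> where \<epsilon>: "\<epsilon> \<in> G" "\<epsilon> > 0" "\<And>x. x \<in> G \<Longrightarrow> x > 0 \<Longrightarrow> \<exists>k. x = \<epsilon> powi k"
    using discrete_subgroup_cyclic[OF one mult inv fin] by metis
  have pow: "\<epsilon> ^ n \<in> G" for n using one mult \<epsilon>(1) by (induct n) auto
  have powi: "\<epsilon> powi k \<in> G" for k
    using pow inv[OF pow] by (simp add: power_int_def power_inverse)
  have abs: "\<exists>k. \<bar>x\<bar> = \<epsilon> powi k" if "x \<in> G" for x
    using \<epsilon>(3)[of "\<bar>x\<bar>"] neg[OF that] that nz by (cases "x > 0") (auto simp: abs_if)
  obtain k1 where k1: "\<bar>x1\<bar> = \<epsilon> powi k1" using abs x by blast
  obtain k2 where k2: "\<bar>x2\<bar> = \<epsilon> powi k2" using abs x by blast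
  have "\<exists>i j. \<not> (\<rho> dvd i \<and> \<rho> dvd j) \<and> int \<rho> dvd int i * k1 + int j * k2"
  proof (cases "int \<rho> dvd k1")
    case True
    have "\<not> \<rho> dvd 1" using \<rho> by (metis not_prime_unit)
    then show ?thesis using True by (intro exI[of _ 1] exI[of _ 0]) auto
  next
    case False
    then have "coprime k1 (int \<rho>)"
      using \<rho> by (metis coprime_commute prime_imp_coprime prime_int_nat_transfer nat_int of_nat_0_le_iff)
    then obtain u where u: "[k1 * u = 1] (mod int \<rho>)" using cong_solve_coprime_int by blast
    define i where "i = nat ((- k2 * u) mod int \<rho>)"
    have "\<rho> > 0" using \<rho> prime_gt_0_nat by blast
    then have "[int i = - k2 * u] (mod int \<rho>)" by (simp add: i_def cong_def)
    then have "[int i * k1 = - k2 * u * k1] (mod int \<rho>)" by (rule cong_scalar_right)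
    also have "[- k2 * u * k1 = - k2 * 1] (mod int \<rho>)"
      using cong_scalar_left[OF u, of "- k2"] by (simp add: mult_ac)
    finally have "[int i * k1 + k2 = - k2 * 1 + k2] (mod int \<rho>)" by (rule cong_add[OF _ cong_refl])
    then have "int \<rho> dvd int i * k1 + int 1 * k2" by (simp add: cong_0_iff)
    moreover have "\<not> \<rho> dvd 1" using \<rho> by (metis not_prime_unit)
    ultimately show ?thesis by blast
  qed
  then obtain i j t where ij: "\<not> (\<rho> dvd i \<and> \<rho> dvd j)" "int i * k1 + int j * k2 = int \<rho> * t"
    by (auto elim!: dvdE)
  have nz\<epsilon>: "\<epsilon> \<noteq> 0" using \<epsilon> by simp
  have "\<bar>x1 ^ i * x2 ^ j\<bar> = (\<epsilon> powi k1) ^ i * (\<epsilon> powi k2) ^ j"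
    by (simp add: abs_mult power_abs k1 k2)
  also have "\<dots> = \<epsilon> powi (k1 * int i) * \<epsilon> powi (k2 * int j)"
    by (simp add: power_int_mult)
  also have "\<dots> = \<epsilon> powi (t * int \<rho>)"
    using nz\<epsilon> ij(2) by (simp add: power_int_add[symmetric] mult.commute)
  also have "\<dots> = (\<epsilon> powi t) ^ \<rho>" by (simp add: power_int_mult)
  finally have "x1 ^ i * x2 ^ j = (\<epsilon> powi t) ^ \<rho> \<or> x1 ^ i * x2 ^ j = - ((\<epsilon> powi t) ^ \<rho>)"
    by (simp add: abs_if split: if_splits)
  then show ?thesis using that ij(1) powi by blast
qed

section \<open>Units in the ring of integers\<close>

context quadratic
begin

definition is_unit :: "complex \<Rightarrow> bool" where
  "is_unit u \<longleftrightarrow> u \<in> IK \<and> (\<exists>v\<in>IK. u * v = 1)"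

text \<open>Passing to \<open>2 * x\<close> removes the case distinction on \<open>d mod 4\<close>
  from everything that follows; the factor 2 is invertible modulo the odd primes considered
  later.\<close>

lemma IK_double: "x \<in> IK \<Longrightarrow> \<exists>a b. 2 * x = of_int a + of_int b * s"
proof (elim IK_E)
  fix a b assume x: "x = of_int a + of_int b * w"
  show ?thesis
  proof (cases "d mod 4 = 1")
    case True
    then have "2 * x = of_int (2 * a + b) + of_int b * s" by (simp add: x w_def algebra_simps)
    then show ?thesis by blast
  next
    case False
    then have "2 * x = of_int (2 * a) + of_int (2 * b) * s" by (simp add: x w_def algebra_simps)
    then show ?thesis by blast
  qed
qed

lemma nm_IK: "x \<in> IK \<Longrightarrow> nm x \<in> \<int>"
  using algebraic_int_nm IK_iff by blast

lemma is_unit_nm: assumes "is_unit u" shows "nm u = 1 \<or> nm u = - 1"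
proof -
  obtain v where v: "u \<in> IK" "v \<in> IK" "u * v = 1" using assms by (auto simp: is_unit_def)
  have "nm u * nm v = nm 1" using v nm_mult IK_in_K by metis
  then have 1: "nm u * nm v = 1" by (simp add: nm_def)
  obtain a where a: "nm u = of_int a" using nm_IK[OF v(1)] by (auto elim: Ints_cases)
  obtain b where b: "nm v = of_int b" using nm_IK[OF v(2)] by (auto elim: Ints_cases)
  have "a * b = 1" using 1 by (simp add: a b flip: of_int_mult)
  then have "a = 1 \<or> a = -1" by (metis zmult_eq_1_iff)
  then show ?thesis using a by auto
qed

lemma IK_double_unit:
  assumes "is_unit u" obtains a b where "2 * u = of_int a + of_int b * s" "a\<^sup>2 - d * b\<^sup>2 = 4 \<or> a\<^sup>2 - d * b\<^sup>2 = - 4"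
proof -
  have u: "u \<in> IK" using assms by (simp add: is_unit_def)
  then obtain a b where ab: "2 * u = of_int a + of_int b * s" using IK_double by blast
  have "nm (of_int 2) = 4" by (simp only: nm_def cj_int) simp
  then have "nm (2 * u) = 4 * nm u" using nm_mult[OF int_in_K[of 2] IK_in_K[OF u]] by simp
  moreover have "nm (2 * u) = of_int (a\<^sup>2 - d * b\<^sup>2)"
    unfolding ab nm_def by (simp add: power2_eq_square algebra_simps)
  ultimately have "of_int (a\<^sup>2 - d * b\<^sup>2) = (of_int 4 :: complex) \<or> of_int (a\<^sup>2 - d * b\<^sup>2) = (of_int (-4) :: complex)"
    using is_unit_nm[OF assms] by auto
  then have "a\<^sup>2 - d * b\<^sup>2 = 4 \<or> a\<^sup>2 - d * b\<^sup>2 = - 4" by (simp only: of_int_eq_iff)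
  then show ?thesis using that ab by blast
qed

text \<open>A unit with \<open>b\<close> nonzero would make \<open>a^2 - d b^2\<close> exceed 4. The
  bound on \<open>d\<close> excludes the fields with further roots of unity.\<close>

lemma imaginary_unit:
  assumes "d < -4" "is_unit u" shows "u = 1 \<or> u = - 1"
proof -
  obtain a b where ab: "2 * u = of_int a + of_int b * s" "a\<^sup>2 - d * b\<^sup>2 = 4 \<or> a\<^sup>2 - d * b\<^sup>2 = - 4"
    using IK_double_unit[OF assms(2)] by blast
  have "b = 0"
  proof (rule ccontr)
    assume "b \<noteq> 0"
    then have "b\<^sup>2 \<ge> 1" by (metis one_le_power int_one_le_iff_zero_less zero_less_power2)
    then have "d * b\<^sup>2 \<le> d * 1" using assms(1) by (intro mult_left_mono_neg) auto
    moreover have "a\<^sup>2 \<ge> 0" by simp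
    ultimately have "a\<^sup>2 - d * b\<^sup>2 > 4" using assms(1) by linarith
    then show False using ab(2) by linarith
  qed
  then have "a\<^sup>2 = 4 \<or> a\<^sup>2 = - 4" using ab(2) by simp
  moreover have "a\<^sup>2 \<ge> 0" by simp
  ultimately have "a\<^sup>2 = 4" by linarith
  then have "a\<^sup>2 = 2\<^sup>2" by simp
  then have "a = 2 \<or> a = - 2" by (metis power2_eq_iff)
  then show ?thesis using ab(1) \<open>b = 0\<close> by auto
qed

lemma is_unit_mult: "is_unit u \<Longrightarrow> is_unit v \<Longrightarrow> is_unit (u * v)"
proof -
  assume "is_unit u" "is_unit v"
  then obtain u' v' where *: "u \<in> IK" "v \<in> IK" "u' \<in> IK" "v' \<in> IK" "u * u' = 1" "v * v' = 1"
    by (auto simp: is_unit_def)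
  have "(u * v) * (u' * v') = (u * u') * (v * v')" by (simp add: mult_ac)
  then show ?thesis using * unfolding is_unit_def by (intro conjI bexI[of _ "u' * v'"]) auto
qed

lemma is_unit_inverse: "is_unit u \<Longrightarrow> is_unit (inverse u)"
  by (auto simp: is_unit_def) (metis inverse_unique mult.commute)+

lemma is_unit_1: "is_unit 1" by (auto simp: is_unit_def)

lemma is_unit_minus: "is_unit u \<Longrightarrow> is_unit (- u)"
  unfolding is_unit_def by (metis IK_minus minus_mult_minus)

lemma is_unit_nz: "is_unit u \<Longrightarrow> u \<noteq> 0" by (auto simp: is_unit_def)

text \<open>A unit in the interval from 1 to \<open>B\<close> has a conjugate of absolute value
  below 1, so its doubled coordinates are bounded. The units are therefore discrete on the line,
  which is the bound 1 for the rank in Dirichlet's theorem.\<close>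

lemma real_units_dependent:
  assumes "d > 0" "is_unit u1" "is_unit u2" "prime (\<rho> :: nat)"
  obtains i j v where "\<not> (\<rho> dvd i \<and> \<rho> dvd j)" "is_unit v"
    "u1 ^ i * u2 ^ j = v ^ \<rho> \<or> u1 ^ i * u2 ^ j = - (v ^ \<rho>)"
proof -
  define G where "G = {x :: real. is_unit (of_real x)}"
  obtain r where r: "s = of_real r" using s_real[OF assms(1)] by (auto elim: Reals_cases)
  have "of_real (r\<^sup>2) = (of_real (of_int d) :: complex)" using s_square r by simp
  then have r2: "r\<^sup>2 = of_int d" by (simp only: of_real_eq_iff)
  have "\<bar>r\<bar> \<ge> 1"
  proof -
    have "\<bar>r\<bar>\<^sup>2 \<ge> 1\<^sup>2" using r2 assms(1) by simp
    then show ?thesis by (rule power2_le_imp_le) auto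
  qed
  have unit_real: "\<exists>x\<in>G. u = of_real x" if u: "is_unit u" for u
  proof -
    obtain a b where "2 * u = of_int a + of_int b * s" using IK_double u unfolding is_unit_def by blast
    then have "u = of_real ((of_int a + of_int b * r) / 2)" by (simp add: r mult.commute)
    then show ?thesis using u
      by (intro bexI[of _ "(of_int a + of_int b * r) / 2"]) (simp_all only: G_def mem_Collect_eq)
  qed
  have G_half: "\<exists>a b :: int. x = (of_int a + of_int b * r) / 2 \<and> \<bar>of_int a\<bar> \<le> B + 1 \<and> \<bar>of_int b\<bar> \<le> B + 1"
    if x: "x \<in> G" "1 < x" "x \<le> B" for x B
  proof -
    obtain a b where ab: "2 * (of_real x :: complex) = of_int a + of_int b * s" "a\<^sup>2 - d * b\<^sup>2 = 4 \<or> a\<^sup>2 - d * b\<^sup>2 = - 4"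
      using IK_double_unit x unfolding G_def by blast
    have "(of_real (2 * x) :: complex) = of_real (of_int a + of_int b * r)" using ab(1) r by simp
    then have x2: "2 * x = of_int a + of_int b * r" by (simp only: of_real_eq_iff)
    \<comment> \<open>The conjugate of \<open>x\<close>; their product is the norm, 1 or -1.\<close>
    define x' where "x' = (of_int a - of_int b * r) / 2"
    have "4 * (x * x') = (2 * x) * (2 * x')" by simp
    also have "\<dots> = (of_int a)\<^sup>2 - (of_int b)\<^sup>2 * r\<^sup>2" unfolding x2 x'_def by (simp add: power2_eq_square algebra_simps)
    also have "\<dots> = of_int (a\<^sup>2 - d * b\<^sup>2)" by (simp add: r2)
    finally have "4 * (x * x') = of_int 4 \<or> 4 * (x * x') = of_int (- 4)" using ab(2) by metis
    then have "\<bar>4 * (x * x')\<bar> = 4"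
      by (elim disjE) (simp_all only: of_int_numeral of_int_minus abs_minus_cancel abs_numeral)
    then have "x * \<bar>x'\<bar> = 1" using x(2) by (simp add: abs_mult)
    have "\<bar>x'\<bar> < 1"
    proof (rule ccontr)
      assume "\<not> ?thesis"
      then have "x * 1 \<le> x * \<bar>x'\<bar>" using x(2) by (intro mult_left_mono) auto
      then show False using \<open>x * \<bar>x'\<bar> = 1\<close> x(2) by simp
    qed
    have "of_int a = x + x'" "of_int b * r = x - x'" using x2 by (simp_all add: x'_def field_simps)
    then have "\<bar>of_int a :: real\<bar> \<le> B + 1" "\<bar>of_int b * r\<bar> \<le> B + 1" using \<open>\<bar>x'\<bar> < 1\<close> x by linarith+
    moreover have "\<bar>of_int b\<bar> * 1 \<le> \<bar>of_int b\<bar> * \<bar>r\<bar>" using \<open>\<bar>r\<bar> \<ge> 1\<close> by (intro mult_left_mono) auto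
    ultimately show ?thesis using x2 by (intro exI[of _ a] exI[of _ b]) (auto simp: abs_mult)
  qed
  have fin: "finite {x \<in> G. 1 < x \<and> x \<le> B}" for B
  proof (rule finite_subset)
    define N where "N = \<lceil>B + 1\<rceil>"
    show "finite ((\<lambda>(a, b). (of_int a + of_int b * r) / 2) ` ({- N..N} \<times> {- N..N}))" by simp
    show "{x \<in> G. 1 < x \<and> x \<le> B} \<subseteq> (\<lambda>(a, b). (of_int a + of_int b * r) / 2) ` ({- N..N} \<times> {- N..N})"
    proof
      fix x assume "x \<in> {x \<in> G. 1 < x \<and> x \<le> B}"
      then obtain a b :: int where ab: "x = (of_int a + of_int b * r) / 2" "\<bar>of_int a\<bar> \<le> B + 1" "\<bar>of_int b\<bar> \<le> B + 1"
        using G_half by blast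
      have le: "\<bar>k\<bar> \<le> N" if "\<bar>of_int k\<bar> \<le> B + 1" for k :: int
        using that unfolding N_def by (metis of_int_abs ceiling_mono ceiling_of_int)
      have "a \<in> {- N..N}" "b \<in> {- N..N}" using le[OF ab(2)] le[OF ab(3)] by auto
      then show "x \<in> (\<lambda>(a, b). (of_int a + of_int b * r) / 2) ` ({- N..N} \<times> {- N..N})" using ab(1) by force
    qed
  qed
  obtain x1 x2 where x: "x1 \<in> G" "x2 \<in> G" "u1 = of_real x1" "u2 = of_real x2"
    using unit_real assms(2,3) by metis
  obtain i j v where ij: "\<not> (\<rho> dvd i \<and> \<rho> dvd j)" "v \<in> G" "x1 ^ i * x2 ^ j = v ^ \<rho> \<or> x1 ^ i * x2 ^ j = - (v ^ \<rho>)"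
  proof (rule discrete_subgroup_dependent[of G x1 x2 \<rho>])
    show "1 \<in> G" by (simp add: G_def is_unit_1)
    show "x * y \<in> G" if "x \<in> G" "y \<in> G" for x y using that is_unit_mult by (simp add: G_def)
    show "inverse x \<in> G" if "x \<in> G" for x using is_unit_inverse[of "of_real x"] that by (simp add: G_def)
    show "- x \<in> G" if "x \<in> G" for x using that is_unit_minus by (simp add: G_def)
    show "0 \<notin> G" using is_unit_nz by (auto simp: G_def)
  qed (use fin x assms(4) in auto)
  have "u1 ^ i * u2 ^ j = of_real (x1 ^ i * x2 ^ j)" by (simp add: x)
  then have "u1 ^ i * u2 ^ j = of_real v ^ \<rho> \<or> u1 ^ i * u2 ^ j = - (of_real v ^ \<rho>)"
    by (metis ij(3) of_real_power of_real_minus)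
  then show ?thesis using that[of i j "of_real v"] ij by (simp add: G_def)
qed

end

section \<open>Primes in residue classes and primitive roots\<close>

text \<open>The prime is chosen so that \<open>V\<close> has order exactly \<open>2 * \<rho>\<close>
  modulo \<open>l\<close>, and the order divides \<open>l - 1\<close>. For odd \<rho> it is a prime
  factor of \<open>(V^\<rho> + 1) / (V + 1)\<close>, for \<rho> = 2 any prime factor of
  \<open>V^2 + 1\<close>.\<close>

lemma prime_cong_1_dvd_power_add_1:
  fixes V \<rho> :: nat
  assumes V: "V > 0" "even V" "\<rho> dvd V" and \<rho>: "prime \<rho>"
  shows "\<exists>l. prime l \<and> l dvd V ^ \<rho> + 1 \<and> 2 * \<rho> dvd l - 1"
proof -
  have V2: "V \<ge> 2" using V(1,2) by (auto elim!: evenE)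
  have "\<exists>l. prime l \<and> l dvd V ^ \<rho> + 1 \<and> (odd \<rho> \<longrightarrow> \<not> l dvd V + 1)"
  proof (cases "odd \<rho>")
    case False
    have "V ^ \<rho> + 1 \<noteq> 1" using V by simp
    then show ?thesis using False prime_factor_nat by blast
  next
    case True
    then have \<rho>3: "\<rho> \<ge> 3" using prime_ge_2_nat[OF \<rho>] by (cases "\<rho> = 2") auto
    \<comment> \<open>The quotient \<open>(V^\<rho> + 1) / (V + 1)\<close> as a geometric sum with
      ratio \<open>- V\<close>.\<close>
    define W :: int where "W = (\<Sum>i<\<rho>. (- int V) ^ i)"
    have "(- int V) ^ \<rho> - 1 = (- int V - 1) * W" unfolding W_def by (rule power_diff_1_eq)
    then have eq: "(int V + 1) * W = int V ^ \<rho> + 1" using True by (simp add: algebra_simps)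
    have "int V ^ 1 < int V ^ \<rho>" using V2 \<rho>3 by (intro power_strict_increasing) auto
    then have "(int V + 1) * W > (int V + 1) * 1" unfolding eq by (simp only: power_one_right mult_1_right)
    then have W1: "W > 1" using V by (simp add: mult_less_cancel_left)
    then have "nat W \<noteq> 1" by linarith
    then obtain l where l: "prime l" "l dvd nat W" using prime_factor_nat by blast
    have "int l dvd int (nat W)" using l(2) by (simp only: int_dvd_int_iff)
    then have lW: "int l dvd W" using W1 by simp
    then have "int l dvd int V ^ \<rho> + 1" using eq by (metis dvd_mult)
    then have "l dvd V ^ \<rho> + 1" by (metis int_dvd_int_iff of_nat_1 of_nat_add of_nat_power)
    \<comment> \<open>Modulo a divisor of \<open>V + 1\<close> the sum \<open>W\<close> reduces to
      \<rho>. Then \<open>l\<close> would divide \<rho>, hence \<open>V\<close>, hence 1.\<close>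
    moreover have "\<not> l dvd V + 1"
    proof
      assume "l dvd V + 1"
      then have "int l dvd int V + 1" by (metis int_dvd_int_iff of_nat_1 of_nat_add)
      then have "[- int V = 1] (mod int l)"
        by (metis (no_types, lifting) cong_iff_dvd_diff cong_sym diff_minus_eq_add add.commute)
      then have "[(- int V) ^ i = 1 ^ i] (mod int l)" for i by (rule cong_pow)
      then have "[W = (\<Sum>i<\<rho>. 1)] (mod int l)" unfolding W_def by (intro cong_sum) simp
      then have "[W = int \<rho>] (mod int l)" by simp
      then have "int l dvd int \<rho>" using lW by (metis cong_dvd_iff dvd_refl cong_sym)
      then have "l dvd \<rho>" by simp
      then have "l dvd V" using V(3) by (rule dvd_trans)
      then have "l dvd 1" using \<open>l dvd V + 1\<close> by (metis dvd_add_right_iff)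
      then show False using l(1) by (metis not_prime_unit)
    qed
    ultimately show ?thesis using l(1) by blast
  qed
  then obtain l where l: "prime l" "l dvd V ^ \<rho> + 1" "odd \<rho> \<longrightarrow> \<not> l dvd V + 1" by blast
  have "\<rho> > 0" using \<rho> prime_gt_0_nat by blast
  then have "even (V ^ \<rho>)" using V by simp
  then have "odd l" using l(2) by (metis dvd_trans even_plus_one_iff odd_one dvd_add_right_iff)
  have not2: "\<not> l dvd 2"
  proof
    assume "l dvd 2"
    then have "l = 2" using l(1) by (metis primes_dvd_imp_eq two_is_prime_nat)
    then show False using \<open>odd l\<close> by simp
  qed
  have cop: "coprime l V"
  proof (rule prime_imp_coprime[OF l(1)])
    show "\<not> l dvd V"
    proof
      assume "l dvd V"
      then have "l dvd V ^ \<rho>" using \<open>\<rho> > 0\<close> by (metis dvd_power dvd_trans)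
      then have "l dvd 1" using l(2) by (metis dvd_add_right_iff)
      then show False using l(1) by (metis not_prime_unit)
    qed
  qed
  have m1: "[V ^ \<rho> \<noteq> 1] (mod l)"
  proof
    assume "[V ^ \<rho> = 1] (mod l)"
    then have "[V ^ \<rho> + 1 = 1 + 1] (mod l)" by (rule cong_add[OF _ cong_refl])
    then have "l dvd 2" using l(2) by (metis cong_dvd_iff one_add_one)
    then show False using not2 by simp
  qed
  have "[V ^ (2 * \<rho>) = 1] (mod l)"
  proof -
    have "int l dvd (int V ^ \<rho> + 1) * (int V ^ \<rho> - 1)"
      using l(2) by (intro dvd_mult2) (metis int_dvd_int_iff of_nat_1 of_nat_add of_nat_power)
    also have "(int V ^ \<rho> + 1) * (int V ^ \<rho> - 1) = int V ^ (2 * \<rho>) - 1"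
    proof -
      have "int V ^ (2 * \<rho>) = (int V ^ \<rho>)\<^sup>2" by (metis mult.commute power_mult)
      then show ?thesis by (simp add: power2_eq_square algebra_simps)
    qed
    finally have "[int (V ^ (2 * \<rho>)) = int 1] (mod int l)" by (simp add: cong_iff_dvd_diff)
    then show ?thesis by (simp only: cong_int_iff)
  qed
  then have ord_dvd: "ord l V dvd 2 * \<rho>" by (simp add: ord_divides')
  have not_dvd: "\<not> ord l V dvd \<rho>" using m1 by (simp add: ord_divides')
  have "even (ord l V)"
  proof (rule ccontr)
    assume "odd (ord l V)"
    then have "coprime (ord l V) 2" by simp
    then have "ord l V dvd \<rho>" using ord_dvd by (simp add: coprime_dvd_mult_right_iff)
    then show False using not_dvd by simp
  qed
  then obtain k where k: "ord l V = 2 * k" by (elim evenE)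
  have "k dvd \<rho>" using ord_dvd k by simp
  then have "k = 1 \<or> k = \<rho>" using \<rho> by (metis prime_nat_iff)
  moreover have "k \<noteq> 1"
  proof
    assume "k = 1"
    then have "[V ^ 2 = 1] (mod l)" using ord_works[of V l] k by simp
    then have V2: "[int (V ^ 2) = int 1] (mod int l)" by (simp only: cong_int_iff)
    show False
    proof (cases "odd \<rho>")
      case False
      then have "\<rho> = 2" using \<rho> prime_odd_nat prime_ge_2_nat by (metis le_neq_implies_less)
      then show False using m1 \<open>[V ^ 2 = 1] (mod l)\<close> by simp
    next
      case True
      have "int l dvd int V ^ 2 - 1" using V2 by (simp add: cong_iff_dvd_diff)
      also have "int V ^ 2 - 1 = (int V + 1) * (int V - 1)" by (simp add: power2_eq_square algebra_simps)
      finally have "int l dvd int V + 1 \<or> int l dvd int V - 1"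
        using l(1) by (simp add: prime_dvd_mult_iff)
      then show False
      proof
        assume "int l dvd int V + 1"
        then have "l dvd V + 1" by (metis int_dvd_int_iff of_nat_1 of_nat_add)
        then show False using l(3) True by simp
      next
        assume "int l dvd int V - 1"
        then have "[int V = int 1] (mod int l)" by (simp add: cong_iff_dvd_diff)
        then have "[V = 1] (mod l)" by (simp only: cong_int_iff)
        then have "[V ^ \<rho> = 1 ^ \<rho>] (mod l)" by (rule cong_pow)
        then show False using m1 by simp
      qed
    qed
  qed
  ultimately have "ord l V = 2 * \<rho>" using k by simp
  moreover have "ord l V dvd totient l" using order_divides_totient[OF cop] .
  ultimately show ?thesis using l totient_prime[OF l(1)] by auto
qed

lemma primroot_power_eq_1D:
  assumes "residue_primroot l g" "prime l" "\<rho> dvd l - 1" "[g ^ (i * ((l - 1) div \<rho>)) = 1] (mod l)" "\<rho> > 0"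
  shows "\<rho> dvd i"
proof -
  have "ord l g = l - 1" using assms(1,2) by (simp add: residue_primroot_def totient_prime)
  then have "l - 1 dvd i * ((l - 1) div \<rho>)" using assms(4) by (simp add: ord_divides')
  then have "\<rho> * ((l - 1) div \<rho>) dvd i * ((l - 1) div \<rho>)" using assms(3) by simp
  moreover have "(l - 1) div \<rho> \<noteq> 0"
  proof
    assume "(l - 1) div \<rho> = 0"
    then have "l - 1 = 0" using assms(3) by (metis dvd_div_mult_self mult_zero_left)
    then show False using prime_gt_1_nat[OF assms(2)] by simp
  qed
  ultimately show ?thesis by simp
qed

text \<open>Since \<open>Q\<close> is odd, \<open>4 * g\<close> is invertible modulo every prime
  \<open>l\<close> dividing \<open>Q\<close>; the Chinese remainder theorem combines the solutions
  into the residue that the assumption \<open>loc\<close> of the family asks for.\<close>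

lemma exists_primroot_residue:
  fixes Q :: int
  assumes "Q > 0" "odd Q"
  shows "\<exists>z. \<forall>l. prime l \<longrightarrow> int l dvd Q \<longrightarrow>
    (\<exists>g. residue_primroot l g \<and> [4 * int g * z = (int g + 1)\<^sup>2] (mod int l))"
proof -
  define A where "A = {l. prime l \<and> int l dvd Q}"
  have "finite A"
  proof (rule finite_subset)
    show "A \<subseteq> {..nat Q}" using assms(1) by (auto simp: A_def dest!: zdvd_imp_le)
  qed auto
  have ex: "\<exists>z :: nat. \<exists>g. residue_primroot l g \<and> [4 * g * z = (g + 1)\<^sup>2] (mod l)" if "l \<in> A" for l
  proof -
    have l: "prime l" "int l dvd Q" using that by (auto simp: A_def)
    then have "odd l" using assms(2) by (metis dvd_trans even_of_nat)
    obtain g where g: "residue_primroot l g"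
      using prime_primitive_root_exists[OF prime_gt_1_nat[OF l(1)] l(1)] by blast
    have "coprime l g" using g by (simp add: residue_primroot_def)
    moreover have "coprime l (2 ^ 2)" using \<open>odd l\<close> by (simp only: coprime_power_right_iff coprime_right_2_iff_odd simp_thms)
    then have "coprime l 4" by simp
    ultimately have "coprime l (4 * g)" by (simp only: coprime_mult_right_iff simp_thms)
    then have "coprime (4 * g) l" by (rule coprime_commute[THEN iffD1])
    then obtain h where h: "[4 * g * h = Suc 0] (mod l)" using cong_solve_coprime_nat by blast
    have "[4 * g * h * (g + 1)\<^sup>2 = Suc 0 * (g + 1)\<^sup>2] (mod l)" using h by (rule cong_scalar_right)
    then show ?thesis using g by (intro exI[of _ "h * (g + 1)\<^sup>2"] exI[of _ g]) (simp add: mult.assoc)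
  qed
  then obtain u where u: "\<And>l. l \<in> A \<Longrightarrow> \<exists>g. residue_primroot l g \<and> [4 * g * u l = (g + 1)\<^sup>2] (mod l)"
    by metis
  have "\<exists>z. \<forall>l\<in>A. [z = u l] (mod l)"
    using chinese_remainder_nat[OF \<open>finite A\<close>, of "\<lambda>l. l" u] by (auto simp: A_def primes_coprime)
  then obtain z where z: "\<And>l. l \<in> A \<Longrightarrow> [z = u l] (mod l)" by blast
  show ?thesis
  proof (intro exI[of _ "int z"] allI impI)
    fix l assume "prime l" "int l dvd Q"
    then have l: "l \<in> A" by (simp add: A_def)
    then obtain g where g: "residue_primroot l g" "[4 * g * u l = (g + 1)\<^sup>2] (mod l)" using u by blast
    have "[4 * g * z = 4 * g * u l] (mod l)" using z[OF l] by (rule cong_scalar_left)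
    then have "[4 * g * z = (g + 1)\<^sup>2] (mod l)" using g(2) by (rule cong_trans)
    then have "[int (4 * g * z) = int ((g + 1)\<^sup>2)] (mod int l)" by (simp only: cong_int_iff)
    then show "\<exists>g. residue_primroot l g \<and> [4 * int g * int z = (int g + 1)\<^sup>2] (mod int l)"
      using g(1) by (intro exI[of _ g]) (simp add: add.commute)
  qed
qed

section \<open>Chebyshev's lower bound\<close>

text \<open>The integral of \<open>x\<^sup>a (1 - x)\<^sup>b\<close> over the unit interval (Nair's method): a common multiple of \<open>1, \<dots>, a + b + 1\<close>
  makes it a positive integer.\<close>

definition beta_nat :: "nat \<Rightarrow> nat \<Rightarrow> real" where
  "beta_nat a b = fact a * fact b / fact (a + b + 1)"

text \<open>Integrated form of \<open>x^a (1-x)^(b+1) = x^a (1-x)^b - x^(a+1) (1-x)^b\<close>. It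
  reduces integrality to the values \<open>1 / (a + 1)\<close> at \<open>b = 0\<close>.\<close>

lemma beta_nat_Suc: "beta_nat a (Suc b) = beta_nat a b - beta_nat (Suc a) b"
proof -
  have 1: "fact (a + Suc b + 1) = (of_nat (a + b + 2) :: real) * fact (a + b + 1)"
    using fact_Suc[of "a + b + 1"] by simp
  show ?thesis unfolding beta_nat_def 1
    by (simp add: divide_simps fact_Suc[of a] fact_Suc[of b] del: fact_Suc) (simp add: algebra_simps)
qed

lemma beta_nat_Ints:
  assumes "\<And>k. 1 \<le> k \<Longrightarrow> k \<le> a + b + 1 \<Longrightarrow> k dvd L"
  shows "of_nat L * beta_nat a b \<in> \<int>"
  using assms
proof (induction b arbitrary: a)
  case 0
  obtain k where "L = (a + 1) * k" using 0[of "a + 1"] by auto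
  have "fact (a + 0 + 1) = real (a + 1) * fact a" by simp
  then have "beta_nat a 0 = 1 / real (a + 1)" unfolding beta_nat_def by (simp del: of_nat_Suc of_nat_add)
  then have "of_nat L * beta_nat a 0 = of_nat k" unfolding \<open>L = (a + 1) * k\<close> of_nat_mult by simp
  then show ?case by simp
next
  case (Suc b)
  have "of_nat L * beta_nat a b \<in> \<int>" "of_nat L * beta_nat (Suc a) b \<in> \<int>"
    by (intro Suc.IH Suc.prems; simp)+
  then show ?case by (simp add: beta_nat_Suc right_diff_distrib)
qed

lemma beta_nat_le: "beta_nat n n \<le> 1 / 2 ^ n"
proof (induction n)
  case (Suc n)
  have "beta_nat (Suc n) (Suc n) = beta_nat n n * ((real n + 1)\<^sup>2 / ((2 * real n + 2) * (2 * real n + 3)))"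
  proof -
    have "fact (Suc n + Suc n + 1) = (2 * real n + 3) * ((2 * real n + 2) * fact (n + n + 1))"
      using fact_Suc[of "n + n + 2"] fact_Suc[of "n + n + 1"] by (simp add: algebra_simps)
    moreover have "fact (Suc n) = (real n + 1) * fact n" by simp
    ultimately show ?thesis unfolding beta_nat_def
      by (simp only: power2_eq_square times_divide_times_eq mult_ac)
  qed
  also have "\<dots> \<le> 1 / 2 ^ n * (1 / 2)"
  proof (rule mult_mono[OF Suc])
    show "(real n + 1)\<^sup>2 / ((2 * real n + 2) * (2 * real n + 3)) \<le> 1 / 2"
    proof (subst pos_divide_le_eq)
      show "(2 * real n + 2) * (2 * real n + 3) > 0"
        by (intro mult_pos_pos) (simp_all add: add_nonneg_pos)
      show "(real n + 1)\<^sup>2 \<le> 1 / 2 * ((2 * real n + 2) * (2 * real n + 3))"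
        by (simp add: power2_eq_square algebra_simps)
    qed
  qed auto
  finally show ?case by simp
qed (simp add: beta_nat_def)

text \<open>This is the least common multiple of the numbers up to \<open>n\<close>: each prime
  contributes its largest power not exceeding \<open>n\<close>, so each contributes a factor of at
  most \<open>n\<close>.\<close>

lemma common_multiple_le:
  fixes n :: nat assumes "n \<ge> 1"
  obtains L where "L > 0" "\<And>k. 1 \<le> k \<Longrightarrow> k \<le> n \<Longrightarrow> k dvd L" "L \<le> n ^ card {p. prime p \<and> p \<le> n}"
proof -
  define A where "A = {p. prime p \<and> p \<le> n}"
  have finA: "finite A" by (rule finite_subset[of _ "{..n}"]) (auto simp: A_def)
  have "\<exists>e. p ^ e \<le> n \<and> (\<forall>i. p ^ i \<le> n \<longrightarrow> i \<le> e)" if "p \<in> A" for p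
  proof -
    have p: "p \<ge> 2" using that prime_ge_2_nat by (auto simp: A_def)
    define E where "E = {i. p ^ i \<le> n}"
    have "i \<le> n" if "i \<in> E" for i
    proof -
      have "i < 2 ^ i" by (rule less_exp)
      also have "\<dots> \<le> p ^ i" using p by (rule power_mono) simp
      finally show ?thesis using that by (simp add: E_def)
    qed
    then have "finite E" by (intro finite_subset[of E "{..n}"]) auto
    moreover have "0 \<in> E" using assms by (simp add: E_def)
    ultimately have "Max E \<in> E" "\<forall>i\<in>E. i \<le> Max E" by (auto intro: Max_in)
    then show ?thesis by (auto simp: E_def)
  qed
  then obtain e where e: "\<And>p. p \<in> A \<Longrightarrow> p ^ e p \<le> n" "\<And>p i. p \<in> A \<Longrightarrow> p ^ i \<le> n \<Longrightarrow> i \<le> e p" by metis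
  define L where "L = (\<Prod>p\<in>A. p ^ e p)"
  have "L > 0" unfolding L_def by (intro prod_pos) (auto simp: A_def prime_gt_0_nat)
  moreover have "k dvd L" if k: "1 \<le> k" "k \<le> n" for k
  proof -
    have sub: "prime_factors k \<subseteq> A"
    proof
      fix p assume "p \<in> prime_factors k"
      then have "prime p" "p dvd k" by (auto simp: in_prime_factors_iff)
      then have "p \<le> k" using k by (intro dvd_imp_le) auto
      then show "p \<in> A" using \<open>prime p\<close> k by (simp add: A_def)
    qed
    have "k = (\<Prod>p\<in>prime_factors k. p ^ multiplicity p k)" using k by (intro prime_factorization_nat) simp
    also have "\<dots> dvd (\<Prod>p\<in>prime_factors k. p ^ e p)"
    proof (rule prod_dvd_prod)
      fix p assume p: "p \<in> prime_factors k"
      have "p ^ multiplicity p k dvd k" by (rule multiplicity_dvd)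
      then have "p ^ multiplicity p k \<le> k" using k by (intro dvd_imp_le) auto
      then have "p ^ multiplicity p k \<le> n" using k by linarith
      then show "p ^ multiplicity p k dvd p ^ e p" using e(2)[of p] p sub by (intro le_imp_power_dvd) auto
    qed
    also have "\<dots> dvd L" unfolding L_def by (rule prod_dvd_prod_subset[OF finA sub])
    finally show ?thesis .
  qed
  moreover have "L \<le> n ^ card A"
  proof -
    have "L \<le> (\<Prod>p\<in>A. n)" unfolding L_def by (rule prod_mono) (use e in auto)
    then show ?thesis by simp
  qed
  ultimately show ?thesis using that unfolding A_def by blast
qed

text \<open>With \<open>2 N + 1 \<le> n\<close>, the common multiple \<open>L\<close> turns
  \<open>beta_nat N N\<close> into a positive integer, so \<open>2^N \<le> L \<le> n^\<pi>\<close>,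
  where \<pi> counts the primes. For \<open>n \<ge> 4\<close> one has \<open>n \<le> 4 N\<close>,
  whence the constant.\<close>

lemma chebyshev_lower:
  fixes n :: nat assumes "n \<ge> 4"
  shows "real (card {p. prime p \<and> p \<le> n}) \<ge> ln 2 / 4 * (real n / ln (real n))"
proof -
  define \<pi> where "\<pi> = card {p. prime p \<and> p \<le> n}"
  define N where "N = (n - 1) div 2"
  obtain L where L: "L > 0" "\<And>k. 1 \<le> k \<Longrightarrow> k \<le> n \<Longrightarrow> k dvd L" "L \<le> n ^ \<pi>"
    using common_multiple_le[of n] assms unfolding \<pi>_def by auto
  have "N + N + 1 \<le> n" using assms unfolding N_def by linarith
  then have "of_nat L * beta_nat N N \<in> \<int>" using L(2) by (intro beta_nat_Ints) auto
  moreover have "of_nat L * beta_nat N N > 0" using L(1) by (simp add: beta_nat_def)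
  ultimately have "of_nat L * beta_nat N N \<ge> 1" by (auto elim!: Ints_cases)
  also have "of_nat L * beta_nat N N \<le> of_nat L * (1 / 2 ^ N)"
    by (intro mult_left_mono beta_nat_le) auto
  finally have "2 ^ N \<le> real L" by (simp add: field_simps)
  also have "\<dots> \<le> real (n ^ \<pi>)" using L(3) by (simp only: of_nat_le_iff)
  finally have "ln (2 ^ N) \<le> ln (real n ^ \<pi>)" using assms by (subst ln_le_cancel_iff) auto
  then have le: "real N * ln 2 \<le> real \<pi> * ln (real n)" using assms by (simp add: ln_realpow)
  have "real n \<le> 4 * real N" using assms unfolding N_def by linarith
  then have "real n / 4 * ln 2 \<le> real N * ln 2" by (intro mult_right_mono) auto
  then have "real n / 4 * ln 2 \<le> real \<pi> * ln (real n)" using le by (rule order_trans)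
  moreover have "ln 2 / 4 * real n = real n / 4 * ln 2" by simp
  ultimately have "ln 2 / 4 * real n \<le> real \<pi> * ln (real n)" by (simp only:)
  moreover have "ln (real n) > 0" using assms by simp
  ultimately have "ln 2 / 4 * real n / ln (real n) \<le> real \<pi>" by (simp add: pos_divide_le_eq)
  then show ?thesis by (simp add: \<pi>_def)
qed

section \<open>Residues at primes of degree one\<close>

text \<open>The residue of an algebraic integer at a prime of degree one above \<open>l\<close>, read off from
  a square root \<open>e\<close> of \<open>d\<close> modulo \<open>l\<close>.\<close>

definition (in quadratic) residue_at :: "nat \<Rightarrow> int \<Rightarrow> complex \<Rightarrow> int \<Rightarrow> bool" where
  "residue_at l e x v \<longleftrightarrow> (\<exists>a b. x = of_int a + of_int b * s \<and> [v = a + b * e] (mod int l))"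

context quadratic
begin

lemma s_coord_eq_iff:
  "of_int a + of_int b * s = of_int a' + of_int b' * s \<longleftrightarrow> a = a' \<and> b = b'"
  using coord_eq_iff[of "of_int a" "of_int b" "of_int a'" "of_int b'"] by simp

lemma residue_at_int: "residue_at l e (of_int a) a"
  unfolding residue_at_def by (intro exI[of _ a] exI[of _ 0]) simp

lemma residue_at_mult:
  assumes e: "[e\<^sup>2 = d] (mod int l)" and x: "residue_at l e x v" and y: "residue_at l e y v'"
  shows "residue_at l e (x * y) (v * v')"
proof -
  obtain a b where 1: "x = of_int a + of_int b * s" "[v = a + b * e] (mod int l)"
    using x by (auto simp: residue_at_def)
  obtain a' b' where 2: "y = of_int a' + of_int b' * s" "[v' = a' + b' * e] (mod int l)"
    using y by (auto simp: residue_at_def)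
  have "x * y = of_int a * of_int a' + of_int b * of_int b' * (s * s) + (of_int a * of_int b' + of_int b * of_int a') * s"
    unfolding 1 2 by (simp add: algebra_simps del: s_mult)
  also have "\<dots> = of_int (a * a' + b * b' * d) + of_int (a * b' + b * a') * s" by simp
  finally have xy: "x * y = of_int (a * a' + b * b' * d) + of_int (a * b' + b * a') * s" .
  have "[v * v' = (a + b * e) * (a' + b' * e)] (mod int l)" by (intro cong_mult 1 2)
  also have "(a + b * e) * (a' + b' * e) = a * a' + (a * b' + b * a') * e + b * b' * e\<^sup>2"
    by (simp add: power2_eq_square algebra_simps)
  also have "[\<dots> = a * a' + (a * b' + b * a') * e + b * b' * d] (mod int l)"
    by (intro cong_add cong_refl cong_scalar_left e)
  finally have "[v * v' = (a * a' + b * b' * d) + (a * b' + b * a') * e] (mod int l)"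
    by (simp add: algebra_simps)
  then show ?thesis using xy unfolding residue_at_def by blast
qed

lemma residue_at_power:
  assumes "[e\<^sup>2 = d] (mod int l)" "residue_at l e x v"
  shows "residue_at l e (x ^ n) (v ^ n)"
proof (induct n)
  case 0 show ?case using residue_at_int[of l e 1] by simp
next
  case (Suc n) then show ?case using residue_at_mult[OF assms(1,2)] by simp
qed

lemma residue_at_unique:
  assumes "residue_at l e x v" "residue_at l e x v'" shows "[v = v'] (mod int l)"
  using assms unfolding residue_at_def s_coord_eq_iff
  by (metis cong_sym cong_trans s_coord_eq_iff)

text \<open>Modulo \<open>l\<close> the value of \<open>2^\<rho> * x\<close> is up to sign a
  \<rho>-th power. Raising to the exponent \<open>(l - 1) div \<rho>\<close> trivialises \<rho>-th
  powers by Fermat, and the sign as well, because \<open>2 * \<rho>\<close> divides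
  \<open>l - 1\<close> and the exponent is even.\<close>

lemma local_power:
  fixes l :: nat
  assumes l: "prime l" "odd l" and e: "[e\<^sup>2 = d] (mod int l)"
    and \<rho>: "2 * \<rho> dvd l - 1"
    and \<theta>: "\<theta> \<in> IK" and u: "u = 1 \<or> u = - 1" and eq: "x = u * \<theta> ^ \<rho>"
    and x: "residue_at l e x v" and v: "\<not> int l dvd v"
  shows "[v ^ ((l - 1) div \<rho>) = 1] (mod int l)"
proof -
  \<comment> \<open>\<open>residue_at\<close> applies only to elements with integer coordinates in
    1, \<open>s\<close>, so \<theta> is doubled; the resulting \<open>2 ^ \<rho>\<close> is itself a
    \<rho>-th power.\<close>
  obtain a b where ab: "2 * \<theta> = of_int a + of_int b * s" using IK_double[OF \<theta>] by blast
  define t where "t = a + b * e"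
  have t: "residue_at l e (2 * \<theta>) t"
    unfolding residue_at_def ab t_def by (intro exI[of _ a] exI[of _ b]) simp
  have "\<exists>u'. u = of_int u' \<and> (u' = 1 \<or> u' = - 1)"
    using u by (auto intro: exI[of _ 1] exI[of _ "- 1"])
  then obtain u' where u': "u = of_int u'" "u' = 1 \<or> u' = - 1" by blast
  have "residue_at l e (of_int (2 ^ \<rho>) * x) (2 ^ \<rho> * v)"
    by (intro residue_at_mult[OF e] residue_at_int x)
  moreover have "residue_at l e (of_int u' * (2 * \<theta>) ^ \<rho>) (u' * t ^ \<rho>)"
    by (intro residue_at_mult[OF e] residue_at_int residue_at_power[OF e] t)
  moreover have "of_int (2 ^ \<rho>) * x = of_int u' * (2 * \<theta>) ^ \<rho>"
    by (simp add: eq u'(1) power_mult_distrib)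
  ultimately have 1: "[2 ^ \<rho> * v = u' * t ^ \<rho>] (mod int l)" by (simp only: residue_at_unique)
  have pl: "prime (int l)" using l by simp
  have l2: "\<not> int l dvd 2"
  proof
    assume "int l dvd 2"
    then have "int l dvd int 2" by simp
    then have "l dvd 2" by (simp only: int_dvd_int_iff)
    then have "l = 2" using primes_dvd_imp_eq[OF l(1) two_is_prime_nat] by simp
    then show False using l(2) by simp
  qed
  have nt: "\<not> int l dvd t"
  proof
    assume "int l dvd t"
    moreover have "\<rho> > 0" using \<rho> prime_gt_1_nat[OF l(1)] by (cases \<rho>) auto
    ultimately have "int l dvd t ^ \<rho>" by (intro dvd_trans[OF _ dvd_power]) auto
    then have "int l dvd u' * t ^ \<rho>" by (rule dvd_mult)
    then have "int l dvd 2 ^ \<rho> * v" using cong_dvd_iff[OF 1] by simp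
    then have "int l dvd 2 ^ \<rho> \<or> int l dvd v" by (simp only: prime_dvd_mult_iff[OF pl])
    then show False using prime_dvd_power[OF pl, of 2 \<rho>] l2 v by blast
  qed
  define f where "f = (l - 1) div \<rho>"
  have f: "\<rho> * f = l - 1" "even f"
  proof -
    obtain k where k: "l - 1 = 2 * \<rho> * k" using \<rho> by (elim dvdE)
    have "\<rho> \<noteq> 0"
    proof
      assume "\<rho> = 0"
      then have "l - 1 = 0" using k by simp
      then show False using prime_gt_1_nat[OF l(1)] by simp
    qed
    moreover have "l - 1 = \<rho> * (2 * k)" using k by simp
    ultimately have "f = 2 * k" unfolding f_def by simp
    then show "\<rho> * f = l - 1" "even f" using k by auto
  qed
  have fermat: "[w ^ (l - 1) = 1] (mod int l)" if "\<not> int l dvd w" for w :: int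
  proof -
    have "[int (nat (w mod int l)) ^ (l - 1) = int 1] (mod int l)"
    proof -
      have pos: "int l > 0" using prime_gt_0_nat[OF l(1)] by simp
      have "int (nat (w mod int l)) = w mod int l" using pos by simp
      then have "\<not> int l dvd int (nat (w mod int l))" using that by (simp add: dvd_mod_iff)
      then have "\<not> l dvd nat (w mod int l)" by (simp only: int_dvd_int_iff not_False_eq_True)
      then have "[nat (w mod int l) ^ (l - 1) = 1] (mod l)" using fermat_theorem l(1) by blast
      then have "[int (nat (w mod int l) ^ (l - 1)) = int 1] (mod int l)" by (simp only: cong_int_iff)
      then show ?thesis by (simp only: of_nat_power)
    qed
    moreover have "[w = int (nat (w mod int l))] (mod int l)"
      using prime_gt_0_nat[OF l(1)] by (simp add: cong_def)
    then have "[w ^ (l - 1) = int (nat (w mod int l)) ^ (l - 1)] (mod int l)" by (rule cong_pow)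
    ultimately show ?thesis using cong_trans by (simp only: of_nat_1) blast
  qed
  have "[(2 ^ \<rho> * v) ^ f = (u' * t ^ \<rho>) ^ f] (mod int l)" using 1 by (rule cong_pow)
  moreover have "(2 ^ \<rho> * v) ^ f = 2 ^ (l - 1) * v ^ f" by (simp add: power_mult_distrib f(1) flip: power_mult)
  moreover have "(u' * t ^ \<rho>) ^ f = t ^ (l - 1)"
    using u'(2) f by (auto simp add: power_mult_distrib simp flip: power_mult)
  ultimately have 2: "[2 ^ (l - 1) * v ^ f = t ^ (l - 1)] (mod int l)" by (simp only:)
  have 3: "[2 ^ (l - 1) * v ^ f = 1 * v ^ f] (mod int l)"
    by (rule cong_scalar_right) (rule fermat[OF l2])
  have 4: "[t ^ (l - 1) = 1] (mod int l)" by (rule fermat[OF nt])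
  have "[1 * v ^ f = 1] (mod int l)" by (rule cong_trans[OF cong_sym[OF 3] cong_trans[OF 2 4]])
  then show ?thesis by (simp add: f_def)
qed

end

lemma not_coprime_primeE:
  fixes a b :: int
  assumes "\<not> coprime a b"
  obtains p where "prime p" "p dvd a" "p dvd b"
proof (cases "gcd a b = 0")
  case True
  then show ?thesis using that[of 2] by simp
next
  case False
  moreover have "\<not> gcd a b dvd 1" using assms coprime_iff_gcd_eq_1[of a b] by simp
  ultimately obtain p where "p dvd gcd a b" "prime p" using prime_divisor_exists by blast
  then show ?thesis using that by simp
qed

section \<open>The parametrised family: norm equations, coprimality and auxiliary primes\<close>

locale family =
  fixes m :: nat and b c z \<sigma> S Q D :: int
  assumes m: "m > 1"
    and \<sigma>: "\<sigma> = (2 * int m)\<^sup>2" and S: "S = \<sigma> ^ m" and Q: "Q = S\<^sup>2 - 1"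
    and z: "Q * z = c ^ m - b ^ m"
    and D: "D = z * (z - b ^ m)"
    and b_cong: "[b = 1] (mod Q)" and b_odd: "odd b" and cop: "coprime b c" and cop\<sigma>: "coprime c \<sigma>"
    \<comment> \<open>modulo \<open>l\<close> this gives \<open>z = (g + 1)\<^sup>2 / (4 g)\<close> and \<open>z - b ^ m = (g - 1)\<^sup>2 / (4 g)\<close>, so that \<open>D\<close> is a square\<close>
    and loc: "\<And>l :: nat. prime l \<Longrightarrow> int l dvd Q \<Longrightarrow>
      \<exists>g. residue_primroot l g \<and> [4 * int g * z = (int g + 1)\<^sup>2] (mod int l)"
begin

lemma norm_alpha: "(2 * z - b ^ m)\<^sup>2 - 4 * D = (b\<^sup>2) ^ m"
proof -
  have "(2 * z - b ^ m)\<^sup>2 - 4 * D = (b ^ m)\<^sup>2" unfolding D by (simp add: power2_eq_square algebra_simps)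
  then show ?thesis by (simp only: power_mult[symmetric] mult.commute)
qed

lemma norm_gamma: "((S - 1) * z + b ^ m)\<^sup>2 - (S - 1)\<^sup>2 * D = (b * c) ^ m"
proof -
  have "((S - 1) * z + b ^ m)\<^sup>2 - (S - 1)\<^sup>2 * D = b ^ m * (b ^ m + Q * z)"
    unfolding D Q by (simp add: power2_eq_square algebra_simps)
  then show ?thesis unfolding z by (simp add: power_mult_distrib)
qed

lemma Q_fac: "Q = (S - 1) * (S + 1)"
  unfolding Q by (simp add: power2_eq_square algebra_simps)

lemma dvd_power_m: "p dvd x \<Longrightarrow> p dvd x ^ m" for p x :: int
  by (rule dvd_trans[OF _ dvd_power]) (use m in auto)

text \<open>The conditions on \<open>b\<close> enter through its prime divisors: oddness excludes 2,
  \<open>b = 1\<close> modulo \<open>Q\<close> excludes those of \<open>Q\<close>, and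
  \<open>Q * z = c ^ m - b ^ m\<close> passes coprimality from \<open>c\<close> on to
  \<open>z\<close>.\<close>

lemma prime_b:
  assumes p: "prime p" "p dvd b" shows "\<not> p dvd 2" "\<not> p dvd Q" "\<not> p dvd c" "\<not> p dvd z"
proof -
  have unit: "\<not> p dvd 1" using p(1) not_prime_unit by blast
  show "\<not> p dvd 2"
  proof
    assume "p dvd 2"
    moreover have "prime (2 :: int)" by simp
    ultimately have "p = 2" using primes_dvd_imp_eq[OF p(1)] by blast
    then show False using b_odd p by simp
  qed
  show "\<not> p dvd Q"
  proof
    assume "p dvd Q"
    then have "[b = 1] (mod p)" using b_cong cong_dvd_modulus by blast
    then have "p dvd 1" using p cong_dvd_iff by blast
    then show False using unit by simp
  qed
  show nc: "\<not> p dvd c" using cop p unit coprime_common_divisor by blast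
  show "\<not> p dvd z"
  proof
    assume "p dvd z"
    then have "p dvd c ^ m - b ^ m" unfolding z[symmetric] by simp
    moreover have "p dvd b ^ m" using p dvd_power_m by blast
    ultimately have "p dvd c ^ m - b ^ m + b ^ m" by (rule dvd_add)
    then have "p dvd c ^ m" by simp
    then show False using nc p(1) prime_dvd_power by blast
  qed
qed

text \<open>Trace of \<alpha> against the m-th root of its norm; by \<open>comaximal_conj\<close>
  this is what makes \<alpha> and its conjugate comaximal. \<open>cop_gamma\<close> does the same
  for \<gamma>.\<close>

lemma cop_alpha: "coprime (2 * (2 * z - b ^ m)) (b\<^sup>2)"
proof -
  have "coprime (2 * (2 * z - b ^ m)) b"
  proof (rule ccontr)
    assume "\<not> ?thesis"
    then obtain p where p: "prime p" "p dvd 2 * (2 * z - b ^ m)" "p dvd b" by (rule not_coprime_primeE)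
    note nd = prime_b[OF p(1,3)]
    have "p dvd b ^ m" using p dvd_power_m by blast
    moreover have "p dvd 2 * z - b ^ m" using p(2) nd(1) by (simp only: prime_dvd_mult_iff[OF p(1)]) blast
    ultimately have "p dvd 2 * z - b ^ m + b ^ m" by (intro dvd_add)
    then have "p dvd 2 * z" by simp
    then show False using nd(1,4) by (simp only: prime_dvd_mult_iff[OF p(1)]) blast
  qed
  then show ?thesis by simp
qed

lemma cop_gamma: "coprime (2 * ((S - 1) * z + b ^ m)) (b * c)"
proof (rule ccontr)
  assume "\<not> ?thesis"
  then obtain p where p: "prime p" "p dvd 2 * ((S - 1) * z + b ^ m)" "p dvd b * c" by (rule not_coprime_primeE)
  have unit: "\<not> p dvd 1" using p(1) not_prime_unit by blast
  have even\<sigma>: "2 dvd \<sigma>" unfolding \<sigma> by simp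
  have S\<sigma>: "p dvd S \<Longrightarrow> p dvd \<sigma>" unfolding S using p(1) prime_dvd_power by blast
  show False
  proof (cases "p dvd b")
    case True
    note nd = prime_b[OF p(1) True]
    have 1: "p dvd b ^ m" using True dvd_power_m by blast
    have "p dvd (S - 1) * z + b ^ m" using p(2) nd(1) by (simp only: prime_dvd_mult_iff[OF p(1)]) blast
    then have "p dvd (S - 1) * z" using dvd_add_left_iff[OF 1] by blast
    then have "p dvd S - 1" using nd(4) by (simp only: prime_dvd_mult_iff[OF p(1)]) blast
    then show False using nd(2) unfolding Q_fac by simp
  next
    case False
    then have pc: "p dvd c" using p(3) by (simp only: prime_dvd_mult_iff[OF p(1)]) blast
    then have n\<sigma>: "\<not> p dvd \<sigma>" using cop\<sigma> unit coprime_common_divisor by blast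
    then have n2: "\<not> p dvd 2" using even\<sigma> dvd_trans by blast
    have 1: "p dvd c ^ m" using pc dvd_power_m by blast
    \<comment> \<open>Multiplying half the trace by \<open>S + 1\<close> replaces \<open>z\<close>
      by \<open>c\<close> and \<open>b\<close>. A prime dividing \<open>c\<close> must then divide
      \<open>S\<close> or \<open>b\<close>, against \<open>cop\<sigma>\<close> and the case
      assumption.\<close>
    have "(S + 1) * ((S - 1) * z + b ^ m) = c ^ m + S * b ^ m"
      using z unfolding Q_fac by (simp add: algebra_simps)
    moreover have "p dvd (S - 1) * z + b ^ m" using p(2) n2 by (simp only: prime_dvd_mult_iff[OF p(1)]) blast
    then have "p dvd (S + 1) * ((S - 1) * z + b ^ m)" by (rule dvd_mult)
    ultimately have "p dvd c ^ m + S * b ^ m" by (simp only:)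
    then have "p dvd S * b ^ m" using dvd_add_right_iff[OF 1] by blast
    then have "p dvd S \<or> p dvd b ^ m" by (simp only: prime_dvd_mult_iff[OF p(1)])
    then show False using S\<sigma> n\<sigma> False prime_dvd_power[OF p(1)] by blast
  qed
qed

lemma b_nz: "b \<noteq> 0" using b_odd by auto

lemma c_nz: "c \<noteq> 0"
proof
  assume "c = 0"
  then have "\<sigma> dvd 1" using cop\<sigma> by simp
  moreover have "2 dvd \<sigma>" unfolding \<sigma> by simp
  ultimately have "2 dvd (1 :: int)" by (rule dvd_trans[rotated])
  then show False by simp
qed

text \<open>For \<open>V = (2 m)^(m div \<rho>)\<close> one has \<open>S = (V^\<rho>)^2\<close>, so
  \<open>V^\<rho> + 1\<close> divides \<open>S - 1\<close> while \<open>S + 1\<close> equals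
  \<open>(V^2)^\<rho> + 1\<close>. This is where \<sigma> being the square of \<open>2 * m\<close>
  is used.\<close>

lemma test_primes:
  assumes "prime \<rho>" "\<rho> dvd m"
  obtains l1 l2 where "prime l1" "prime l2" "int l1 dvd S - 1" "int l2 dvd S + 1"
    "2 * \<rho> dvd l1 - 1" "2 * \<rho> dvd l2 - 1"
proof -
  have "\<rho> > 0" using assms(1) prime_gt_0_nat by blast
  obtain k where k: "m = \<rho> * k" using assms(2) by (elim dvdE)
  define V where "V = (2 * m) ^ k"
  have k0: "k > 0" using k m by (cases k) auto
  have "\<rho> dvd 2 * m" using assms(2) by (rule dvd_mult)
  then have "\<rho> dvd V" unfolding V_def by (rule dvd_trans[OF _ dvd_power]) (use k0 in simp)
  then have V: "V > 0" "even V" "\<rho> dvd V"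
    using m k0 by (auto simp: V_def)
  have S_V: "S = int ((V ^ \<rho>) ^ 2)"
  proof -
    have "S = (2 * int m) ^ (2 * m)" unfolding S \<sigma> by (simp add: power_mult)
    also have "\<dots> = int (((2 * m) ^ k) ^ (\<rho> * 2))" by (simp add: k mult_ac flip: power_mult)
    finally show ?thesis by (simp add: V_def power_mult)
  qed
  obtain l1 where l1: "prime l1" "l1 dvd V ^ \<rho> + 1" "2 * \<rho> dvd l1 - 1"
    using prime_cong_1_dvd_power_add_1[OF V assms(1)] by blast
  have V': "V ^ 2 > 0" "even (V ^ 2)" "\<rho> dvd V ^ 2" using V by (auto simp: power2_eq_square)
  obtain l2 where l2: "prime l2" "l2 dvd (V ^ 2) ^ \<rho> + 1" "2 * \<rho> dvd l2 - 1"
    using prime_cong_1_dvd_power_add_1[OF V' assms(1)] by blast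
  have "(V ^ 2) ^ \<rho> = (V ^ \<rho>) ^ 2" by (simp only: power_mult[symmetric] mult.commute)
  then have "l2 dvd (V ^ \<rho>) ^ 2 + 1" using l2(2) by simp
  then have "int l2 dvd int ((V ^ \<rho>) ^ 2 + 1)" by (simp only: int_dvd_int_iff)
  then have "int l2 dvd S + 1" unfolding S_V by (simp only: of_nat_add of_nat_1)
  moreover have "int l1 dvd S - 1"
  proof -
    have "S - 1 = (int (V ^ \<rho>) + 1) * (int (V ^ \<rho>) - 1)"
      unfolding S_V by (simp add: power2_eq_square algebra_simps)
    moreover have "int l1 dvd int (V ^ \<rho> + 1)" using l1(2) by (simp only: int_dvd_int_iff)
    then have "int l1 dvd int (V ^ \<rho>) + 1" by (simp only: of_nat_add of_nat_1)
    ultimately show ?thesis by (simp only: dvd_mult2)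
  qed
  ultimately show ?thesis using that l1 l2 by blast
qed

end

section \<open>Independence of the two ideal classes\<close>

text \<open>Trace and norm both lie in the ideal generated by \<open>x\<close> and
  \<open>cj x\<close>, so a Bezout relation between them is one between \<open>x\<close> and its
  conjugate.\<close>

lemma (in quadratic) comaximal_conj:
  assumes x: "x \<in> IK" and t: "x + cj x = of_int t" and n: "x * cj x = of_int (n ^ k)" and cop: "coprime t n"
  shows "\<exists>u\<in>IK. \<exists>v\<in>IK. u * x + v * cj x = 1"
proof -
  have "coprime t (n ^ k)" using cop by simp
  then obtain p q where pq: "p * t + q * n ^ k = 1" using bezout_int[of t "n ^ k"] coprime_iff_gcd_eq_1[of t "n ^ k"] by auto
  have "(of_int p + of_int q * cj x) * x + of_int p * cj x = of_int p * (x + cj x) + of_int q * (x * cj x)"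
    by (simp add: algebra_simps)
  also have "\<dots> = of_int (p * t + q * n ^ k)" unfolding t n by simp
  finally have "(of_int p + of_int q * cj x) * x + of_int p * cj x = 1" unfolding pq by simp
  then show ?thesis using x by (intro bexI[of _ "of_int p + of_int q * cj x"] bexI[of _ "of_int p"]) auto
qed

text \<open>The product \<open>y * s\<close> serves as the square root of \<open>D\<close>, which
  need not be squarefree.\<close>

locale quadratic_family = quadratic d s + family m b c z \<sigma> S Q D
  for d s m b c z \<sigma> S Q D +
  fixes y :: int
  assumes D_eq: "D = d * y\<^sup>2"
begin

definition \<alpha> where "\<alpha> = of_int (2 * z - b ^ m) + of_int (2 * y) * s"
definition \<gamma> where "\<gamma> = of_int ((S - 1) * z + b ^ m) + of_int ((S - 1) * y) * s"

lemma \<alpha>_IK: "\<alpha> \<in> IK" and \<gamma>_IK: "\<gamma> \<in> IK"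
  unfolding \<alpha>_def \<gamma>_def by (intro IK_add IK_mult IK_int IK_s)+

lemma conj_product: "(of_int p + of_int q * s) * cj (of_int p + of_int q * s) = of_int (p\<^sup>2 - q\<^sup>2 * d)"
proof -
  have "cj (of_int p + of_int q * s) = of_int p - of_int q * s" by simp
  then have "(of_int p + of_int q * s) * cj (of_int p + of_int q * s) = of_int p * of_int p - of_int q * of_int q * (s * s)"
    by (simp add: algebra_simps del: s_mult)
  then show ?thesis by (simp add: power2_eq_square)
qed

lemma conj_sum: "(of_int p + of_int q * s) + cj (of_int p + of_int q * s) = of_int (2 * p)"
  by simp

lemma \<alpha>_conj: "\<alpha> * cj \<alpha> = of_int ((b\<^sup>2) ^ m)" "\<alpha> + cj \<alpha> = of_int (2 * (2 * z - b ^ m))"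
proof -
  have "(2 * z - b ^ m)\<^sup>2 - (2 * y)\<^sup>2 * d = (b\<^sup>2) ^ m"
    using norm_alpha unfolding D_eq by (simp add: power_mult_distrib mult_ac)
  then show "\<alpha> * cj \<alpha> = of_int ((b\<^sup>2) ^ m)" unfolding \<alpha>_def conj_product by (simp only:)
  show "\<alpha> + cj \<alpha> = of_int (2 * (2 * z - b ^ m))" unfolding \<alpha>_def by (rule conj_sum)
qed

lemma \<gamma>_conj: "\<gamma> * cj \<gamma> = of_int ((b * c) ^ m)" "\<gamma> + cj \<gamma> = of_int (2 * ((S - 1) * z + b ^ m))"
proof -
  have "((S - 1) * z + b ^ m)\<^sup>2 - ((S - 1) * y)\<^sup>2 * d = (b * c) ^ m"
    using norm_gamma unfolding D_eq by (simp add: power_mult_distrib mult_ac)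
  then show "\<gamma> * cj \<gamma> = of_int ((b * c) ^ m)" unfolding \<gamma>_def conj_product by (simp only:)
  show "\<gamma> + cj \<gamma> = of_int (2 * ((S - 1) * z + b ^ m))" unfolding \<gamma>_def by (rule conj_sum)
qed

lemma \<alpha>_nz: "\<alpha> \<noteq> 0"
  using \<alpha>_conj(1) b_nz by auto
lemma \<gamma>_nz: "\<gamma> \<noteq> 0"
  using \<gamma>_conj(1) b_nz c_nz by auto

lemma exists_root_ideal:
  assumes x: "x \<in> IK" "x \<noteq> 0" and n: "x * cj x = of_int (n ^ m)" and t: "x + cj x = of_int t" and cop: "coprime t n"
  shows "\<exists>I. nzi I \<and> ipow I m = scale x IK"
proof -
  define I where "I = gen2 (of_int n) x"
  have "ipow I m = scale x IK" unfolding I_def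
  proof (rule ipow_gen2[where b = "cj x"])
    show "x * cj x = of_int n ^ m" using n by simp
    show "\<exists>u\<in>IK. \<exists>v\<in>IK. u * x + v * cj x = 1" by (rule comaximal_conj[OF x(1) t n cop])
  qed (use x m in auto)
  moreover have "nzi I"
  proof -
    have "x \<in> I" unfolding I_def gen2_def by (intro CollectI exI[of _ 0] exI[of _ 1]) simp
    then have "I \<noteq> {0}" using x(2) by auto
    moreover have "ideal I R" unfolding I_def by (rule gen2_ideal) (use x in auto)
    ultimately show ?thesis by (simp add: nzi_def)
  qed
  ultimately show ?thesis by blast
qed

text \<open>Modulo \<open>l\<close> one has \<open>b ^ m = 1\<close>, and the square root of
  \<open>D\<close> becomes \<open>(g^2 - 1) / (4 g)\<close>, so \<alpha> reduces to
  \<open>g\<close>. In \<gamma> the coefficient \<open>S - 1\<close> becomes 0 or -2, which gives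
  the two values.\<close>

lemma reduction:
  fixes l :: nat
  assumes l: "prime l" "int l dvd Q" and \<rho>: "\<rho> \<ge> 2" "2 * \<rho> dvd l - 1"
  obtains g e where "residue_primroot l g" "[e\<^sup>2 = d] (mod int l)" "\<not> int l dvd int g"
    "residue_at l e \<alpha> (int g)" "int l dvd S - 1 \<Longrightarrow> residue_at l e \<gamma> 1"
    "int l dvd S + 1 \<Longrightarrow> residue_at l e \<gamma> (- int g)"
proof -
  define M where "M = int l"
  have pM: "prime M" using l(1) by (simp add: M_def)
  obtain g where g: "residue_primroot l g" "[4 * int g * z = (int g + 1)\<^sup>2] (mod M)"
    using loc[OF l] unfolding M_def by blast
  have l1: "l > 1" using l(1) prime_gt_1_nat by blast
  have "2 * \<rho> \<le> l - 1" using \<rho> l1 by (intro dvd_imp_le) auto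
  \<comment> \<open>A primitive root then has order at least 4, so \<open>g^2 - 1\<close>, and with
    it \<open>D\<close>, is nonzero modulo \<open>l\<close>.\<close>
  then have l5: "l \<ge> 5" using \<rho>(1) by simp
  have "even (l - 1)" using \<rho>(2) dvd_trans dvd_triv_left by blast
  then have lodd: "odd l" using l1 by simp
  have ord: "ord l g = l - 1" using g(1) l(1) by (simp add: residue_primroot_def totient_prime)
  have cop: "coprime l g" using g(1) by (simp add: residue_primroot_def)
  have ng: "\<not> M dvd int g"
  proof
    assume "M dvd int g"
    then have "l dvd g" by (simp add: M_def)
    then have "l dvd 1" using cop coprime_common_divisor dvd_refl by blast
    then show False using l1 by simp
  qed
  have n4: "\<not> M dvd 4"
  proof
    assume "M dvd 4"
    then have "M \<le> 4" by (rule zdvd_imp_le) simp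
    then show False using l5 by (simp add: M_def)
  qed
  have "\<not> M dvd 4 * int g" using ng n4 by (simp only: prime_dvd_mult_iff[OF pM]) simp
  then have "coprime M (4 * int g)" using pM prime_imp_coprime by blast
  then have "coprime (4 * int g) M" by (rule coprime_commute[THEN iffD1])
  then obtain h where h: "[4 * int g * h = 1] (mod M)" using cong_solve_coprime_int by blast
  define G where "G = int g"
  have h': "[4 * G * h = 1] (mod M)" using h by (simp only: G_def)
  have bm: "[b ^ m = 1] (mod M)"
  proof -
    have "[b = 1] (mod M)" using b_cong l(2) cong_dvd_modulus unfolding M_def by blast
    then have "[b ^ m = 1 ^ m] (mod M)" by (rule cong_pow)
    then show ?thesis by simp
  qed
  have zc: "[z = (G + 1)\<^sup>2 * h] (mod M)"
  proof -
    have "[1 * z = (4 * G * h) * z] (mod M)" using cong_sym[OF h'] by (rule cong_scalar_right)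
    moreover have "(4 * G * h) * z = (4 * G * z) * h" by simp
    moreover have "[(4 * G * z) * h = (G + 1)\<^sup>2 * h] (mod M)"
      using g(2) unfolding G_def by (rule cong_scalar_right)
    ultimately show ?thesis using cong_trans by (simp only: mult_1) blast
  qed
  \<comment> \<open>Here \<open>h\<close> inverts \<open>4 * G\<close>, so this is the square root
    of \<open>D\<close> modulo \<open>l\<close>.\<close>
  define e0 where "e0 = (G\<^sup>2 - 1) * h"
  have zb: "[z - b ^ m = (G - 1)\<^sup>2 * h] (mod M)"
  proof -
    have "[z - b ^ m = (G + 1)\<^sup>2 * h - 4 * G * h] (mod M)"
      by (intro cong_diff zc cong_trans[OF bm cong_sym[OF h']])
    moreover have "(G + 1)\<^sup>2 * h - 4 * G * h = (G - 1)\<^sup>2 * h" by (simp add: power2_eq_square algebra_simps)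
    ultimately show ?thesis by (simp only:)
  qed
  have De: "[D = e0\<^sup>2] (mod M)"
  proof -
    have "[D = ((G + 1)\<^sup>2 * h) * ((G - 1)\<^sup>2 * h)] (mod M)" unfolding D by (intro cong_mult zc zb)
    moreover have "((G + 1)\<^sup>2 * h) * ((G - 1)\<^sup>2 * h) = e0\<^sup>2" unfolding e0_def
      by (simp add: power2_eq_square algebra_simps)
    ultimately show ?thesis by (simp only:)
  qed
  have nh: "\<not> M dvd h"
  proof
    assume "M dvd h"
    then have "M dvd 4 * int g * h" by (rule dvd_mult)
    then have "M dvd 1" using cong_dvd_iff[OF h] by simp
    then show False using l1 by (simp add: M_def)
  qed
  have ng2: "\<not> M dvd G\<^sup>2 - 1"
  proof
    assume "M dvd G\<^sup>2 - 1"
    then have "[int (g ^ 2) = int 1] (mod int l)" by (simp add: cong_iff_dvd_diff M_def G_def)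
    then have "[g ^ 2 = 1] (mod l)" by (simp only: cong_int_iff)
    then have "l - 1 dvd 2" using ord ord_divides'[of g 2 l] by simp
    then have "l - 1 \<le> 2" by (rule dvd_imp_le) simp
    then show False using l5 by simp
  qed
  have ne0: "\<not> M dvd e0" unfolding e0_def using nh ng2 by (simp only: prime_dvd_mult_iff[OF pM]) simp
  have nD: "\<not> M dvd D"
  proof
    assume "M dvd D"
    then have "M dvd e0\<^sup>2" using cong_dvd_iff[OF De] by simp
    then show False using ne0 prime_dvd_power[OF pM] by blast
  qed
  have "\<not> M dvd y"
  proof
    assume "M dvd y"
    then have "M dvd y * (y * d)" by (rule dvd_mult2)
    moreover have "y * (y * d) = D" unfolding D_eq by (simp add: power2_eq_square)
    ultimately show False using nD by simp
  qed
  then have "coprime M y" using pM prime_imp_coprime by blast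
  then have "coprime y M" by (rule coprime_commute[THEN iffD1])
  then obtain y' where y': "[y * y' = 1] (mod M)" using cong_solve_coprime_int by blast
  \<comment> \<open>Dividing the root of \<open>D = d * y^2\<close> by \<open>y\<close> gives the
    residue assigned to \<open>s\<close>.\<close>
  define e where "e = e0 * y'"
  have ye: "[y * e = e0] (mod M)"
  proof -
    have "[e0 * (y * y') = e0 * 1] (mod M)" using y' by (rule cong_scalar_left)
    moreover have "e0 * (y * y') = y * e" by (simp add: e_def)
    ultimately show ?thesis by simp
  qed
  have ed: "[e\<^sup>2 = d] (mod M)"
  proof -
    have "[e0\<^sup>2 * y'\<^sup>2 = D * y'\<^sup>2] (mod M)" using cong_sym[OF De] by (rule cong_scalar_right)
    moreover have "e0\<^sup>2 * y'\<^sup>2 = e\<^sup>2" by (simp add: e_def power_mult_distrib)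
    moreover have "D * y'\<^sup>2 = d * (y * y')\<^sup>2" unfolding D_eq by (simp add: power_mult_distrib)
    moreover have "[d * (y * y')\<^sup>2 = d * 1\<^sup>2] (mod M)" by (intro cong_scalar_left cong_pow y')
    ultimately show ?thesis using cong_trans by (simp only: one_power2 mult_1_right) blast
  qed
  have av: "[2 * z - b ^ m + 2 * e0 = G] (mod M)"
  proof -
    have "[z + (z - b ^ m) + 2 * e0 = (G + 1)\<^sup>2 * h + (G - 1)\<^sup>2 * h + 2 * e0] (mod M)"
      by (intro cong_add zc zb cong_refl)
    moreover have "(G + 1)\<^sup>2 * h + (G - 1)\<^sup>2 * h + 2 * e0 = G * (4 * G * h)"
      unfolding e0_def by (simp add: power2_eq_square algebra_simps)
    moreover have "[G * (4 * G * h) = G * 1] (mod M)" using h' by (rule cong_scalar_left)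
    moreover have "z + (z - b ^ m) + 2 * e0 = 2 * z - b ^ m + 2 * e0" by simp
    ultimately show ?thesis using cong_trans by (simp only: mult_1_right) blast
  qed
  have "[2 * z - b ^ m + (2 * y) * e = 2 * z - b ^ m + 2 * e0] (mod M)"
  proof -
    have "[2 * (y * e) = 2 * e0] (mod M)" using ye by (rule cong_scalar_left)
    then have "[2 * z - b ^ m + 2 * (y * e) = 2 * z - b ^ m + 2 * e0] (mod M)" by (intro cong_add cong_refl)
    then show ?thesis by (simp only: mult.assoc)
  qed
  then have "[G = 2 * z - b ^ m + (2 * y) * e] (mod M)" using av cong_trans cong_sym by blast
  then have ra: "residue_at l e \<alpha> (int g)"
    unfolding residue_at_def \<alpha>_def M_def G_def by blast
  have gy: "[(S - 1) * z + b ^ m + (S - 1) * y * e = (S - 1) * (z + e0) + 1] (mod M)"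
  proof -
    have "[(S - 1) * z + b ^ m + (S - 1) * (y * e) = (S - 1) * z + 1 + (S - 1) * e0] (mod M)"
      by (intro cong_add cong_refl bm cong_scalar_left ye)
    moreover have "(S - 1) * z + 1 + (S - 1) * e0 = (S - 1) * (z + e0) + 1" by (simp add: algebra_simps)
    ultimately show ?thesis by (simp only: mult.assoc)
  qed
  have r1: "residue_at l e \<gamma> 1" if "int l dvd S - 1"
  proof -
    have "M dvd (S - 1) * (z + e0)" using that by (simp add: M_def)
    then have "[(S - 1) * (z + e0) + 1 = 0 + 1] (mod M)" by (intro cong_add cong_refl) (simp add: cong_0_iff)
    then have "[1 = (S - 1) * z + b ^ m + (S - 1) * y * e] (mod M)" using gy cong_trans cong_sym by (simp only: add_0) blast
    then show ?thesis unfolding residue_at_def \<gamma>_def M_def by blast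
  qed
  have r2: "residue_at l e \<gamma> (- int g)" if "int l dvd S + 1"
  proof -
    \<comment> \<open>With this coefficient \<gamma> reduces to the negative of the reduction of
      \<alpha>.\<close>
    have "[S - 1 = - 2] (mod M)" using that by (simp add: cong_iff_dvd_diff M_def add.commute)
    then have 1: "[(S - 1) * (z + e0) + 1 = - 2 * (z + e0) + 1] (mod M)" by (intro cong_add cong_refl cong_scalar_right)
    have "[b ^ m - (2 * z + 2 * e0) = 1 - (2 * z + 2 * e0)] (mod M)" using bm by (intro cong_diff cong_refl)
    moreover have "- 2 * (z + e0) + 1 = 1 - (2 * z + 2 * e0)" by simp
    moreover have "b ^ m - (2 * z + 2 * e0) = - (2 * z - b ^ m + 2 * e0)" by simp
    moreover have "[- (2 * z - b ^ m + 2 * e0) = - G] (mod M)" using av by (simp only: cong_minus_minus_iff)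
    ultimately have 2: "[- 2 * (z + e0) + 1 = - G] (mod M)" using cong_trans cong_sym by (simp only:) blast
    have "[- G = (S - 1) * z + b ^ m + (S - 1) * y * e] (mod M)"
      by (rule cong_sym[OF cong_trans[OF gy cong_trans[OF 1 2]]])
    then show ?thesis unfolding residue_at_def \<gamma>_def M_def G_def by blast
  qed
  show ?thesis
    using that[of g e] g(1) ed ng ra r1 r2 unfolding M_def by blast
qed

text \<open>At \<open>l1\<close> the product reduces to \<open>g^j\<close>, which isolates
  \<open>j\<close>. At \<open>l2\<close> it reduces to \<open>g^(i + j)\<close> up to sign, so
  \<rho> divides \<open>i + j\<close> and then also \<open>i\<close>.\<close>

lemma independence:
  assumes \<rho>: "prime (\<rho> :: nat)" "\<rho> dvd m" and u: "u = 1 \<or> u = - 1" and \<theta>: "\<theta> \<in> IK"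
    and eq: "\<gamma> ^ i * \<alpha> ^ j = u * \<theta> ^ \<rho>"
  shows "\<rho> dvd i \<and> \<rho> dvd j"
proof -
  obtain l1 l2 where l: "prime l1" "prime l2" "int l1 dvd S - 1" "int l2 dvd S + 1"
    "2 * \<rho> dvd l1 - 1" "2 * \<rho> dvd l2 - 1"
    using test_primes[OF \<rho>] by blast
  have \<rho>2: "\<rho> \<ge> 2" using \<rho>(1) by (rule prime_ge_2_nat)
  have step: "\<rho> dvd k"
    if l': "prime l" "2 * \<rho> dvd l - 1" and g: "residue_primroot l g" "\<not> int l dvd int g" and e: "[e\<^sup>2 = d] (mod int l)"
      and v: "residue_at l e (\<gamma> ^ i * \<alpha> ^ j) v" "v = int g ^ k \<or> v = - (int g ^ k)" for l g e v k
  proof -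
    have pl: "prime (int l)" using l'(1) by simp
    have "even (l - 1)" using l'(2) dvd_trans dvd_triv_left by blast
    then have lodd: "odd l" using prime_gt_1_nat[OF l'(1)] by simp
    have "\<not> int l dvd int g ^ k" using g(2) prime_dvd_power[OF pl] by blast
    then have "\<not> int l dvd v" using v(2) by auto
    then have 1: "[v ^ ((l - 1) div \<rho>) = 1] (mod int l)"
      using local_power[OF l'(1) lodd e l'(2) \<theta> u eq v(1)] by blast
    obtain t where t: "l - 1 = 2 * \<rho> * t" using l'(2) by (elim dvdE)
    then have "l - 1 = \<rho> * (2 * t)" by simp
    then have "(l - 1) div \<rho> = 2 * t" using \<rho>2 by simp
    then have "even ((l - 1) div \<rho>)" by simp
    then have "v ^ ((l - 1) div \<rho>) = (int g ^ k) ^ ((l - 1) div \<rho>)" using v(2) by auto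
    also have "\<dots> = int (g ^ (k * ((l - 1) div \<rho>)))" by (simp add: power_mult)
    finally have "[int (g ^ (k * ((l - 1) div \<rho>))) = int 1] (mod int l)" using 1 by simp
    then have "[g ^ (k * ((l - 1) div \<rho>)) = 1] (mod l)" by (simp only: cong_int_iff)
    moreover have "\<rho> dvd l - 1" using l'(2) by (rule dvd_trans[rotated]) simp
    moreover have "\<rho> > 0" using \<rho>2 by linarith
    ultimately show ?thesis by (blast intro: primroot_power_eq_1D[OF g(1) l'(1)])
  qed
  have "int l1 dvd Q" unfolding Q_fac using l(3) by (rule dvd_mult2)
  obtain g1 e1 where 1: "residue_primroot l1 g1" "[e1\<^sup>2 = d] (mod int l1)" "\<not> int l1 dvd int g1"
    "residue_at l1 e1 \<alpha> (int g1)" "residue_at l1 e1 \<gamma> 1"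
    by (rule reduction[OF l(1) \<open>int l1 dvd Q\<close> \<rho>2 l(5)]) (use l(3) in blast)
  have "residue_at l1 e1 (\<gamma> ^ i * \<alpha> ^ j) (1 ^ i * int g1 ^ j)"
    by (intro residue_at_mult residue_at_power 1)
  then have dj: "\<rho> dvd j" by (rule step[OF l(1) l(5) 1(1,3,2)]) simp
  have "int l2 dvd Q" unfolding Q_fac using l(4) by (rule dvd_mult)
  obtain g2 e2 where 2: "residue_primroot l2 g2" "[e2\<^sup>2 = d] (mod int l2)" "\<not> int l2 dvd int g2"
    "residue_at l2 e2 \<alpha> (int g2)" "residue_at l2 e2 \<gamma> (- int g2)"
    by (rule reduction[OF l(2) \<open>int l2 dvd Q\<close> \<rho>2 l(6)]) (use l(4) in blast)
  have "residue_at l2 e2 (\<gamma> ^ i * \<alpha> ^ j) ((- int g2) ^ i * int g2 ^ j)"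
    by (intro residue_at_mult residue_at_power 2)
  moreover have "(- int g2) ^ i * int g2 ^ j = int g2 ^ (i + j) \<or> (- int g2) ^ i * int g2 ^ j = - (int g2 ^ (i + j))"
    by (cases "even i") (simp_all add: power_add)
  ultimately have "\<rho> dvd i + j" by (rule step[OF l(2) l(6) 2(1,3,2)])
  then show ?thesis using dj by (simp add: dvd_add_left_iff)
qed

lemma class_generators:
  obtains I J where "nzi I" "ipow I m = scale \<gamma> IK" "nzi J" "ipow J m = scale \<alpha> IK"
  using exists_root_ideal[OF \<gamma>_IK \<gamma>_nz \<gamma>_conj cop_gamma] exists_root_ideal[OF \<alpha>_IK \<alpha>_nz \<alpha>_conj cop_alpha]
  by blast

lemma relation:
  assumes I: "nzi I" "ipow I m = scale \<gamma> IK" and J: "nzi J" "ipow J m = scale \<alpha> IK" and \<rho>: "\<rho> dvd m"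
    and one: "cls I [^]\<^bsub>A\<^esub> (m div \<rho> * i) \<otimes>\<^bsub>A\<^esub> cls J [^]\<^bsub>A\<^esub> (m div \<rho> * j) = \<one>\<^bsub>A\<^esub>"
  shows "\<exists>u \<theta>. is_unit u \<and> \<theta> \<in> IK \<and> \<gamma> ^ i * \<alpha> ^ j = u * \<theta> ^ \<rho>"
proof -
  have m': "m = m div \<rho> * \<rho>" using \<rho> by simp
  show ?thesis
    using cls_relation[OF I IK_in_K[OF \<gamma>_IK] \<gamma>_nz J IK_in_K[OF \<alpha>_IK] \<alpha>_nz m' one]
    unfolding is_unit_def by blast
qed

lemma cls_closed: "nzi I \<Longrightarrow> cls I \<in> carrier A"
  unfolding carrier_A by blast

lemma cls_pow_m: "nzi I \<Longrightarrow> ipow I m = scale x IK \<Longrightarrow> x \<in> IK \<Longrightarrow> x \<noteq> 0 \<Longrightarrow> cls I [^]\<^bsub>A\<^esub> m = \<one>\<^bsub>A\<^esub>"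
  by (simp only: cls_pow cls_principal IK_in_K not_False_eq_True)

lemma imaginary_rank:
  assumes "d < - 4" shows "enat 2 \<le> m_rank m A"
proof (rule m_rank_geI)
  obtain I J where I: "nzi I" "ipow I m = scale \<gamma> IK" and J: "nzi J" "ipow J m = scale \<alpha> IK"
    by (rule class_generators)
  show "has_power_subgroup m 2 A"
  proof (rule comm_monoid.has_power_subgroup_2I[OF comm_monoid_A m])
    fix \<rho> i j :: nat
    assume \<rho>: "prime \<rho>" "\<rho> dvd m"
      and one: "cls I [^]\<^bsub>A\<^esub> (m div \<rho> * i) \<otimes>\<^bsub>A\<^esub> cls J [^]\<^bsub>A\<^esub> (m div \<rho> * j) = \<one>\<^bsub>A\<^esub>"
    obtain u \<theta> where u: "is_unit u" "\<theta> \<in> IK" "\<gamma> ^ i * \<alpha> ^ j = u * \<theta> ^ \<rho>"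
      using relation[OF I J \<rho>(2) one] by blast
    then show "\<rho> dvd i \<and> \<rho> dvd j" using independence[OF \<rho> imaginary_unit[OF assms u(1)] u(2,3)] by blast
  qed (use cls_closed I J cls_pow_m \<gamma>_IK \<gamma>_nz \<alpha>_IK \<alpha>_nz in blast)+
qed

text \<open>If both classes became trivial at the same \<rho>, then \<alpha> and \<gamma> would each
  be a unit times a \<rho>-th power. The dependence of these two units produces a product
  \<open>\<gamma>^i \<alpha>^j\<close> that \<open>independence\<close> excludes.\<close>

lemma real_rank:
  assumes "d > 0" shows "enat 1 \<le> m_rank m A"
proof (rule m_rank_geI)
  obtain I J where I: "nzi I" "ipow I m = scale \<gamma> IK" and J: "nzi J" "ipow J m = scale \<alpha> IK"
    by (rule class_generators)
  interpret A: comm_monoid A by (rule comm_monoid_A)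
  have IA: "cls I \<in> carrier A" "cls J \<in> carrier A" using I J cls_closed by auto
  show "has_power_subgroup m 1 A"
  proof (rule A.has_power_subgroup_1I[OF m])
    fix \<rho> :: nat assume \<rho>: "prime \<rho>" "\<rho> dvd m"
    show "\<not> (cls I [^]\<^bsub>A\<^esub> (m div \<rho>) = \<one>\<^bsub>A\<^esub> \<and> cls J [^]\<^bsub>A\<^esub> (m div \<rho>) = \<one>\<^bsub>A\<^esub>)"
    proof
      assume one: "cls I [^]\<^bsub>A\<^esub> (m div \<rho>) = \<one>\<^bsub>A\<^esub> \<and> cls J [^]\<^bsub>A\<^esub> (m div \<rho>) = \<one>\<^bsub>A\<^esub>"
      have "cls I [^]\<^bsub>A\<^esub> (m div \<rho> * 1) \<otimes>\<^bsub>A\<^esub> cls J [^]\<^bsub>A\<^esub> (m div \<rho> * 0) = \<one>\<^bsub>A\<^esub>"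
        using one IA by simp
      from relation[OF I J \<rho>(2) this] obtain u1 \<theta>1 where 1: "is_unit u1" "\<theta>1 \<in> IK" "\<gamma> = u1 * \<theta>1 ^ \<rho>" by auto
      have "cls I [^]\<^bsub>A\<^esub> (m div \<rho> * 0) \<otimes>\<^bsub>A\<^esub> cls J [^]\<^bsub>A\<^esub> (m div \<rho> * 1) = \<one>\<^bsub>A\<^esub>"
        using one IA by simp
      from relation[OF I J \<rho>(2) this] obtain u2 \<theta>2 where 2: "is_unit u2" "\<theta>2 \<in> IK" "\<alpha> = u2 * \<theta>2 ^ \<rho>" by auto
      obtain i j v where ij: "\<not> (\<rho> dvd i \<and> \<rho> dvd j)" "is_unit v"
          "u1 ^ i * u2 ^ j = v ^ \<rho> \<or> u1 ^ i * u2 ^ j = - (v ^ \<rho>)"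
        by (rule real_units_dependent[OF assms 1(1) 2(1) \<rho>(1)])
      define \<theta> where "\<theta> = v * \<theta>1 ^ i * \<theta>2 ^ j"
      have "\<gamma> ^ i * \<alpha> ^ j = (u1 ^ i * u2 ^ j) * ((\<theta>1 ^ i) ^ \<rho> * (\<theta>2 ^ j) ^ \<rho>)"
        unfolding 1(3) 2(3) by (simp add: power_mult_distrib mult_ac flip: power_mult)
      then have "\<gamma> ^ i * \<alpha> ^ j = 1 * \<theta> ^ \<rho> \<or> \<gamma> ^ i * \<alpha> ^ j = (- 1) * \<theta> ^ \<rho>"
        using ij(3) by (auto simp: \<theta>_def power_mult_distrib)
      moreover have "\<theta> \<in> IK" unfolding \<theta>_def using ij(2) 1(2) 2(2) by (simp add: is_unit_def)
      ultimately show False using independence[OF \<rho>] ij(1) by blast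
    qed
  qed (use cls_closed I J cls_pow_m \<gamma>_IK \<gamma>_nz \<alpha>_IK \<alpha>_nz in blast)+
qed

end

section \<open>Construction of the family\<close>

lemma power_diff_cong:
  fixes u v n :: int
  assumes "[u = v] (mod n)"
  shows "[(\<Sum>i<m. v ^ (m - Suc i) * u ^ i) = int m * v ^ (m - 1)] (mod n)"
proof -
  have "[(\<Sum>i<m. v ^ (m - Suc i) * u ^ i) = (\<Sum>i<m. v ^ (m - Suc i) * v ^ i)] (mod n)"
    by (intro cong_sum cong_scalar_left cong_pow assms)
  also have "(\<Sum>i<m. v ^ (m - Suc i) * v ^ i) = (\<Sum>i<m. v ^ (m - 1))"
    by (intro sum.cong refl) (simp flip: power_add)
  finally show ?thesis by simp
qed

lemma prime_square_dvd_multD: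
  fixes p :: int
  assumes "prime p" "\<not> p dvd w" "p\<^sup>2 dvd a * w" shows "p\<^sup>2 dvd a"
proof -
  have "coprime p w" using assms(1,2) prime_imp_coprime by blast
  then have "coprime (p\<^sup>2) w" by simp
  then show ?thesis using assms(3) coprime_dvd_mult_left_iff by blast
qed

text \<open>The simplest case of lifting the exponent: the cofactor of \<open>u - v\<close> in
  \<open>u^m - v^m\<close> is \<open>m v^(m-1)\<close> modulo \<open>p\<close>, which is
  nonzero.\<close>

lemma exact_prime_power_diff:
  fixes p u v :: int
  assumes p: "prime p" "p dvd u - v" "\<not> p\<^sup>2 dvd u - v" "\<not> p dvd v" "\<not> p dvd int m"
  shows "p dvd u ^ m - v ^ m" "\<not> p\<^sup>2 dvd u ^ m - v ^ m"
proof -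
  define t where "t = (\<Sum>i<m. v ^ (m - Suc i) * u ^ i)"
  have fac: "u ^ m - v ^ m = (u - v) * t" unfolding t_def by (rule power_diff_sumr2)
  then show "p dvd u ^ m - v ^ m" using p(2) by simp
  have "[u = v] (mod p)" using p(2) by (simp only: cong_iff_dvd_diff)
  then have 1: "[t = int m * v ^ (m - 1)] (mod p)" unfolding t_def by (rule power_diff_cong)
  have "\<not> p dvd v ^ (m - 1)" using p(4) prime_dvd_power[OF p(1)] by blast
  then have "\<not> p dvd int m * v ^ (m - 1)" using p(5) by (simp only: prime_dvd_mult_iff[OF p(1)]) blast
  then have nt: "\<not> p dvd t" by (simp only: cong_dvd_iff[OF 1] not_False_eq_True)
  then have "\<not> p\<^sup>2 dvd (u - v) * t" using p(3) prime_square_dvd_multD[OF p(1)] by blast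
  then show "\<not> p\<^sup>2 dvd u ^ m - v ^ m" by (simp only: fac not_False_eq_True)
qed

lemma exists_cong_in_interval:
  fixes a n N :: int
  assumes "n > 0"
  obtains k where "N \<le> k" "k < N + n" "[k = a] (mod n)"
proof -
  have "(a - N) mod n = (a - N) - n * ((a - N) div n)" by (rule minus_mult_div_eq_mod[symmetric])
  then have "[N + (a - N) mod n = a] (mod n)" by (simp add: cong_iff_dvd_diff)
  then show ?thesis using that[of "N + (a - N) mod n"] assms by simp
qed

text \<open>A common prime cannot divide \<open>L\<close>, because \<open>x + y\<close> is 1 modulo
  \<open>L\<close>. It divides the difference \<open>(\<sigma>^2 - 1) x\<close>, hence
  \<open>x\<close>, and then \<open>y\<close>.\<close>

lemma coprime_linear_forms:
  fixes x y \<sigma> L :: int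
  assumes L: "\<sigma>\<^sup>2 - 1 dvd L" "[x + y = 1] (mod L)"
    and xy: "\<And>r. prime r \<Longrightarrow> \<not> r dvd L \<Longrightarrow> r dvd x \<Longrightarrow> r dvd y \<Longrightarrow> False"
  shows "coprime (x + y) (\<sigma>\<^sup>2 * x + y)"
proof (rule ccontr)
  assume "\<not> ?thesis"
  then obtain r where r: "prime r" "r dvd x + y" "r dvd \<sigma>\<^sup>2 * x + y" by (rule not_coprime_primeE)
  have unit: "\<not> r dvd 1" using r(1) not_prime_unit by blast
  have nL: "\<not> r dvd L"
  proof
    assume "r dvd L"
    then have "[x + y = 1] (mod r)" using L(2) cong_dvd_modulus by blast
    then show False using r(2) unit cong_dvd_iff by blast
  qed
  then have nT: "\<not> r dvd \<sigma>\<^sup>2 - 1" using L(1) dvd_trans by blast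
  have "r dvd (\<sigma>\<^sup>2 * x + y) - (x + y)" using r(3,2) by (rule dvd_diff)
  moreover have "(\<sigma>\<^sup>2 * x + y) - (x + y) = (\<sigma>\<^sup>2 - 1) * x" by (simp add: algebra_simps)
  ultimately have x: "r dvd x" using nT by (simp only: prime_dvd_mult_iff[OF r(1)]) blast
  then have "r dvd x + y - x" using r(2) by (intro dvd_diff)
  then have "r dvd y" by simp
  then show False using xy r(1) nL x by blast
qed

lemma family_modulus:
  fixes m :: nat and \<sigma> S Q :: int
  assumes m: "m > 1" and \<sigma>: "\<sigma> = (2 * int m)\<^sup>2" and S: "S = \<sigma> ^ m" and Q: "Q = S\<^sup>2 - 1"
  shows "Q > 0" "odd Q"
proof -
  have "\<sigma> \<noteq> 0" using m unfolding \<sigma> by simp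
  then have S0: "S \<noteq> 0" unfolding S by simp
  have "2 dvd \<sigma>" unfolding \<sigma> by (simp add: power2_eq_square)
  moreover have "\<sigma> dvd S" unfolding S by (rule dvd_power) (use m in simp)
  ultimately have S2: "2 dvd S" by (rule dvd_trans)
  have "\<bar>S\<bar> > 1" using S0 S2 by (cases "\<bar>S\<bar> = 1") auto
  then have "\<bar>S\<bar>\<^sup>2 > 1\<^sup>2" by (intro power_strict_mono) auto
  then show "Q > 0" unfolding Q by simp
  show "odd Q" using S2 unfolding Q by simp
qed

text \<open>The aim is \<open>z = z0\<close> modulo \<open>Q\<close> for the residue
  \<open>z0\<close> of \<open>exists_primroot_residue\<close>. As \<open>c ^ m - b ^ m\<close> is
  \<open>c - b\<close> times a sum that is \<open>m\<close> modulo \<open>Q\<close>, the quotient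
  \<open>(c - b) / Q\<close> has to be \<open>z0 / m\<close> modulo \<open>Q\<close>.\<close>

lemma family_residue:
  fixes m :: nat and \<sigma> S Q :: int
  assumes m: "m > 1" and \<sigma>: "\<sigma> = (2 * int m)\<^sup>2" and S: "S = \<sigma> ^ m" and Q: "Q = S\<^sup>2 - 1"
  obtains x0 where "\<And>x y. [x = x0] (mod Q\<^sup>2 * \<sigma>) \<Longrightarrow> [y = 1 - x0] (mod Q\<^sup>2 * \<sigma>) \<Longrightarrow>
    coprime (x + y) (\<sigma>\<^sup>2 * x + y) \<Longrightarrow>
    \<exists>z. family m (x + y) (\<sigma>\<^sup>2 * x + y) z \<sigma> S Q (z * (z - (x + y) ^ m))"
proof -
  have \<sigma>2: "2 dvd \<sigma>" "int m dvd \<sigma>" unfolding \<sigma> by (simp_all add: power2_eq_square)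
  note Q0 = family_modulus(1)[OF assms] and Qodd = family_modulus(2)[OF assms]
  have "\<sigma> dvd S" unfolding S by (rule dvd_power) (use m in simp)
  then obtain t where t: "S = \<sigma> * t" by (elim dvdE)
  have cop\<sigma>: "coprime Q \<sigma>"
  proof (rule ccontr)
    assume "\<not> ?thesis"
    then obtain p where p: "prime p" "p dvd Q" "p dvd \<sigma>" by (rule not_coprime_primeE)
    have "p dvd S\<^sup>2" using p(3) unfolding t power2_eq_square by simp
    then have "p dvd S\<^sup>2 - Q" using p(2) by (rule dvd_diff)
    then have "p dvd 1" unfolding Q by simp
    then show False using p(1) not_prime_unit by blast
  qed
  define T where "T = \<sigma>\<^sup>2 - 1"
  have "S\<^sup>2 = (\<sigma>\<^sup>2) ^ m" unfolding S by (simp only: power_mult[symmetric] mult.commute)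
  then have "Q = (\<sigma>\<^sup>2) ^ m - 1 ^ m" unfolding Q by simp
  also have "\<dots> = T * (\<Sum>i<m. 1 ^ (m - Suc i) * (\<sigma>\<^sup>2) ^ i)" unfolding T_def by (rule power_diff_sumr2)
  finally obtain W where W: "Q = T * W" by blast
  obtain z0 where z0: "\<And>l. prime l \<Longrightarrow> int l dvd Q \<Longrightarrow>
      \<exists>g. residue_primroot l g \<and> [4 * int g * z0 = (int g + 1)\<^sup>2] (mod int l)"
    using exists_primroot_residue[OF Q0 Qodd] by blast
  have "coprime Q (int m)" using cop\<sigma> \<sigma>2(2) coprime_divisors[OF dvd_refl] by blast
  then have "coprime (int m) Q" by (rule coprime_commute[THEN iffD1])
  then obtain m' where m': "[int m * m' = 1] (mod Q)" using cong_solve_coprime_int by blast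
  \<comment> \<open>The residue \<open>z0 / m\<close> modulo \<open>Q\<close> wanted for
    \<open>(c - b) / Q\<close>.\<close>
  define e where "e = m' * z0"
  have "coprime (Q\<^sup>2) \<sigma>" using cop\<sigma> by simp
  \<comment> \<open>Since \<open>c - b = T * x\<close> and \<open>T * W = Q\<close>, the first
    congruence yields \<open>Q * e\<close>; the modulus is \<open>Q^2\<close> because one factor
    \<open>Q\<close> is divided out. The second makes \<open>y\<close>, and so \<open>c\<close>, a
    unit modulo \<sigma>.\<close>
  then obtain x0 where x0: "[x0 = W * e] (mod Q\<^sup>2)" "[x0 = 0] (mod \<sigma>)"
    using binary_chinese_remainder_int by blast
  show ?thesis
  proof (rule that[of x0])
    fix x y :: int
    assume x: "[x = x0] (mod Q\<^sup>2 * \<sigma>)" and y: "[y = 1 - x0] (mod Q\<^sup>2 * \<sigma>)"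
      and cop: "coprime (x + y) (\<sigma>\<^sup>2 * x + y)"
    define b c where "b = x + y" and "c = \<sigma>\<^sup>2 * x + y"
    have "[x + y = x0 + (1 - x0)] (mod Q\<^sup>2 * \<sigma>)" using x y by (rule cong_add)
    then have b1: "[b = 1] (mod Q\<^sup>2 * \<sigma>)" by (simp add: b_def)
    have "[b = 1] (mod Q)" by (rule cong_dvd_modulus[OF b1]) (simp add: power2_eq_square)
    have "[b = 1] (mod 2)" by (rule cong_dvd_modulus[OF b1]) (use \<sigma>2(1) in simp)
    then have "odd b" by (simp add: cong_iff_dvd_diff)
    have "coprime c \<sigma>"
    proof (rule ccontr)
      assume "\<not> ?thesis"
      then obtain p where p: "prime p" "p dvd c" "p dvd \<sigma>" by (rule not_coprime_primeE)
      have "p dvd \<sigma>\<^sup>2 * x" using p(3) by (simp add: power2_eq_square)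
      then have "p dvd c - \<sigma>\<^sup>2 * x" using p(2) by (intro dvd_diff)
      then have py: "p dvd y" unfolding c_def by simp
      have "[y = 1 - x0] (mod p)" by (rule cong_dvd_modulus[OF y]) (use p(3) in simp)
      moreover have "[x0 = 0] (mod p)" by (rule cong_dvd_modulus[OF x0(2) p(3)])
      then have "[1 - x0 = 1 - 0] (mod p)" by (intro cong_diff cong_refl)
      ultimately have "[y = 1 - 0] (mod p)" by (rule cong_trans)
      then have "[y = 1] (mod p)" by simp
      then have "p dvd 1" using py cong_dvd_iff by blast
      then show False using p(1) not_prime_unit by blast
    qed
    have "[x = x0] (mod Q\<^sup>2)" by (rule cong_dvd_modulus[OF x]) simp
    then have "[x = W * e] (mod Q\<^sup>2)" using x0(1) by (rule cong_trans)
    then have "Q\<^sup>2 dvd x - W * e" by (simp only: cong_iff_dvd_diff)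
    then obtain k where "x - W * e = Q\<^sup>2 * k" by (elim dvdE)
    then have k: "x = W * e + Q\<^sup>2 * k" by simp
    define f where "f = e + Q * (T * k)"
    have cb: "c - b = Q * f"
    proof -
      have "c - b = T * x" by (simp add: c_def b_def T_def algebra_simps)
      also have "\<dots> = (T * W) * e + Q * (Q * (T * k))" unfolding k by (simp add: algebra_simps power2_eq_square)
      also have "\<dots> = Q * f" unfolding f_def W[symmetric] by (simp add: algebra_simps)
      finally show ?thesis .
    qed
    define t where "t = (\<Sum>i<m. b ^ (m - Suc i) * c ^ i)"
    define z where "z = f * t"
    have "c ^ m - b ^ m = (c - b) * t" unfolding t_def by (rule power_diff_sumr2)
    then have Qz: "Q * z = c ^ m - b ^ m" unfolding cb z_def by simp
    have "[c = b] (mod Q)" using cb by (simp add: cong_iff_dvd_diff)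
    then have "[t = int m * b ^ (m - 1)] (mod Q)" unfolding t_def by (rule power_diff_cong)
    also have "[int m * b ^ (m - 1) = int m * 1 ^ (m - 1)] (mod Q)"
      by (intro cong_scalar_left cong_pow \<open>[b = 1] (mod Q)\<close>)
    finally have tm: "[t = int m] (mod Q)" by simp
    have fe: "[f = e] (mod Q)" by (simp add: f_def cong_iff_dvd_diff)
    have "[z = e * int m] (mod Q)" unfolding z_def using fe tm by (rule cong_mult)
    also have "e * int m = (int m * m') * z0" by (simp add: e_def)
    also have "[(int m * m') * z0 = 1 * z0] (mod Q)" using m' by (rule cong_scalar_right)
    finally have zz: "[z = z0] (mod Q)" by simp
    have "\<exists>g. residue_primroot l g \<and> [4 * int g * z = (int g + 1)\<^sup>2] (mod int l)"
      if l: "prime l" "int l dvd Q" for l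
    proof -
      obtain g where g: "residue_primroot l g" "[4 * int g * z0 = (int g + 1)\<^sup>2] (mod int l)"
        using z0[OF l] by blast
      have "[z = z0] (mod int l)" by (rule cong_dvd_modulus[OF zz l(2)])
      then have "[4 * int g * z = 4 * int g * z0] (mod int l)" by (rule cong_scalar_left)
      then show ?thesis using g cong_trans by blast
    qed
    then have "family m b c z \<sigma> S Q (z * (z - b ^ m))"
      using m \<sigma> S Q Qz \<open>[b = 1] (mod Q)\<close> \<open>odd b\<close> cop \<open>coprime c \<sigma>\<close>
      unfolding family_def b_def[symmetric] c_def[symmetric] by blast
    then show "\<exists>z. family m (x + y) (\<sigma>\<^sup>2 * x + y) z \<sigma> S Q (z * (z - (x + y) ^ m))"
      unfolding b_def[symmetric] c_def[symmetric] by blast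
  qed
qed

section \<open>Sign, size and exact prime divisors of \<open>D\<close>\<close>

context family
begin

text \<open>Because \<open>S^2 = (\<sigma>^2)^m\<close>, the second factor of \<open>D\<close> is,
  like the first, a difference of m-th powers up to \<open>Q\<close>; sign and divisibility are read
  off from the bases.\<close>

lemma Q_times_z_minus: "Q * (z - b ^ m) = c ^ m - (\<sigma>\<^sup>2 * b) ^ m"
proof -
  have "S\<^sup>2 = (\<sigma>\<^sup>2) ^ m" unfolding S by (simp only: power_mult[symmetric] mult.commute)
  then have "(\<sigma>\<^sup>2 * b) ^ m = (Q + 1) * b ^ m" unfolding Q by (simp add: power_mult_distrib)
  then show ?thesis using z by (simp add: algebra_simps)
qed

lemma Q_pos: "Q > 0"
  using family_modulus(1)[OF m \<sigma> S Q] .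

lemma z_pos:
  assumes "0 < b" "b < c" shows "z > 0"
proof -
  have "b ^ m < c ^ m" using assms m by (intro power_strict_mono) auto
  then have "Q * z > 0" unfolding z by simp
  then show ?thesis using Q_pos by (simp add: zero_less_mult_iff)
qed

lemma D_neg:
  assumes "0 < b" "b < c" "c < \<sigma>\<^sup>2 * b" shows "D < 0"
proof -
  have "c ^ m < (\<sigma>\<^sup>2 * b) ^ m" using assms m by (intro power_strict_mono) auto
  then have "Q * (z - b ^ m) < 0" unfolding Q_times_z_minus by simp
  then have "z - b ^ m < 0" using Q_pos by (simp add: mult_less_0_iff)
  then show ?thesis unfolding D using z_pos[OF assms(1,2)] by (rule mult_pos_neg[rotated])
qed

lemma D_pos:
  assumes "0 < b" "b < c" "\<sigma>\<^sup>2 * b < c" shows "D > 0"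
proof -
  have "(\<sigma>\<^sup>2 * b) ^ m < c ^ m" using assms m by (intro power_strict_mono) auto
  then have "Q * (z - b ^ m) > 0" unfolding Q_times_z_minus by simp
  then have "z - b ^ m > 0" using Q_pos by (simp add: zero_less_mult_iff)
  then show ?thesis unfolding D using z_pos[OF assms(1,2)] by (rule mult_pos_pos[rotated])
qed

lemma D_bound:
  assumes "\<bar>b\<bar> \<le> N" "\<bar>c\<bar> \<le> N" shows "\<bar>D\<bar> \<le> 6 * N ^ (2 * m)"
proof -
  have b: "\<bar>b ^ m\<bar> \<le> N ^ m" unfolding power_abs using assms by (intro power_mono) auto
  have c: "\<bar>c ^ m\<bar> \<le> N ^ m" unfolding power_abs using assms by (intro power_mono) auto
  have "1 * \<bar>z\<bar> \<le> Q * \<bar>z\<bar>" using Q_pos by (intro mult_right_mono) auto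
  also have "\<dots> = \<bar>c ^ m - b ^ m\<bar>" using Q_pos unfolding z[symmetric] by (simp add: abs_mult)
  finally have "\<bar>z\<bar> \<le> 2 * N ^ m" using b c by linarith
  moreover from this b have "\<bar>z - b ^ m\<bar> \<le> 3 * N ^ m" by linarith
  ultimately have "\<bar>z\<bar> * \<bar>z - b ^ m\<bar> \<le> (2 * N ^ m) * (3 * N ^ m)" by (intro mult_mono) auto
  also have "\<dots> = 6 * (N ^ m * N ^ m)" by simp
  also have "N ^ m * N ^ m = N ^ (2 * m)" by (simp only: mult_2 power_add)
  finally show ?thesis unfolding D abs_mult .
qed

text \<open>The factors \<open>z\<close> and \<open>z - b ^ m\<close> differ by
  \<open>b ^ m\<close>, so \<open>p\<close> divides only one of them; in that one,
  \<open>exact_prime_power_diff\<close> makes it a simple divisor.\<close>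

lemma prime_exact_dvd_D:
  assumes p: "prime p" "\<not> p dvd int m" "\<not> p dvd Q" "\<not> p dvd b"
    and e: "p dvd c - b \<and> \<not> p\<^sup>2 dvd c - b \<or>
      p dvd c - \<sigma>\<^sup>2 * b \<and> \<not> p\<^sup>2 dvd c - \<sigma>\<^sup>2 * b \<and> \<not> p dvd \<sigma>\<^sup>2 * b"
  shows "p dvd D \<and> \<not> p\<^sup>2 dvd D"
proof -
  have B: "\<not> p dvd b ^ m" using p(1,4) prime_dvd_power by blast
  have not_both: "\<not> (p dvd z \<and> p dvd z - b ^ m)"
  proof
    assume "p dvd z \<and> p dvd z - b ^ m"
    then have "p dvd z - (z - b ^ m)" using dvd_diff by blast
    then show False using B by simp
  qed
  have divQ: "p dvd w \<and> \<not> p\<^sup>2 dvd w" if w: "p dvd Q * w" "\<not> p\<^sup>2 dvd Q * w" for w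
    using w p(3) dvd_mult[of "p\<^sup>2" w Q] by (simp only: prime_dvd_mult_iff[OF p(1)]) blast
  show ?thesis
    using e
  proof
    assume "p dvd c - b \<and> \<not> p\<^sup>2 dvd c - b"
    then have e: "p dvd c - b" "\<not> p\<^sup>2 dvd c - b" by auto
    have zp: "p dvd z \<and> \<not> p\<^sup>2 dvd z"
      by (rule divQ; unfold z; rule exact_prime_power_diff[OF p(1) e p(4,2)])
    then have nw: "\<not> p dvd z - b ^ m" using not_both by blast
    have "p dvd D" unfolding D using zp by simp
    moreover have "\<not> p\<^sup>2 dvd D" unfolding D using zp prime_square_dvd_multD[OF p(1) nw] by blast
    ultimately show ?thesis ..
  next
    assume "p dvd c - \<sigma>\<^sup>2 * b \<and> \<not> p\<^sup>2 dvd c - \<sigma>\<^sup>2 * b \<and> \<not> p dvd \<sigma>\<^sup>2 * b"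
    then have e: "p dvd c - \<sigma>\<^sup>2 * b" "\<not> p\<^sup>2 dvd c - \<sigma>\<^sup>2 * b" "\<not> p dvd \<sigma>\<^sup>2 * b" by auto
    have zp: "p dvd z - b ^ m \<and> \<not> p\<^sup>2 dvd z - b ^ m"
      by (rule divQ; unfold Q_times_z_minus; rule exact_prime_power_diff[OF p(1) e p(2)])
    then have nw: "\<not> p dvd z" using not_both by blast
    have "p dvd D" unfolding D using zp by simp
    moreover have "\<not> p\<^sup>2 dvd D" unfolding D mult.commute[of z] using zp prime_square_dvd_multD[OF p(1) nw] by blast
    ultimately show ?thesis ..
  qed
qed

end

text \<open>\<epsilon> is the sign of \<open>y\<close>; as \<open>c - \<sigma>^2 b = - T y\<close>
  with \<open>T > 0\<close>, the value 1 yields negative \<open>D\<close>. Bounding by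
  \<open>P\<close> instead of \<open>p\<close> prepares for counting all pairs below a common
  limit.\<close>

lemma exists_family:
  fixes m :: nat and \<epsilon> :: int
  assumes m: "m > 1" and \<epsilon>: "\<epsilon> = 1 \<or> \<epsilon> = - 1"
  obtains k0 M :: nat where "\<And>q p P. prime q \<Longrightarrow> prime p \<Longrightarrow> k0 < q \<Longrightarrow> q < p \<Longrightarrow> p \<le> P \<Longrightarrow>
    \<exists>b c z \<sigma> S Q D. family m b c z \<sigma> S Q D \<and>
      int p dvd D \<and> \<not> (int p)\<^sup>2 dvd D \<and> int q dvd D \<and> \<not> (int q)\<^sup>2 dvd D \<and>
      \<bar>D\<bar> \<le> int M * int P ^ (2 * m) \<and> (if \<epsilon> = 1 then D < 0 else D > 0)"
proof -
  define \<sigma> :: int where "\<sigma> = (2 * int m)\<^sup>2"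
  define S where "S = \<sigma> ^ m"
  define Q where "Q = S\<^sup>2 - 1"
  define L where "L = Q\<^sup>2 * \<sigma>"
  define T where "T = \<sigma>\<^sup>2 - 1"
  obtain x0 where x0: "\<And>x y. [x = x0] (mod L) \<Longrightarrow> [y = 1 - x0] (mod L) \<Longrightarrow>
    coprime (x + y) (\<sigma>\<^sup>2 * x + y) \<Longrightarrow>
    \<exists>z. family m (x + y) (\<sigma>\<^sup>2 * x + y) z \<sigma> S Q (z * (z - (x + y) ^ m))"
    using family_residue[OF m \<sigma>_def S_def Q_def] unfolding L_def by blast
  have Q0: "Q > 0" using family_modulus(1)[OF m \<sigma>_def S_def Q_def] .
  have m\<sigma>: "int m dvd \<sigma>" unfolding \<sigma>_def by (simp add: power2_eq_square)
  have "\<sigma> \<noteq> 0" "\<sigma> \<ge> 0" using m unfolding \<sigma>_def by auto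
  then have \<sigma>0: "\<sigma> > 0" by simp
  then have L0: "L > 0" unfolding L_def using Q0 by simp
  have "S\<^sup>2 = (\<sigma>\<^sup>2) ^ m" unfolding S_def by (simp only: power_mult[symmetric] mult.commute)
  then have "Q = (\<sigma>\<^sup>2) ^ m - 1 ^ m" unfolding Q_def by simp
  also have "\<dots> = T * (\<Sum>i<m. 1 ^ (m - Suc i) * (\<sigma>\<^sup>2) ^ i)" unfolding T_def by (rule power_diff_sumr2)
  finally have TQ: "T dvd Q" by simp
  have QL: "Q dvd L" and \<sigma>L: "\<sigma> dvd L" unfolding L_def by (simp_all add: power2_eq_square)
  have TL: "T dvd L" using TQ QL by (rule dvd_trans)
  have T0: "T > 0"
  proof -
    have "T \<noteq> 0" using TL L0 by auto
    moreover have "\<sigma>\<^sup>2 \<ge> 1" using \<sigma>0 by (simp add: int_one_le_iff_zero_less)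
    ultimately show ?thesis unfolding T_def by linarith
  qed
  \<comment> \<open>The multiplier \<open>k2\<close> will stay below \<open>2 * L\<close>, so these
    are the only primes outside \<open>L\<close> that could divide both multipliers.\<close>
  define R where "R = {r::nat. prime r \<and> int r \<le> 2 * L \<and> \<not> int r dvd L}"
  have finR: "finite R" by (rule finite_subset[of _ "{..nat (2 * L)}"]) (auto simp: R_def)
  define L' where "L' = (\<Prod>r\<in>R. int r)"
  have L'0: "L' > 0" unfolding L'_def by (rule prod_pos) (auto simp: R_def prime_gt_0_nat)
  have copL: "coprime L L'" unfolding L'_def
  proof (rule prod_coprime_right)
    fix r assume "r \<in> R"
    then have "coprime (int r) L" unfolding R_def by (intro prime_imp_coprime) auto
    then show "coprime L (int r)" by (rule coprime_commute[THEN iffD1])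
  qed
  \<comment> \<open>An upper bound for both multipliers; a prime above it divides neither of them,
    nor \<open>m\<close>, nor \<open>L\<close>.\<close>
  define U where "U = 3 * (L * L')"
  have LL': "L \<le> L * L'" using L0 L'0 by simp
  have U: "L \<le> U" "2 * L \<le> U" using LL' L0 by (auto simp: U_def)
  \<comment> \<open>From \<open>|y| < x \<le> U P\<close> one gets
    \<open>|b|, |c| \<le> N P\<close>, and \<open>D_bound\<close> turns this into the constant
    \<open>M\<close>.\<close>
  define N where "N = (\<sigma>\<^sup>2 + 1) * U"
  define M where "M = nat (6 * N ^ (2 * m))"
  have N0: "N > 0" unfolding N_def using U L0 \<sigma>0 by (intro mult_pos_pos add_pos_pos) auto
  have "\<exists>b c z \<sigma> S Q D. family m b c z \<sigma> S Q D \<and>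
      int p dvd D \<and> \<not> (int p)\<^sup>2 dvd D \<and> int q dvd D \<and> \<not> (int q)\<^sup>2 dvd D \<and>
      \<bar>D\<bar> \<le> int M * int P ^ (2 * m) \<and> (if \<epsilon> = 1 then D < 0 else D > 0)"
    if q: "prime q" and p: "prime p" and q0: "nat U < q" and qp: "q < p" and pP: "p \<le> P" for q p P
  proof -
    have pp: "prime (int p)" and pq: "prime (int q)" using p q by auto
    have qU: "U < int q" using q0 by simp
    have pU: "U < int p" using qU qp by simp
    have small: "\<not> int r dvd k" if "0 < k" "k \<le> U" "U < int r" for r k
      using zdvd_not_zless[of k "int r"] that by simp
    have mL: "int m \<le> L" using dvd_trans[OF m\<sigma> \<sigma>L] L0 by (rule zdvd_imp_le)
    have mU: "0 < int m" "int m \<le> U" using m mL U(1) by linarith+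
    have nm: "\<not> int p dvd int m" "\<not> int q dvd int m" using small[OF mU] pU qU by blast+
    have nL: "\<not> int p dvd L" "\<not> int q dvd L" using small[OF L0 U(1)] pU qU by blast+
    have nQ: "\<not> int p dvd Q" "\<not> int q dvd Q" using nL QL dvd_trans by blast+
    have n\<sigma>: "\<not> int p dvd \<sigma>" "\<not> int q dvd \<sigma>" using nL \<sigma>L dvd_trans by blast+
    have nT: "\<not> int p dvd T" "\<not> int q dvd T" using nL TL dvd_trans by blast+
    have npq: "\<not> int p dvd int q" "\<not> int q dvd int p"
    proof -
      show "\<not> int p dvd int q" using primes_dvd_imp_eq[OF p q] qp by auto
      show "\<not> int q dvd int p" using primes_dvd_imp_eq[OF q p] qp by auto
    qed
    obtain p' where p': "[int p * p' = 1] (mod L)"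
      using cong_solve_coprime_int[OF prime_imp_coprime[OF pp nL(1)]] by blast
    obtain q' where q': "[int q * q' = 1] (mod L)"
      using cong_solve_coprime_int[OF prime_imp_coprime[OF pq nL(2)]] by blast
    \<comment> \<open>the congruence modulo \<open>L'\<close> prevents common prime factors of \<open>k1\<close> and \<open>k2\<close> outside \<open>L\<close>\<close>
    obtain t where t: "[t = x0 * p'] (mod L)" "[t = 1] (mod L')"
      using binary_chinese_remainder_int[OF copL] by blast
    have LL0: "L * L' > 0" using L0 L'0 by simp
    \<comment> \<open>Starting at twice the modulus keeps \<open>k1\<close> above
      \<open>k2 < 2 L\<close>. Together with \<open>q < p\<close> this gives \<open>|y| < x\<close>,
      hence \<open>b > 0\<close> for either sign of \<open>y\<close>.\<close>
    obtain k1 where k1: "2 * (L * L') \<le> k1" "k1 < 2 * (L * L') + L * L'" "[k1 = t] (mod L * L')"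
      using exists_cong_in_interval[OF LL0] by blast
    obtain k2 where k2: "L \<le> k2" "k2 < L + L" "[k2 = \<epsilon> * (1 - x0) * q'] (mod L)"
      using exists_cong_in_interval[OF L0] by blast
    have k1_bounds: "0 < k1" "k1 \<le> U" using k1(1,2) LL0 unfolding U_def by linarith+
    have k2_bounds: "0 < k2" "k2 \<le> U" "k2 \<le> k1" using k2(1,2) k1(1) L0 LL' U by linarith+
    define x y where "x = k1 * int p" and "y = \<epsilon> * (k2 * int q)"
    have x: "[x = x0] (mod L)"
    proof -
      have "[k1 = t] (mod L)" by (rule cong_dvd_modulus[OF k1(3)]) simp
      then have "[k1 = x0 * p'] (mod L)" using t(1) by (rule cong_trans)
      then have "[k1 * int p = (x0 * p') * int p] (mod L)" by (rule cong_scalar_right)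
      also have "(x0 * p') * int p = x0 * (int p * p')" by simp
      also have "[\<dots> = x0 * 1] (mod L)" using p' by (rule cong_scalar_left)
      finally show ?thesis by (simp add: x_def)
    qed
    have y: "[y = 1 - x0] (mod L)"
    proof -
      have "[\<epsilon> * (k2 * int q) = \<epsilon> * ((\<epsilon> * (1 - x0) * q') * int q)] (mod L)"
        using k2(3) by (intro cong_scalar_left cong_scalar_right)
      also have "\<epsilon> * ((\<epsilon> * (1 - x0) * q') * int q) = (1 - x0) * (int q * q')" using \<epsilon> by auto
      also have "[\<dots> = (1 - x0) * 1] (mod L)" using q' by (rule cong_scalar_left)
      finally show ?thesis by (simp add: y_def)
    qed
    have "[x + y = x0 + (1 - x0)] (mod L)" using x y by (rule cong_add)
    then have xy1: "[x + y = 1] (mod L)" by simp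
    have dvd_y: "r dvd y \<longleftrightarrow> r dvd k2 * int q" for r using \<epsilon> by (auto simp: y_def)
    have cop: "coprime (x + y) (\<sigma>\<^sup>2 * x + y)"
    proof (rule coprime_linear_forms[OF _ xy1])
      show "\<sigma>\<^sup>2 - 1 dvd L" using TL unfolding T_def .
      fix r assume r: "prime r" "\<not> r dvd L" "r dvd x" "r dvd y"
      have r0: "r > 0" using r(1) prime_gt_0_int by blast
      have rx: "r dvd k1 \<or> r dvd int p" using r(3) unfolding x_def by (simp only: prime_dvd_mult_iff[OF r(1)])
      have ry: "r dvd k2 \<or> r dvd int q" using r(4) unfolding dvd_y by (simp only: prime_dvd_mult_iff[OF r(1)])
      have rq: "\<not> r dvd int q"
      proof
        assume "r dvd int q"
        then have "r = int q" using primes_dvd_imp_eq[OF r(1) pq] by blast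
        then show False using rx npq(2) small[OF k1_bounds qU] by blast
      qed
      have rp: "\<not> r dvd int p"
      proof
        assume "r dvd int p"
        then have "r = int p" using primes_dvd_imp_eq[OF r(1) pp] by blast
        then show False using ry npq(1) small[OF k2_bounds(1,2) pU] by blast
      qed
      have rk: "r dvd k1" "r dvd k2" using rx ry rp rq by auto
      have "r \<le> k2" using rk(2) k2_bounds(1) by (rule zdvd_imp_le)
      then have "r \<le> 2 * L" using k2(2) by linarith
      moreover have "int (nat r) = r" using r0 by simp
      moreover have "prime (nat r)" using r(1) prime_int_nat_transfer by blast
      ultimately have "nat r \<in> R" using r(2) unfolding R_def by simp
      then have "int (nat r) dvd L'" unfolding L'_def by (intro dvd_prodI finR)
      then have "r dvd L'" by (simp only: \<open>int (nat r) = r\<close>)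
      have "[k1 = t] (mod L')" by (rule cong_dvd_modulus[OF k1(3)]) simp
      then have "[k1 = 1] (mod L')" using t(2) by (rule cong_trans)
      then have "[k1 = 1] (mod r)" using \<open>r dvd L'\<close> by (rule cong_dvd_modulus)
      then have "r dvd 1" using rk(1) cong_dvd_iff by blast
      then show False using r(1) not_prime_unit by blast
    qed
    define b c where "b = x + y" and "c = \<sigma>\<^sup>2 * x + y"
    obtain z where "family m b c z \<sigma> S Q (z * (z - b ^ m))"
      using x0[OF x y cop] unfolding b_def c_def by blast
    then obtain D where "family m b c z \<sigma> S Q D" by blast
    then interpret family m b c z \<sigma> S Q D .
    have cb: "c - b = T * x" and csb: "c - \<sigma>\<^sup>2 * b = - (T * y)"
      by (simp_all add: b_def c_def T_def algebra_simps)
    have nx: "\<not> int q dvd x" and ny: "\<not> int p dvd y"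
      unfolding x_def dvd_y
      using small[OF k1_bounds qU] small[OF k2_bounds(1,2) pU] npq
      by (simp_all only: prime_dvd_mult_iff[OF pp] prime_dvd_mult_iff[OF pq] simp_thms)
    have px: "int p dvd x" and qy: "int q dvd y" unfolding x_def dvd_y by simp_all
    have nb: "\<not> int p dvd b" "\<not> int q dvd b"
      unfolding b_def using px ny qy nx dvd_add_right_iff[OF px] dvd_add_left_iff[OF qy] by blast+
    have nTk: "\<not> int p dvd T * k1" "\<not> int q dvd T * k2"
      using nT small[OF k1_bounds pU] small[OF k2_bounds(1,2) qU]
      by (simp_all only: prime_dvd_mult_iff[OF pp] prime_dvd_mult_iff[OF pq] simp_thms)
    have sq: "\<not> r\<^sup>2 dvd k * r" if "\<not> r dvd k" "r \<noteq> 0" for r k :: int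
      using that by (simp add: power2_eq_square)
    have "\<not> (int p)\<^sup>2 dvd c - b"
    proof -
      have "\<not> (int p)\<^sup>2 dvd (T * k1) * int p" using nTk(1) p by (intro sq) auto
      then show ?thesis unfolding cb x_def by (simp only: mult.assoc not_False_eq_True)
    qed
    moreover have "int p dvd c - b" unfolding cb using px by (rule dvd_mult)
    ultimately have pD: "int p dvd D \<and> \<not> (int p)\<^sup>2 dvd D"
      by (intro prime_exact_dvd_D pp nm nQ nb) blast
    have "\<not> (int q)\<^sup>2 dvd c - \<sigma>\<^sup>2 * b"
    proof -
      have "\<not> (int q)\<^sup>2 dvd (T * k2) * int q" using nTk(2) q by (intro sq) auto
      moreover have "(int q)\<^sup>2 dvd - (T * y) \<longleftrightarrow> (int q)\<^sup>2 dvd (T * k2) * int q"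
        using \<epsilon> by (auto simp: y_def mult.assoc)
      ultimately show ?thesis unfolding csb by blast
    qed
    moreover have "int q dvd c - \<sigma>\<^sup>2 * b" unfolding csb using qy by simp
    moreover have "\<not> int q dvd \<sigma>\<^sup>2 * b"
      using n\<sigma>(2) nb(2) by (simp only: power2_eq_square prime_dvd_mult_iff[OF pq] simp_thms)
    ultimately have qD: "int q dvd D \<and> \<not> (int q)\<^sup>2 dvd D"
      by (intro prime_exact_dvd_D pq nm nQ nb) blast
    have xpos: "x > 0" unfolding x_def using k1_bounds p prime_gt_0_nat[OF p] by simp
    have k2q: "k2 * int q > 0" using k2_bounds q prime_gt_0_nat[OF q] by simp
    have "k2 * int q < k2 * int p" using k2_bounds qp by simp
    also have "k2 * int p \<le> x" unfolding x_def using k2_bounds by (intro mult_right_mono) auto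
    finally have yx: "\<bar>y\<bar> < x" using \<epsilon> k2q by (auto simp: y_def)
    have cb0: "b < c" using mult_pos_pos[OF T0 xpos] cb by linarith
    have b0: "0 < b" using yx unfolding b_def by linarith
    have sign: "if \<epsilon> = 1 then D < 0 else D > 0"
    proof (cases "\<epsilon> = 1")
      case True
      then have "y > 0" using k2q by (simp add: y_def)
      then have "T * y > 0" using T0 by (rule mult_pos_pos[rotated])
      then have "c < \<sigma>\<^sup>2 * b" using csb by simp
      then show ?thesis using D_neg[OF b0 cb0] True by simp
    next
      case False
      then have "- y > 0" using k2q \<epsilon> by (simp add: y_def)
      then have "T * - y > 0" using T0 by (rule mult_pos_pos[rotated])
      then have "\<sigma>\<^sup>2 * b < c" using csb by simp
      then show ?thesis using D_pos[OF b0 cb0] False by simp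
    qed
    have xN: "x \<le> U * int P" unfolding x_def using k1_bounds pP by (intro mult_mono) auto
    have "\<bar>c\<bar> \<le> \<sigma>\<^sup>2 * x + x" using yx xpos unfolding c_def
      by (intro order.trans[OF abs_triangle_ineq]) (simp add: abs_mult)
    also have "\<dots> = (\<sigma>\<^sup>2 + 1) * x" by (simp add: algebra_simps)
    also have "\<dots> \<le> (\<sigma>\<^sup>2 + 1) * (U * int P)" using xN by (intro mult_left_mono) auto
    finally have cN: "\<bar>c\<bar> \<le> N * int P" by (simp add: N_def mult.assoc)
    have bN: "\<bar>b\<bar> \<le> N * int P" using b0 cb0 cN by linarith
    have "\<bar>D\<bar> \<le> 6 * (N * int P) ^ (2 * m)" using D_bound[OF bN cN] .
    also have "\<dots> = int M * int P ^ (2 * m)" using N0 by (simp add: M_def power_mult_distrib)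
    finally show ?thesis using pD qD sign \<open>family m b c z \<sigma> S Q D\<close> by blast
  qed
  then show ?thesis by (rule that)
qed

section \<open>Counting\<close>

lemma prod_primes_dvd:
  fixes n :: nat
  assumes "finite A" "\<And>p. p \<in> A \<Longrightarrow> prime p \<and> p dvd n"
  shows "\<Prod>A dvd n"
  using assms
proof (induction A rule: finite_induct)
  case (insert p A)
  have "coprime p (\<Prod>A)"
  proof (rule prod_coprime_right)
    fix q assume "q \<in> A"
    then show "coprime p q" using insert.prems[of p] insert.prems[of q] insert.hyps(2) primes_coprime[of p q] by auto
  qed
  then have "p * \<Prod>A dvd n" using insert.IH insert.prems by (intro divides_mult) auto
  then show ?case using insert.hyps by simp
qed simp

lemma card_large_prime_divisors:
  fixes n R k :: nat
  assumes "finite A" "\<And>p. p \<in> A \<Longrightarrow> prime p \<and> p dvd n \<and> R < p" "n > 0" "R > 0" "n < R ^ k"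
  shows "card A < k"
proof (rule ccontr)
  assume "\<not> ?thesis"
  then have "R ^ k \<le> R ^ card A" using assms(4) by (intro power_increasing) auto
  also have "\<dots> = (\<Prod>p\<in>A. R)" by simp
  also have "\<dots> \<le> \<Prod>A" using assms(2) by (intro prod_mono) (auto intro: less_imp_le)
  also have "\<Prod>A dvd n" using assms(1,2) by (intro prod_primes_dvd) auto
  then have "\<Prod>A \<le> n" using assms(3) by (rule dvd_imp_le)
  finally show False using assms(5) by simp
qed

lemma card_le_fibers:
  assumes "finite F" "f ` A \<subseteq> F" "\<And>K. K \<in> F \<Longrightarrow> card {a \<in> A. f a = K} \<le> k"
  shows "card A \<le> k * card F"
proof -
  have "A = (\<Union>K\<in>F. {a \<in> A. f a = K})" using assms(2) by auto
  then have "card A \<le> (\<Sum>K\<in>F. card {a \<in> A. f a = K})" using card_UN_le[OF assms(1), of "\<lambda>K. {a \<in> A. f a = K}"] by simp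
  also have "\<dots> \<le> of_nat (card F) * k" by (intro sum_bounded_above assms(3))
  finally show ?thesis by (simp add: mult.commute)
qed

lemma card_square_le_pairs:
  fixes A :: "'a :: linorder set"
  assumes "finite A"
  shows "card A * card A \<le> card A + 2 * card {(q, p). q \<in> A \<and> p \<in> A \<and> q < p}"
proof -
  define B where "B = {(q, p). q \<in> A \<and> p \<in> A \<and> q < p}"
  have B: "finite B" by (rule finite_subset[of _ "A \<times> A"]) (auto simp: B_def assms)
  have "A \<times> A \<subseteq> (\<lambda>a. (a, a)) ` A \<union> (B \<union> prod.swap ` B)"
    by (force simp: B_def image_iff)
  then have "card (A \<times> A) \<le> card ((\<lambda>a. (a, a)) ` A \<union> (B \<union> prod.swap ` B))"
    using assms B by (intro card_mono) auto
  also have "\<dots> \<le> card ((\<lambda>a. (a, a)) ` A) + (card B + card (prod.swap ` B))"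
    by (rule order.trans[OF card_Un_le add_left_mono[OF card_Un_le]])
  also have "\<dots> \<le> card A + (card B + card B)"
    by (intro add_mono card_image_le assms B order.refl)
  finally show ?thesis by (simp add: card_cartesian_product B_def mult_2)
qed

text \<open>Chebyshev's bound at \<open>R^2\<close>, with at most \<open>R\<close> primes discarded;
  \<open>ln (R^2) = 2 ln R\<close> turns the 4 into an 8.\<close>

lemma card_primes_between:
  assumes "R > 1"
  shows "real (card {p::nat. prime p \<and> R < p \<and> p \<le> R\<^sup>2}) \<ge> ln 2 / 8 * ((real R)\<^sup>2 / ln (real R)) - real R"
proof -
  have "2\<^sup>2 \<le> R\<^sup>2" using assms by (intro power_mono) auto
  then have "ln 2 / 4 * (real (R\<^sup>2) / ln (real (R\<^sup>2))) \<le> real (card {p. prime p \<and> p \<le> R\<^sup>2})"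
    by (intro chebyshev_lower) simp
  moreover have "ln (real (R\<^sup>2)) = 2 * ln (real R)" using assms by (simp add: ln_realpow)
  moreover have "card {p::nat. prime p \<and> p \<le> R\<^sup>2} \<le> card ({p::nat. prime p \<and> R < p \<and> p \<le> R\<^sup>2} \<union> {1..R})"
  proof (rule card_mono)
    show "finite ({p::nat. prime p \<and> R < p \<and> p \<le> R\<^sup>2} \<union> {1..R})"
      by (rule finite_subset[of _ "{..max (R\<^sup>2) R}"]) auto
    show "{p::nat. prime p \<and> p \<le> R\<^sup>2} \<subseteq> {p::nat. prime p \<and> R < p \<and> p \<le> R\<^sup>2} \<union> {1..R}"
      using prime_ge_1_nat by (auto simp: not_less)
  qed
  moreover have "\<dots> \<le> card {p::nat. prime p \<and> R < p \<and> p \<le> R\<^sup>2} + card {1..R}" by (rule card_Un_le)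
  ultimately show ?thesis by simp
qed

text \<open>The bound on \<Delta> is below \<open>R^(4 m + 2)\<close>, so fewer than
  \<open>4 m + 2\<close> primes above \<open>R\<close> divide it. Each \<open>K\<close> thus serves
  at most \<open>(4 m + 2)^2\<close> pairs, and the square of \<open>card A\<close> counts the pairs
  twice plus the diagonal.\<close>

lemma counting_step:
  fixes F :: "'a set" and \<Delta> :: "'a \<Rightarrow> int" and m M R :: nat
  assumes R: "R > 1" "M \<le> R" and fin: "finite F"
    and \<Delta>: "\<And>K. K \<in> F \<Longrightarrow> \<Delta> K \<noteq> 0 \<and> \<bar>\<Delta> K\<bar> \<le> int (M * R ^ (4 * m))"
    and ex: "\<And>q p. prime q \<Longrightarrow> prime p \<Longrightarrow> R < q \<Longrightarrow> q < p \<Longrightarrow> p \<le> R\<^sup>2 \<Longrightarrow>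
      \<exists>K\<in>F. int p dvd \<Delta> K \<and> int q dvd \<Delta> K"
    and A: "A = {p::nat. prime p \<and> R < p \<and> p \<le> R\<^sup>2}"
  shows "card A * card A \<le> card A + 2 * ((4 * m + 2)\<^sup>2 * card F)"
proof -
  define B where "B = {(q, p). q \<in> A \<and> p \<in> A \<and> q < p}"
  have finA: "finite A" by (rule finite_subset[of _ "{..R\<^sup>2}"]) (auto simp: A)
  have "\<forall>a\<in>B. \<exists>K. K \<in> F \<and> int (snd a) dvd \<Delta> K \<and> int (fst a) dvd \<Delta> K"
  proof
    fix a assume "a \<in> B"
    then obtain q p where a: "a = (q, p)" "prime q" "prime p" "R < q" "q < p" "p \<le> R\<^sup>2" by (auto simp: B_def A)
    then show "\<exists>K. K \<in> F \<and> int (snd a) dvd \<Delta> K \<and> int (fst a) dvd \<Delta> K" using ex[OF a(2-6)] by auto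
  qed
  then obtain f where f: "\<forall>a\<in>B. f a \<in> F \<and> int (snd a) dvd \<Delta> (f a) \<and> int (fst a) dvd \<Delta> (f a)"
    using bchoice by meson
  have "card B \<le> (4 * m + 2)\<^sup>2 * card F"
  proof (rule card_le_fibers[OF fin])
    show "f ` B \<subseteq> F" using f by auto
    fix K assume K: "K \<in> F"
    define C where "C = {p \<in> A. p dvd nat \<bar>\<Delta> K\<bar>}"
    have finC: "finite C" using finA by (simp add: C_def)
    have "card C < 4 * m + 2"
    proof (rule card_large_prime_divisors[OF finC])
      show "prime p \<and> p dvd nat \<bar>\<Delta> K\<bar> \<and> R < p" if "p \<in> C" for p using that by (auto simp: C_def A)
      show "0 < nat \<bar>\<Delta> K\<bar>" using \<Delta>[OF K] by simp
      show "0 < R" using R by simp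
      have "nat \<bar>\<Delta> K\<bar> \<le> M * R ^ (4 * m)" using \<Delta>[OF K] by linarith
      also have "\<dots> \<le> R * R ^ (4 * m)" using R(2) by (rule mult_right_mono) simp
      also have "\<dots> < R * (R * R ^ (4 * m))" using R(1) by simp
      finally show "nat \<bar>\<Delta> K\<bar> < R ^ (4 * m + 2)" by simp
    qed
    have "card {a \<in> B. f a = K} \<le> card (C \<times> C)"
    proof (rule card_mono)
      show "finite (C \<times> C)" using finC by simp
      show "{a \<in> B. f a = K} \<subseteq> C \<times> C"
      proof
        fix a assume a: "a \<in> {a \<in> B. f a = K}"
        then have "int (snd a) dvd \<Delta> K" "int (fst a) dvd \<Delta> K" using f by auto
        then have "snd a dvd nat \<bar>\<Delta> K\<bar>" "fst a dvd nat \<bar>\<Delta> K\<bar>" by (simp_all add: dvd_nat_abs_iff)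
        then show "a \<in> C \<times> C" using a by (auto simp: B_def C_def)
      qed
    qed
    also have "\<dots> \<le> (4 * m + 2)\<^sup>2"
      unfolding card_cartesian_product power2_eq_square using \<open>card C < 4 * m + 2\<close> by (intro mult_mono) auto
    finally show "card {a \<in> B. f a = K} \<le> (4 * m + 2)\<^sup>2" .
  qed
  then show ?thesis using card_square_le_pairs[OF finA] unfolding B_def by linarith
qed

text \<open>The substitution is \<open>P = R^2\<close> and \<open>x\<close> of size
  \<open>M R^(4 m)\<close>: the pairs number at least a constant times
  \<open>(R^2 / ln R)^2\<close>, and \<open>R^4\<close> is \<open>x^(1/m)\<close> up to a
  constant.\<close>

lemma card_lower_bound:
  fixes F :: "real \<Rightarrow> 'a set" and \<Delta> :: "'a \<Rightarrow> int" and m \<kappa> M :: nat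
  assumes m: "m > 0" and M: "M > 0" and fin: "\<And>x. finite (F x)"
    and mono: "\<And>x y. x \<le> y \<Longrightarrow> F x \<subseteq> F y"
    and \<Delta>: "\<And>x K. K \<in> F x \<Longrightarrow> \<Delta> K \<noteq> 0 \<and> real_of_int \<bar>\<Delta> K\<bar> \<le> x"
    and ex: "\<And>q p P. prime q \<Longrightarrow> prime p \<Longrightarrow> \<kappa> < q \<Longrightarrow> q < p \<Longrightarrow> p \<le> P \<Longrightarrow>
      \<exists>K\<in>F (real (M * P ^ (2 * m))). int p dvd \<Delta> K \<and> int q dvd \<Delta> K"
  shows "(\<lambda>x. real (card (F x))) \<ggreater> (\<lambda>x. x powr (1 / real m) / (ln x)\<^sup>2)"
proof -
  define k where "k = 4 * m + 2"
  \<comment> \<open>Half of the constant in \<open>card_primes_between\<close>; the other half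
    absorbs the subtracted \<open>R\<close>.\<close>
  define \<delta> :: real where "\<delta> = ln 2 / 16"
  have \<delta>0: "\<delta> > 0" by (simp add: \<delta>_def)
  have "eventually (\<lambda>R::nat. ln 2 / 16 * ((real R)\<^sup>2 / ln (real R)) \<ge> real R) at_top" by real_asymp
  then obtain R1 where R1: "\<And>R. R \<ge> R1 \<Longrightarrow> real R \<le> \<delta> * ((real R)\<^sup>2 / ln (real R))"
    unfolding eventually_at_top_linorder \<delta>_def by blast
  define R0 where "R0 = R1 + \<kappa> + M + 2"
  have bound: "\<delta>\<^sup>2 / (4 * (real k)\<^sup>2) * (real R ^ 4 / (ln (real R))\<^sup>2) \<le> real (card (F (real (M * R ^ (4 * m)))))"
    if R: "R \<ge> R0" for R
  proof -
    have R': "R > 1" "M \<le> R" "\<kappa> \<le> R" "R1 \<le> R" using R by (auto simp: R0_def)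
    define A where "A = {p::nat. prime p \<and> R < p \<and> p \<le> R\<^sup>2}"
    define N where "N = card (F (real (M * R ^ (4 * m))))"
    have pow: "(R\<^sup>2) ^ (2 * m) = R ^ (4 * m)" by (simp flip: power_mult)
    have "card A * card A \<le> card A + 2 * ((4 * m + 2)\<^sup>2 * card (F (real (M * R ^ (4 * m)))))"
    proof (rule counting_step[OF R'(1,2) fin _ _ A_def])
      show "\<Delta> K \<noteq> 0 \<and> \<bar>\<Delta> K\<bar> \<le> int (M * R ^ (4 * m))" if "K \<in> F (real (M * R ^ (4 * m)))" for K
        using \<Delta>[OF that] by linarith
      show "\<exists>K\<in>F (real (M * R ^ (4 * m))). int p dvd \<Delta> K \<and> int q dvd \<Delta> K"
        if "prime q" "prime p" "R < q" "q < p" "p \<le> R\<^sup>2" for p q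
        using ex[OF that(1,2) _ that(4,5)] that(3) R'(3) unfolding pow by simp
    qed
    then have "real (card A * card A) \<le> real (card A + 2 * (k\<^sup>2 * N))" unfolding k_def N_def by (rule of_nat_mono)
    then have 1: "real (card A) * real (card A) \<le> real (card A) + 2 * ((real k)\<^sup>2 * real N)" by simp
    have "\<delta> * ((real R)\<^sup>2 / ln (real R)) = ln 2 / 8 * ((real R)\<^sup>2 / ln (real R)) - \<delta> * ((real R)\<^sup>2 / ln (real R))"
      by (simp add: \<delta>_def)
    also have "\<dots> \<le> real (card A)" using card_primes_between[OF R'(1)] R1[OF R'(4)] unfolding A_def by linarith
    finally have 2: "\<delta> * ((real R)\<^sup>2 / ln (real R)) \<le> real (card A)" .
    \<comment> \<open>From two elements on, the diagonal term is at most half of the square and can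
      be absorbed.\<close>
    then have "2 \<le> real (card A)" using R1[OF R'(4)] R'(1) by linarith
    then have "2 * real (card A) \<le> real (card A) * real (card A)" by (rule mult_right_mono) simp
    then have 3: "real (card A) * real (card A) \<le> 4 * ((real k)\<^sup>2 * real N)" using 1 by linarith
    have ln0: "ln (real R) > 0" using R'(1) by simp
    have "(\<delta> * ((real R)\<^sup>2 / ln (real R)))\<^sup>2 \<le> (real (card A))\<^sup>2" using 2 \<delta>0 ln0 by (intro power_mono) auto
    then have "\<delta>\<^sup>2 * (real R ^ 4 / (ln (real R))\<^sup>2) \<le> real N * (4 * (real k)\<^sup>2)"
      using 3 by (simp add: power2_eq_square[of "real (card A)"] power_mult_distrib power_divide mult_ac flip: power_mult)
    moreover have "4 * (real k)\<^sup>2 > 0" by (simp add: k_def)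
    ultimately have "\<delta>\<^sup>2 * (real R ^ 4 / (ln (real R))\<^sup>2) / (4 * (real k)\<^sup>2) \<le> real N" by (simp only: pos_divide_le_eq)
    then show ?thesis unfolding N_def by (simp only: times_divide_eq_left)
  qed
  \<comment> \<open>The 16 pays for rounding: the integer \<open>R\<close> chosen below is at least
    \<open>t / 2\<close>, and fourth powers are compared.\<close>
  define c where "c = \<delta>\<^sup>2 / (4 * (real k)\<^sup>2) / (16 * real M powr (1 / real m))"
  \<comment> \<open>The summand 1 leaves room for the floor, so that
    \<open>R \<ge> R0\<close>.\<close>
  define x0 where "x0 = real M * (real R0 + 1) ^ (4 * m)"
  have "c > 0" unfolding c_def using \<delta>0 M by (intro divide_pos_pos mult_pos_pos) (auto simp: k_def)
  moreover have "c * (x powr (1 / real m) / (ln x)\<^sup>2) \<le> real (card (F x))" if x: "x \<ge> x0" for x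
  proof -
    have M0: "real M > 0" using M by simp
    have x1: "(real R0 + 1) ^ (4 * m) \<le> x / real M" using x M0 unfolding x0_def by (simp add: pos_le_divide_eq mult.commute)
    have "(1::real) ^ (4 * m) \<le> (real R0 + 1) ^ (4 * m)" by (intro power_mono) auto
    then have xM1: "x / real M \<ge> 1" using x1 unfolding power_one by linarith
    then have xM: "x / real M > 0" by simp
    then have xpos: "x > 0" using M0 by (simp add: zero_less_divide_iff)
    \<comment> \<open>The real solution of \<open>M * t ^ (4 * m) = x\<close>; its floor is the
      parameter \<open>R\<close>.\<close>
    define t where "t = (x / real M) powr (1 / real (4 * m))"
    have t0: "t > 0" unfolding t_def using xpos M by simp
    have t_pow: "t ^ (4 * m) = x / real M"
    proof -
      have "t ^ (4 * m) = t powr real (4 * m)" using t0 by (simp only: powr_realpow)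
      also have "\<dots> = (x / real M) powr (1 / real (4 * m) * real (4 * m))" unfolding t_def by (rule powr_powr)
      also have "1 / real (4 * m) * real (4 * m) = 1" using m by simp
      finally show ?thesis using xpos M by simp
    qed
    have "real R0 + 1 \<le> t"
    proof (rule power_le_imp_le_base[of _ "4 * m - 1"])
      show "(real R0 + 1) ^ Suc (4 * m - 1) \<le> t ^ Suc (4 * m - 1)" using x1 t_pow m by simp
    qed (use t0 in simp)
    define R where "R = nat \<lfloor>t\<rfloor>"
    have Rt: "real R \<le> t" "t < real R + 1" using t0 unfolding R_def by linarith+
    have RR0: "R \<ge> R0" using Rt \<open>real R0 + 1 \<le> t\<close> by linarith
    have R2: "R \<ge> 2" using RR0 by (simp add: R0_def)
    have "real M * real R ^ (4 * m) \<le> real M * t ^ (4 * m)" using Rt(1) by (intro mult_left_mono power_mono) auto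
    also have "\<dots> = x" using t_pow M0 by simp
    finally have MR: "real (M * R ^ (4 * m)) \<le> x" by simp
    have half: "t / 2 \<le> real R" using Rt(2) R2 by linarith
    have "(x / real M) powr (1 / real (4 * m) * real 4) = t powr real 4" unfolding t_def by (rule powr_powr[symmetric])
    also have "\<dots> = t ^ 4" using t0 by (rule powr_realpow)
    also have "1 / real (4 * m) * real 4 = 1 / real m" using m by simp
    finally have t4: "x powr (1 / real m) / real M powr (1 / real m) = t ^ 4"
      using xpos M0 by (simp add: powr_divide)
    have "(t / 2) ^ 4 \<le> real R ^ 4" using half t0 by (intro power_mono) auto
    then have R4: "x powr (1 / real m) / (16 * real M powr (1 / real m)) \<le> real R ^ 4"
      using t4 by (simp add: power_divide mult.commute flip: divide_divide_eq_left)
    \<comment> \<open>The crude bound \<open>R \<le> x\<close> is for the logarithms: it allows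
      \<open>ln R\<close> to be replaced by \<open>ln x\<close> in the denominator.\<close>
    have "real R \<le> real R ^ (4 * m)" using R2 m by (intro self_le_power) auto
    also have "\<dots> = 1 * real R ^ (4 * m)" by simp
    also have "\<dots> \<le> real M * real R ^ (4 * m)" using M by (intro mult_right_mono) auto
    also have "\<dots> \<le> x" using MR by simp
    finally have "real R \<le> x" .
    then have ln: "ln (real R) \<le> ln x" using R2 by simp
    have ln0: "ln (real R) > 0" using R2 by simp
    have "c * (x powr (1 / real m) / (ln x)\<^sup>2) =
      \<delta>\<^sup>2 / (4 * (real k)\<^sup>2) * ((x powr (1 / real m) / (16 * real M powr (1 / real m))) / (ln x)\<^sup>2)"
      by (simp add: c_def)
    also have "\<dots> \<le> \<delta>\<^sup>2 / (4 * (real k)\<^sup>2) * (real R ^ 4 / (ln (real R))\<^sup>2)"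
      using R4 ln ln0 by (intro mult_left_mono frac_le power_mono) auto
    also have "\<dots> \<le> real (card (F (real (M * R ^ (4 * m)))))" by (rule bound[OF RR0])
    also have "\<dots> \<le> real (card (F x))" using mono[OF MR] fin by (simp add: card_mono)
    finally show ?thesis .
  qed
  ultimately show ?thesis unfolding asymp_bounded_below_def by blast
qed

section \<open>From members of the family to counted fields\<close>

lemma exact_prime_dvd_squarefree_part:
  fixes p D d y :: int
  assumes "prime p" "p dvd D" "\<not> p\<^sup>2 dvd D" "D = d * y\<^sup>2"
  shows "p dvd d"
proof -
  have "\<not> p dvd y"
  proof
    assume "p dvd y"
    then have "p\<^sup>2 dvd y\<^sup>2" by (rule dvd_power_same)
    then show False using assms(3,4) by simp
  qed
  then have "\<not> p dvd y\<^sup>2" using prime_dvd_power[OF assms(1)] by blast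
  then show ?thesis using assms(2) unfolding assms(4) by (simp only: prime_dvd_mult_iff[OF assms(1)]) blast
qed

text \<open>The field belongs to the squarefree part \<open>d\<close> of \<open>D\<close>. A simple
  prime divisor of \<open>D\<close> survives in \<open>d\<close>, and \<open>p \<ge> 5\<close> then
  gives both \<open>d \<noteq> 1\<close> and \<open>|d| \<ge> 5\<close>, as
  \<open>imaginary_unit\<close> requires for negative \<open>d\<close>.\<close>

lemma family_field:
  assumes "family m b c z \<sigma> S Q D" and p: "prime p" "p \<ge> 5" "p dvd D" "\<not> p\<^sup>2 dvd D"
  obtains K where "D < 0 \<longrightarrow> imaginary_quadratic_field K \<and> enat 2 \<le> m_rank m (class_group K)"
    "D > 0 \<longrightarrow> real_quadratic_field K \<and> enat 1 \<le> m_rank m (class_group K)"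
    "discriminant K \<noteq> 0" "\<bar>discriminant K\<bar> \<le> 4 * \<bar>D\<bar>"
    "\<forall>q. prime q \<longrightarrow> q dvd D \<longrightarrow> \<not> q\<^sup>2 dvd D \<longrightarrow> q dvd discriminant K"
proof -
  define d y where "d = squarefree_part D" and "y = square_part D"
  define s where "s = csqrt (of_int d)"
  have D_sq: "D = d * y\<^sup>2" unfolding d_def y_def by (rule squarefree_decompose)
  have pd: "p dvd d" using exact_prime_dvd_squarefree_part[OF p(1,3,4) D_sq] .
  have sqf: "squarefree d" unfolding d_def by (rule squarefree_squarefree_part)
  have d1: "d \<noteq> 1"
  proof
    assume "d = 1"
    then show False using pd p(1) not_prime_unit by blast
  qed
  have s: "s\<^sup>2 = of_int d" unfolding s_def by (rule power2_csqrt)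
  interpret quadratic d s by (rule quadratic.intro[OF s sqf d1])
  interpret family m b c z \<sigma> S Q D by (rule assms(1))
  interpret quadratic_family d s m b c z \<sigma> S Q D y
    by (rule quadratic_family.intro[OF quadratic_axioms family_axioms quadratic_family_axioms.intro[OF D_sq]])
  have "D \<noteq> 0" using p(4) by auto
  then have y2: "y\<^sup>2 > 0" using D_sq by auto
  have dp: "\<bar>d\<bar> \<ge> p" using zdvd_imp_le[of p "\<bar>d\<bar>"] pd d_nz by simp
  have "1 \<le> y\<^sup>2" using y2 by linarith
  then have "\<bar>d\<bar> * 1 \<le> \<bar>d\<bar> * y\<^sup>2" by (rule mult_left_mono) simp
  then have dD: "\<bar>d\<bar> \<le> \<bar>D\<bar>" unfolding D_sq abs_mult by simp
  have d_disc: "d dvd disc" "disc \<noteq> 0" "\<bar>disc\<bar> \<le> 4 * \<bar>d\<bar>" using d_nz by (auto simp: disc_def abs_mult)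
  show ?thesis
  proof (rule that[of K])
    show "D < 0 \<longrightarrow> imaginary_quadratic_field K \<and> enat 2 \<le> m_rank m A"
    proof
      assume "D < 0"
      then have "d < 0" unfolding D_sq using y2 by (simp only: mult_less_0_iff) linarith
      then show "imaginary_quadratic_field K \<and> enat 2 \<le> m_rank m A"
        using imaginary_K imaginary_rank dp p(2) by simp
    qed
    show "D > 0 \<longrightarrow> real_quadratic_field K \<and> enat 1 \<le> m_rank m A"
    proof
      assume "D > 0"
      then have "d > 0" unfolding D_sq using y2 by (simp only: zero_less_mult_iff) linarith
      then show "real_quadratic_field K \<and> enat 1 \<le> m_rank m A"
        using real_K real_rank by blast
    qed
    show "discriminant K \<noteq> 0" "\<bar>discriminant K\<bar> \<le> 4 * \<bar>D\<bar>"
      unfolding discriminant_K using d_disc dD by linarith+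
    show "\<forall>q. prime q \<longrightarrow> q dvd D \<longrightarrow> \<not> q\<^sup>2 dvd D \<longrightarrow> q dvd discriminant K"
      unfolding discriminant_K
      using exact_prime_dvd_squarefree_part[OF _ _ _ D_sq] d_disc(1) dvd_trans by blast
  qed
qed

text \<open>The common frame of the two estimates: \<open>P\<close> collects the kind of field and
  the rank condition, and \<epsilon> selects the matching sign of \<open>D\<close>.\<close>

lemma field_count_lower_bound:
  fixes m :: nat and P :: "complex set \<Rightarrow> bool" and \<epsilon> :: int
  assumes m: "m > 1" and \<epsilon>: "\<epsilon> = 1 \<or> \<epsilon> = - 1"
    and P: "\<And>K. P K \<Longrightarrow> number_field 2 K \<and> discriminant K \<noteq> 0"
    and ex: "\<And>b c z \<sigma> S Q D p. family m b c z \<sigma> S Q D \<Longrightarrow> prime p \<Longrightarrow> p \<ge> 5 \<Longrightarrow> p dvd D \<Longrightarrow> \<not> p\<^sup>2 dvd D \<Longrightarrow>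
      (if \<epsilon> = 1 then D < 0 else D > 0) \<Longrightarrow>
      \<exists>K. P K \<and> \<bar>discriminant K\<bar> \<le> 4 * \<bar>D\<bar> \<and>
        (\<forall>q. prime q \<longrightarrow> q dvd D \<longrightarrow> \<not> q\<^sup>2 dvd D \<longrightarrow> q dvd discriminant K)"
  shows "(\<lambda>x. real (card {K. P K \<and> real_of_int \<bar>discriminant K\<bar> \<le> x})) \<ggreater> (\<lambda>x. x powr (1 / real m) / (ln x)\<^sup>2)"
proof -
  obtain k0 M :: nat where fam: "\<And>q p N. prime q \<Longrightarrow> prime p \<Longrightarrow> k0 < q \<Longrightarrow> q < p \<Longrightarrow> p \<le> N \<Longrightarrow>
    \<exists>b c z \<sigma> S Q D. family m b c z \<sigma> S Q D \<and>
      int p dvd D \<and> \<not> (int p)\<^sup>2 dvd D \<and> int q dvd D \<and> \<not> (int q)\<^sup>2 dvd D \<and>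
      \<bar>D\<bar> \<le> int M * int N ^ (2 * m) \<and> (if \<epsilon> = 1 then D < 0 else D > 0)"
    by (rule exists_family[OF m \<epsilon>]) blast
  show ?thesis
  \<comment> \<open>The 5 ensures \<open>p \<ge> 5\<close>; the 4 bounds the discriminant by
    \<open>4 |D|\<close>, and \<open>M + 1\<close> makes the constant positive.\<close>
  proof (rule card_lower_bound[where \<Delta> = discriminant and \<kappa> = "k0 + 5" and M = "4 * (M + 1)"])
    show "m > 0" "4 * (M + 1) > 0" using m by auto
    show "finite {K. P K \<and> real_of_int \<bar>discriminant K\<bar> \<le> x}" for x
      by (rule finite_subset[OF _ finite_number_fields[of x]]) (use P in blast)
    show "{K. P K \<and> real_of_int \<bar>discriminant K\<bar> \<le> x} \<subseteq> {K. P K \<and> real_of_int \<bar>discriminant K\<bar> \<le> y}"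
      if "x \<le> y" for x y using that by auto
    show "discriminant K \<noteq> 0 \<and> real_of_int \<bar>discriminant K\<bar> \<le> x"
      if "K \<in> {K. P K \<and> real_of_int \<bar>discriminant K\<bar> \<le> x}" for x K using that P by blast
    fix q p N :: nat
    assume q: "prime q" and p: "prime p" and k0: "k0 + 5 < q" and qp: "q < p" and pN: "p \<le> N"
    have "k0 < q" using k0 by simp
    then obtain b c z \<sigma> S Q D where D: "family m b c z \<sigma> S Q D" "int p dvd D" "\<not> (int p)\<^sup>2 dvd D"
      "int q dvd D" "\<not> (int q)\<^sup>2 dvd D"
      "\<bar>D\<bar> \<le> int M * int N ^ (2 * m)" "if \<epsilon> = 1 then D < 0 else D > 0"
      using fam[OF q p _ qp pN] by blast
    have pp: "prime (int p)" and pq: "prime (int q)" using p q by auto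
    have "int p \<ge> 5" using k0 qp by simp
    then obtain K where K: "P K" "\<bar>discriminant K\<bar> \<le> 4 * \<bar>D\<bar>"
        "\<And>q. prime q \<Longrightarrow> q dvd D \<Longrightarrow> \<not> q\<^sup>2 dvd D \<Longrightarrow> q dvd discriminant K"
      using ex[OF D(1) pp _ D(2,3,7)] by blast
    have "int M * int N ^ (2 * m) \<le> (int M + 1) * int N ^ (2 * m)" by (intro mult_right_mono) auto
    then have "\<bar>discriminant K\<bar> \<le> 4 * ((int M + 1) * int N ^ (2 * m))" using K(2) D(6) by linarith
    also have "\<dots> = int (4 * (M + 1) * N ^ (2 * m))" by simp
    finally have "real_of_int \<bar>discriminant K\<bar> \<le> real_of_int (int (4 * (M + 1) * N ^ (2 * m)))"
      by (simp only: of_int_le_iff)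
    then have "real_of_int \<bar>discriminant K\<bar> \<le> real (4 * (M + 1) * N ^ (2 * m))" by (simp only: of_int_of_nat_eq)
    then show "\<exists>K\<in>{K. P K \<and> real_of_int \<bar>discriminant K\<bar> \<le> real (4 * (M + 1) * N ^ (2 * m))}.
        int p dvd discriminant K \<and> int q dvd discriminant K"
      using K(1) K(3)[OF pp D(2,3)] K(3)[OF pq D(4,5)] by blast
  qed
qed

lemma discriminant_nonzero:
  assumes "number_field 2 K" shows "discriminant K \<noteq> 0"
proof -
  obtain d s where "quadratic d s" "K = qfield s" using number_field_2E[OF assms] by blast
  then show ?thesis using quadratic.discriminant_K[of d s] quadratic.d_nz[of d s] by (simp add: quadratic.disc_def)
qed

theorem corollary1p4:
  fixes m :: nat
  assumes "m > 1"
  shows "(\<lambda>x. real (N_minus m 2 x)) \<ggreater> (\<lambda>x. x powr (1 / real m) / (ln x)\<^sup>2) \<and>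
         (\<lambda>x. real (N_plus m 1 x)) \<ggreater> (\<lambda>x. x powr (1 / real m) / (ln x)\<^sup>2)"
proof
  define P where "P K \<longleftrightarrow> imaginary_quadratic_field K \<and> enat 2 \<le> m_rank m (class_group K)" for K
  have "(\<lambda>x. real (card {K. P K \<and> real_of_int \<bar>discriminant K\<bar> \<le> x})) \<ggreater> (\<lambda>x. x powr (1 / real m) / (ln x)\<^sup>2)"
  proof (rule field_count_lower_bound[OF assms, of 1])
    show "number_field 2 K \<and> discriminant K \<noteq> 0" if "P K" for K
      using that discriminant_nonzero unfolding P_def imaginary_quadratic_field_def by blast
    fix b c z \<sigma> S Q D p :: int
    assume D: "family m b c z \<sigma> S Q D" "prime p" "p \<ge> 5" "p dvd D" "\<not> p\<^sup>2 dvd D"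
      and "if (1 :: int) = 1 then D < 0 else D > 0"
    then have "D < 0" by simp
    obtain K where K: "D < 0 \<longrightarrow> imaginary_quadratic_field K \<and> enat 2 \<le> m_rank m (class_group K)"
        "D > 0 \<longrightarrow> real_quadratic_field K \<and> enat 1 \<le> m_rank m (class_group K)"
        "discriminant K \<noteq> 0" "\<bar>discriminant K\<bar> \<le> 4 * \<bar>D\<bar>"
        "\<forall>q. prime q \<longrightarrow> q dvd D \<longrightarrow> \<not> q\<^sup>2 dvd D \<longrightarrow> q dvd discriminant K"
      by (rule family_field[OF D])
    have "P K" unfolding P_def using K(1) \<open>D < 0\<close> by (simp only: simp_thms)
    then show "\<exists>K. P K \<and> \<bar>discriminant K\<bar> \<le> 4 * \<bar>D\<bar> \<and>
        (\<forall>q. prime q \<longrightarrow> q dvd D \<longrightarrow> \<not> q\<^sup>2 dvd D \<longrightarrow> q dvd discriminant K)"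
      using K(4,5) by blast
  qed simp
  moreover have "N_minus m 2 x = card {K. P K \<and> real_of_int \<bar>discriminant K\<bar> \<le> x}" for x
    unfolding N_minus_def P_def by (simp only: conj_ac)
  ultimately show "(\<lambda>x. real (N_minus m 2 x)) \<ggreater> (\<lambda>x. x powr (1 / real m) / (ln x)\<^sup>2)" by simp
next
  define P where "P K \<longleftrightarrow> real_quadratic_field K \<and> enat 1 \<le> m_rank m (class_group K)" for K
  have "(\<lambda>x. real (card {K. P K \<and> real_of_int \<bar>discriminant K\<bar> \<le> x})) \<ggreater> (\<lambda>x. x powr (1 / real m) / (ln x)\<^sup>2)"
  proof (rule field_count_lower_bound[OF assms, of "- 1"])
    show "number_field 2 K \<and> discriminant K \<noteq> 0" if "P K" for K
      using that discriminant_nonzero unfolding P_def real_quadratic_field_def by blast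
    fix b c z \<sigma> S Q D p :: int
    assume D: "family m b c z \<sigma> S Q D" "prime p" "p \<ge> 5" "p dvd D" "\<not> p\<^sup>2 dvd D"
      and "if (- 1 :: int) = 1 then D < 0 else D > 0"
    then have "D > 0" by simp
    obtain K where K: "D < 0 \<longrightarrow> imaginary_quadratic_field K \<and> enat 2 \<le> m_rank m (class_group K)"
        "D > 0 \<longrightarrow> real_quadratic_field K \<and> enat 1 \<le> m_rank m (class_group K)"
        "discriminant K \<noteq> 0" "\<bar>discriminant K\<bar> \<le> 4 * \<bar>D\<bar>"
        "\<forall>q. prime q \<longrightarrow> q dvd D \<longrightarrow> \<not> q\<^sup>2 dvd D \<longrightarrow> q dvd discriminant K"
      by (rule family_field[OF D])
    have "P K" unfolding P_def using K(2) \<open>D > 0\<close> by (simp only: simp_thms)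
    then show "\<exists>K. P K \<and> \<bar>discriminant K\<bar> \<le> 4 * \<bar>D\<bar> \<and>
        (\<forall>q. prime q \<longrightarrow> q dvd D \<longrightarrow> \<not> q\<^sup>2 dvd D \<longrightarrow> q dvd discriminant K)"
      using K(4,5) by blast
  qed simp
  moreover have "N_plus m 1 x = card {K. P K \<and> real_of_int \<bar>discriminant K\<bar> \<le> x}" for x
    unfolding N_plus_def P_def by (simp only: conj_ac)
  ultimately show "(\<lambda>x. real (N_plus m 1 x)) \<ggreater> (\<lambda>x. x powr (1 / real m) / (ln x)\<^sup>2)" by simp
qed

end
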